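(* Let $Z=\bigcup_{i=1}^s T_i\subset\mathbb{P}^r$ be a reduced scheme with irreducible components $T_1,\dots,T_s$, all of which are rational varieties of dimension at most $r-2$. Then there is a birational map $\omega:\mathbb{P}^r\dashrightarrow\mathbb{P}^r$ that contracts $Z$ to a set of $s$ distinct points.
   Context: We work over the field of complex numbers $\mathbb{C}$. That $\omega$ contracts $Z=\bigcup_{i=1}^s T_i$ to a set of $s$ distinct points means: $\omega$ is defined at the generic point of each $T_i$, the closure of the image $\omega(T_i)$ is a single point $q_i$, and the points $q_1,\dots,q_s$ are pairwise distinct. A point is regarded as a rational variety of dimension $0$. *)

theory Defs
  imports
    "HOL-Analysis.Analysis"
    "HOL-Library.Poly_Mapping"
    "HOL-Library.Extended_Nat"
begin

section \<open>Polynomials in countably many variables over the complex numbers\<close>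

text \<open>A monomial is its finitely supported exponent vector; addition of exponent vectors is
  multiplication of monomials, so the ring structure of \<open>mpoly\<close> is the one of
  \<^theory>\<open>HOL-Library.Poly_Mapping\<close>.\<close>

type_synonym monom = "nat \<Rightarrow>\<^sub>0 nat"
type_synonym mpoly = "monom \<Rightarrow>\<^sub>0 complex"

definition monom_eval :: "monom \<Rightarrow> (nat \<Rightarrow> complex) \<Rightarrow> complex" where
  "monom_eval m x = (\<Prod>i\<in>Poly_Mapping.keys m. x i ^ Poly_Mapping.lookup m i)"

definition mpoly_eval :: "mpoly \<Rightarrow> (nat \<Rightarrow> complex) \<Rightarrow> complex" where
  "mpoly_eval f x = (\<Sum>m\<in>Poly_Mapping.keys f. Poly_Mapping.lookup f m * monom_eval m x)"

definition monom_degree :: "monom \<Rightarrow> nat" where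
  "monom_degree m = (\<Sum>i\<in>Poly_Mapping.keys m. Poly_Mapping.lookup m i)"

text \<open>Homogeneous of degree \<open>d\<close> in the variables \<open>X\<^sub>0, \<dots>, X\<^sub>n\<close>; the zero polynomial is
  homogeneous of every degree.\<close>

definition hom_poly :: "nat \<Rightarrow> nat \<Rightarrow> mpoly \<Rightarrow> bool" where
  "hom_poly n d f \<longleftrightarrow>
     (\<forall>m\<in>Poly_Mapping.keys f. Poly_Mapping.keys m \<subseteq> {..n} \<and> monom_degree m = d)"

lemma monom_eval_superset:
  assumes "finite A" "Poly_Mapping.keys m \<subseteq> A"
  shows "monom_eval m x = (\<Prod>i\<in>A. x i ^ Poly_Mapping.lookup m i)"
  unfolding monom_eval_def
  by (rule prod.mono_neutral_left) (use assms in \<open>auto simp: in_keys_iff\<close>)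

lemma monom_degree_superset:
  assumes "finite A" "Poly_Mapping.keys m \<subseteq> A"
  shows "monom_degree m = (\<Sum>i\<in>A. Poly_Mapping.lookup m i)"
  unfolding monom_degree_def
  by (rule sum.mono_neutral_left) (use assms in \<open>auto simp: in_keys_iff\<close>)

lemma monom_eval_add: "monom_eval (a + b) x = monom_eval a x * monom_eval b x"
proof -
  let ?A = "Poly_Mapping.keys a \<union> Poly_Mapping.keys b"
  have "Poly_Mapping.keys (a + b) \<subseteq> ?A" by (rule keys_add)
  then show ?thesis
    by (simp add: monom_eval_superset[of ?A] lookup_add power_add prod.distrib)
qed

lemma monom_degree_add: "monom_degree (a + b) = monom_degree a + monom_degree b"
proof -
  let ?A = "Poly_Mapping.keys a \<union> Poly_Mapping.keys b"
  have "Poly_Mapping.keys (a + b) \<subseteq> ?A" by (rule keys_add)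
  then show ?thesis
    by (simp add: monom_degree_superset[of ?A] lookup_add sum.distrib)
qed

lemma mpoly_eval_0 [simp]: "mpoly_eval 0 x = 0"
  by (simp add: mpoly_eval_def)

lemma mpoly_eval_1 [simp]: "mpoly_eval 1 x = 1"
  by (simp add: mpoly_eval_def monom_eval_def)

lemma mpoly_eval_single: "mpoly_eval (Poly_Mapping.single m c) x = c * monom_eval m x"
  by (simp add: mpoly_eval_def)

lemma mpoly_eval_add: "mpoly_eval (f + g) x = mpoly_eval f x + mpoly_eval g x"
  unfolding mpoly_eval_def
  by (rule setsum_keys_plus_distrib) (auto simp: algebra_simps)

lemma update_eq_add_single:
  assumes "a \<notin> Poly_Mapping.keys f"
  shows "Poly_Mapping.update a b f = f + Poly_Mapping.single a b"
  by (rule poly_mapping_eqI)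
    (use assms in \<open>auto simp: lookup_update lookup_add lookup_single in_keys_iff when_def\<close>)

lemma mpoly_eval_single_mult:
  "mpoly_eval (Poly_Mapping.single m c * g) x = c * monom_eval m x * mpoly_eval g x"
proof (induction g rule: update_induct)
  case const
  then show ?case by simp
next
  case (update f a b)
  then show ?case
    by (simp add: update_eq_add_single distrib_left mpoly_eval_add mult_single
        mpoly_eval_single monom_eval_add)
qed

lemma mpoly_eval_mult: "mpoly_eval (f * g) x = mpoly_eval f x * mpoly_eval g x"
proof (induction f rule: update_induct)
  case const
  then show ?case by simp
next
  case (update f a b)
  then show ?case
    by (simp add: update_eq_add_single distrib_right mpoly_eval_add
        mpoly_eval_single mpoly_eval_single_mult)
qed

lemma hom_poly_1: "hom_poly n 0 1"
  by (simp add: hom_poly_def monom_degree_def)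

lemma hom_poly_mult:
  assumes "hom_poly n d f" "hom_poly n e g"
  shows "hom_poly n (d + e) (f * g)"
  unfolding hom_poly_def
proof
  fix m assume "m \<in> Poly_Mapping.keys (f * g)"
  then obtain a b where ab: "m = a + b" "a \<in> Poly_Mapping.keys f" "b \<in> Poly_Mapping.keys g"
    using keys_mult[of f g] by blast
  then show "Poly_Mapping.keys m \<subseteq> {..n} \<and> monom_degree m = d + e"
    using assms keys_add[of a b] unfolding hom_poly_def by (fastforce simp: monom_degree_add)
qed

lemma mpoly_eval_scale:
  assumes "hom_poly n d f"
  shows "mpoly_eval f (\<lambda>i. c * x i) = c ^ d * mpoly_eval f x"
proof -
  have "monom_eval m (\<lambda>i. c * x i) = c ^ d * monom_eval m x" if "m \<in> Poly_Mapping.keys f" for m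
  proof -
    have "d = monom_degree m" using assms that by (simp add: hom_poly_def)
    then show ?thesis
      by (simp add: monom_eval_def monom_degree_def power_mult_distrib prod.distrib power_sum)
  qed
  then show ?thesis
    by (simp add: mpoly_eval_def sum_distrib_left mult_ac)
qed

section \<open>Projective space with its Zariski topology\<close>

text \<open>Homogeneous coordinates on \<open>\<P>\<^sup>n\<close> are the nonzero vectors of \<open>\<complex>\<^sup>n\<^sup>+\<^sup>1\<close>, stored as functions
  on the naturals that vanish beyond \<open>n\<close>. A point is a proportionality class of such vectors.\<close>

definition hom_coords :: "nat \<Rightarrow> (nat \<Rightarrow> complex) set" where
  "hom_coords n = {x. (\<forall>i>n. x i = 0) \<and> (\<exists>i. x i \<noteq> 0)}"

definition proportional :: "nat \<Rightarrow> ((nat \<Rightarrow> complex) \<times> (nat \<Rightarrow> complex)) set" where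
  "proportional n =
     {(x, y). x \<in> hom_coords n \<and> y \<in> hom_coords n \<and> (\<exists>c. c \<noteq> 0 \<and> y = (\<lambda>i. c * x i))}"

type_synonym point = "(nat \<Rightarrow> complex) set"

definition proj_space :: "nat \<Rightarrow> point set" where
  "proj_space n = hom_coords n // proportional n"

definition zero_locus :: "nat \<Rightarrow> mpoly set \<Rightarrow> point set" where
  "zero_locus n S = {p \<in> proj_space n. \<forall>x\<in>p. \<forall>f\<in>S. mpoly_eval f x = 0}"

definition zariski :: "nat \<Rightarrow> point topology" where
  "zariski n = topology (\<lambda>U. U \<subseteq> proj_space n \<and>
     (\<exists>S. (\<forall>f\<in>S. \<exists>d. hom_poly n d f) \<and> proj_space n - U = zero_locus n S))"

lemma equiv_proportional: "equiv (hom_coords n) (proportional n)"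
proof (rule equivI)
  show "proportional n \<subseteq> hom_coords n \<times> hom_coords n"
    by (auto simp: proportional_def)
  show "refl_on (hom_coords n) (proportional n)"
    by (auto simp: refl_on_def proportional_def intro!: exI[of _ 1])
  show "sym (proportional n)"
  proof (rule symI)
    fix x y assume "(x, y) \<in> proportional n"
    then obtain c where c: "x \<in> hom_coords n" "y \<in> hom_coords n" "c \<noteq> 0" "y = (\<lambda>i. c * x i)"
      by (auto simp: proportional_def)
    then have "x = (\<lambda>i. inverse c * y i)" by (simp add: mult.assoc[symmetric])
    with c show "(y, x) \<in> proportional n"
      unfolding proportional_def using nonzero_imp_inverse_nonzero by blast
  qed
  show "trans (proportional n)"
  proof (rule transI)
    fix x y z assume "(x, y) \<in> proportional n" "(y, z) \<in> proportional n"
    then obtain c d where *: "x \<in> hom_coords n" "z \<in> hom_coords n" "c \<noteq> 0" "d \<noteq> 0"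
        "y = (\<lambda>i. c * x i)" "z = (\<lambda>i. d * y i)"
      by (auto simp: proportional_def)
    then have "z = (\<lambda>i. (d * c) * x i)" by (simp add: mult.assoc)
    with * show "(x, z) \<in> proportional n"
      unfolding proportional_def using mult_eq_0_iff[of d c] by blast
  qed
qed

lemma eval_zero_point_iff:
  assumes "p \<in> proj_space n" "x \<in> p" "y \<in> p" "hom_poly n d f"
  shows "mpoly_eval f x = 0 \<longleftrightarrow> mpoly_eval f y = 0"
proof -
  have "(x, y) \<in> proportional n"
    using assms quotient_eq_iff[OF equiv_proportional] unfolding proj_space_def by blast
  then obtain c where "c \<noteq> 0" "y = (\<lambda>i. c * x i)" by (auto simp: proportional_def)
  then show ?thesis using mpoly_eval_scale[OF assms(4), of c x] by simp
qed

lemma istopology_zariski: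
  "istopology (\<lambda>U. U \<subseteq> proj_space n \<and>
     (\<exists>S. (\<forall>f\<in>S. \<exists>d. hom_poly n d f) \<and> proj_space n - U = zero_locus n S))"
  unfolding istopology_def
proof (intro conjI allI impI)
  fix U V
  assume U: "U \<subseteq> proj_space n \<and>
     (\<exists>S. (\<forall>f\<in>S. \<exists>d. hom_poly n d f) \<and> proj_space n - U = zero_locus n S)"
    and V: "V \<subseteq> proj_space n \<and>
     (\<exists>S. (\<forall>f\<in>S. \<exists>d. hom_poly n d f) \<and> proj_space n - V = zero_locus n S)"
  show "U \<inter> V \<subseteq> proj_space n" using U by blast
  obtain S where S: "\<forall>f\<in>S. \<exists>d. hom_poly n d f" "proj_space n - U = zero_locus n S"
    using U by blast
  obtain S' where S': "\<forall>f\<in>S'. \<exists>d. hom_poly n d f" "proj_space n - V = zero_locus n S'"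
    using V by blast
  let ?S = "{f * g | f g. f \<in> S \<and> g \<in> S'}"
  have "\<forall>h\<in>?S. \<exists>d. hom_poly n d h" using S(1) S'(1) hom_poly_mult by fast
  moreover have "zero_locus n S \<union> zero_locus n S' = zero_locus n ?S"
  proof
    show "zero_locus n S \<union> zero_locus n S' \<subseteq> zero_locus n ?S"
      by (auto simp: zero_locus_def mpoly_eval_mult)
    show "zero_locus n ?S \<subseteq> zero_locus n S \<union> zero_locus n S'"
    proof
      fix p assume p: "p \<in> zero_locus n ?S"
      then have pP: "p \<in> proj_space n" by (simp add: zero_locus_def)
      show "p \<in> zero_locus n S \<union> zero_locus n S'"
      proof (rule ccontr)
        assume "p \<notin> zero_locus n S \<union> zero_locus n S'"
        then obtain x f y g where *: "x \<in> p" "f \<in> S" "mpoly_eval f x \<noteq> 0"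
            "y \<in> p" "g \<in> S'" "mpoly_eval g y \<noteq> 0"
          using pP unfolding zero_locus_def by blast
        obtain d where "hom_poly n d g" using S'(1) * by blast
        then have "mpoly_eval g x \<noteq> 0" using eval_zero_point_iff[OF pP] * by blast
        then have "mpoly_eval (f * g) x \<noteq> 0" using * by (simp add: mpoly_eval_mult)
        then show False using p * unfolding zero_locus_def by blast
      qed
    qed
  qed
  ultimately show "\<exists>S. (\<forall>f\<in>S. \<exists>d. hom_poly n d f) \<and> proj_space n - U \<inter> V = zero_locus n S"
    using S S' by (intro exI[of _ ?S]) (auto simp: Diff_Int)
next
  fix K
  assume K: "\<forall>U\<in>K. U \<subseteq> proj_space n \<and>
     (\<exists>S. (\<forall>f\<in>S. \<exists>d. hom_poly n d f) \<and> proj_space n - U = zero_locus n S)"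
  show "\<Union>K \<subseteq> proj_space n" using K by blast
  obtain S where S: "\<And>U. U \<in> K \<Longrightarrow>
      (\<forall>f\<in>S U. \<exists>d. hom_poly n d f) \<and> proj_space n - U = zero_locus n (S U)"
    using K by metis
  have "proj_space n - \<Union>K = zero_locus n (\<Union>U\<in>K. S U)"
  proof -
    have "proj_space n - \<Union>K = {p \<in> proj_space n. \<forall>U\<in>K. p \<in> proj_space n - U}" by blast
    also have "\<dots> = {p \<in> proj_space n. \<forall>U\<in>K. p \<in> zero_locus n (S U)}" using S by blast
    also have "\<dots> = zero_locus n (\<Union>U\<in>K. S U)" by (auto simp: zero_locus_def)
    finally show ?thesis .
  qed
  then show "\<exists>S. (\<forall>f\<in>S. \<exists>d. hom_poly n d f) \<and> proj_space n - \<Union>K = zero_locus n S"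
    using S by (intro exI[of _ "\<Union>U\<in>K. S U"]) blast
qed

lemma openin_zariski:
  "openin (zariski n) U \<longleftrightarrow> U \<subseteq> proj_space n \<and>
     (\<exists>S. (\<forall>f\<in>S. \<exists>d. hom_poly n d f) \<and> proj_space n - U = zero_locus n S)"
  unfolding zariski_def topology_inverse'[OF istopology_zariski] ..

lemma topspace_zariski [simp]: "topspace (zariski n) = proj_space n"
proof
  show "topspace (zariski n) \<subseteq> proj_space n"
    using openin_topspace[of "zariski n"] unfolding openin_zariski by blast
  have "x \<in> hom_coords n \<Longrightarrow> x \<in> proportional n `` {x}" for x
    using equiv_proportional by (rule equiv_class_self)
  then have "zero_locus n {1} = {}"
    by (auto simp: zero_locus_def proj_space_def quotient_def)
  then have "openin (zariski n) (proj_space n)"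
    unfolding openin_zariski using hom_poly_1 by (intro conjI exI[of _ "{1}"]) auto
  then show "proj_space n \<subseteq> topspace (zariski n)" by (rule openin_subset)
qed

lemma closedin_zariski:
  "closedin (zariski n) A \<longleftrightarrow> (\<exists>S. (\<forall>f\<in>S. \<exists>d. hom_poly n d f) \<and> A = zero_locus n S)"
proof -
  have "A \<subseteq> proj_space n \<Longrightarrow> proj_space n - (proj_space n - A) = A" by blast
  moreover have "zero_locus n S \<subseteq> proj_space n" for S by (auto simp: zero_locus_def)
  ultimately show ?thesis
    unfolding closedin_def openin_zariski topspace_zariski by (metis Diff_subset)
qed

section \<open>Irreducibility, components, dimension\<close>

definition irreducible_space :: "'a topology \<Rightarrow> bool" where
  "irreducible_space X \<longleftrightarrow> topspace X \<noteq> {} \<and>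
     (\<forall>A B. closedin X A \<and> closedin X B \<and> A \<union> B = topspace X \<longrightarrow>
        A = topspace X \<or> B = topspace X)"

definition irreducible_in :: "'a topology \<Rightarrow> 'a set \<Rightarrow> bool" where
  "irreducible_in X A \<longleftrightarrow> A \<subseteq> topspace X \<and> irreducible_space (subtopology X A)"

definition irreducible_components :: "'a topology \<Rightarrow> 'a set set" where
  "irreducible_components X =
     {A. irreducible_in X A \<and> (\<forall>B. irreducible_in X B \<and> A \<subseteq> B \<longrightarrow> B = A)}"

text \<open>Krull dimension. The supremum over the empty set is \<open>0\<close> in \<^typ>\<open>enat\<close>, so the empty
  space gets dimension \<open>0\<close>; the definition is only applied to nonempty spaces.\<close>

definition krull_dim :: "'a topology \<Rightarrow> enat" where
  "krull_dim X = (SUP k\<in>{k. \<exists>C. (\<forall>i\<le>k. closedin X (C i) \<and> irreducible_in X (C i)) \<and>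
                                (\<forall>i<k. C i \<subset> C (Suc i))}. enat k)"

definition proj_variety :: "nat \<Rightarrow> point set \<Rightarrow> bool" where
  "proj_variety n X \<longleftrightarrow> closedin (zariski n) X \<and> irreducible_in (zariski n) X"

definition variety_dim :: "nat \<Rightarrow> point set \<Rightarrow> enat" where
  "variety_dim n X = krull_dim (subtopology (zariski n) X)"

section \<open>Rational maps\<close>

text \<open>A partial map from \<open>\<P>\<^sup>n\<close> to \<open>\<P>\<^sup>m\<close> is regular if around each point of its domain it is
  given by forms \<open>F\<^sub>0, \<dots>, F\<^sub>m\<close> of a common degree. The forms have no common zero there, since a
  point of \<open>\<P>\<^sup>m\<close> contains only nonzero vectors.\<close>

definition regular_map :: "nat \<Rightarrow> nat \<Rightarrow> (point \<rightharpoonup> point) \<Rightarrow> bool" where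
  "regular_map n m f \<longleftrightarrow> ran f \<subseteq> proj_space m \<and>
     (\<forall>p\<in>dom f. \<exists>V F d. openin (zariski n) V \<and> p \<in> V \<and> (\<forall>i\<le>m. hom_poly n d (F i)) \<and>
        (\<forall>q\<in>V \<inter> dom f. \<forall>x\<in>q. (\<lambda>i. if i \<le> m then mpoly_eval (F i) x else 0) \<in> the (f q)))"

text \<open>Rational maps from \<open>X \<subseteq> \<P>\<^sup>n\<close> to \<open>Y \<subseteq> \<P>\<^sup>m\<close> are classes of regular maps on nonempty
  open subsets of \<open>X\<close>, two of which are identified if they agree wherever both are defined.\<close>

definition rational_reps :: "nat \<Rightarrow> point set \<Rightarrow> nat \<Rightarrow> point set \<Rightarrow> (point \<rightharpoonup> point) set" where
  "rational_reps n X m Y =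
     {f. openin (subtopology (zariski n) X) (dom f) \<and> dom f \<noteq> {} \<and> ran f \<subseteq> Y \<and>
         regular_map n m f}"

definition rational_eq ::
    "nat \<Rightarrow> point set \<Rightarrow> nat \<Rightarrow> point set \<Rightarrow> ((point \<rightharpoonup> point) \<times> (point \<rightharpoonup> point)) set" where
  "rational_eq n X m Y =
     {(f, g). f \<in> rational_reps n X m Y \<and> g \<in> rational_reps n X m Y \<and>
        (\<forall>p\<in>dom f \<inter> dom g. f p = g p)}"

type_synonym rational_map = "(point \<rightharpoonup> point) set"

definition rational_maps :: "nat \<Rightarrow> point set \<Rightarrow> nat \<Rightarrow> point set \<Rightarrow> rational_map set" where
  "rational_maps n X m Y = rational_reps n X m Y // rational_eq n X m Y"

definition rat_dom :: "rational_map \<Rightarrow> point set" where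
  "rat_dom \<omega> = (\<Union>f\<in>\<omega>. dom f)"

text \<open>The value is unspecified outside \<^term>\<open>rat_dom \<omega>\<close>.\<close>

definition rat_apply :: "rational_map \<Rightarrow> point \<Rightarrow> point" where
  "rat_apply \<omega> p = (THE q. \<exists>f\<in>\<omega>. f p = Some q)"

definition dominant :: "nat \<Rightarrow> point set \<Rightarrow> rational_map \<Rightarrow> bool" where
  "dominant m Y \<omega> \<longleftrightarrow> zariski m closure_of (rat_apply \<omega> ` rat_dom \<omega>) = Y"

text \<open>A birational map is a dominant rational map with a dominant rational inverse. Dominance
  ensures that both composites are defined on a nonempty open set.\<close>

definition birational_maps :: "nat \<Rightarrow> point set \<Rightarrow> nat \<Rightarrow> point set \<Rightarrow> rational_map set" where
  "birational_maps n X m Y =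
     {\<omega> \<in> rational_maps n X m Y. dominant m Y \<omega> \<and>
        (\<exists>\<eta>\<in>rational_maps m Y n X. dominant n X \<eta> \<and>
           (\<forall>p\<in>rat_dom \<omega>. rat_apply \<omega> p \<in> rat_dom \<eta> \<longrightarrow> rat_apply \<eta> (rat_apply \<omega> p) = p) \<and>
           (\<forall>q\<in>rat_dom \<eta>. rat_apply \<eta> q \<in> rat_dom \<omega> \<longrightarrow> rat_apply \<omega> (rat_apply \<eta> q) = q))}"

text \<open>A rational variety of dimension \<open>d\<close> is one that is birational to \<open>\<P>\<^sup>d\<close>. For \<open>d = 0\<close>
  these are the points, as \<open>\<P>\<^sup>0\<close> is a point.\<close>

definition rational_variety :: "nat \<Rightarrow> point set \<Rightarrow> bool" where
  "rational_variety n X \<longleftrightarrow> proj_variety n X \<and>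
     (\<exists>d. variety_dim n X = enat d \<and> birational_maps n X d (proj_space d) \<noteq> {})"

text \<open>A rational map is defined at the generic point of an irreducible closed set iff its
  domain of definition, being open, meets that set.\<close>

definition contracts_to_point :: "nat \<Rightarrow> rational_map \<Rightarrow> point set \<Rightarrow> point \<Rightarrow> bool" where
  "contracts_to_point m \<omega> A q \<longleftrightarrow> A \<inter> rat_dom \<omega> \<noteq> {} \<and>
     zariski m closure_of (rat_apply \<omega> ` (A \<inter> rat_dom \<omega>)) = {q}"

definition contracts_to_distinct_points ::
    "nat \<Rightarrow> rational_map \<Rightarrow> 'i set \<Rightarrow> ('i \<Rightarrow> point set) \<Rightarrow> bool" where
  "contracts_to_distinct_points m \<omega> I T \<longleftrightarrow>
     (\<exists>q. (\<forall>i\<in>I. contracts_to_point m \<omega> (T i) (q i)) \<and> inj_on q I)"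

end

theory Submission
  imports Defs "HOL-Computational_Algebra.Polynomial"
begin

text \<open>A rational variety \<open>T\<^sub>i\<close> of dimension \<open>d \<le> r - 2\<close> is parametrised by forms in \<open>d + 1 < r\<close>
  variables, and \<open>r\<close> such forms are algebraically dependent, so every cone over \<open>T\<^sub>i\<close> lies in a
  hypersurface. Hence the projections of the \<open>T\<^sub>i\<close> from a general point \<open>p\<close> have closures that are
  not dense and none of which contains another. In affine coordinates \<open>(x', x\<^sub>r)\<close>, with \<open>x'\<close> the
  projection from \<open>p\<close>, there are therefore a nonzero function \<open>\<alpha>(x')\<close> vanishing on all \<open>T\<^sub>i\<close> and a
  function \<open>\<beta>(x')\<close> equal to \<open>c\<^sub>i\<close> on \<open>T\<^sub>i\<close>, for any constants \<open>c\<^sub>i\<close>. The substitution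
  \<open>x\<^sub>r \<mapsto> \<alpha> x\<^sub>r + \<beta>\<close> moves \<open>T\<^sub>i\<close> into the hyperplane \<open>x\<^sub>r = c\<^sub>i\<close>, and
  \<open>(x', x\<^sub>r) \<mapsto> (x' (x\<^sub>r - c\<^sub>1) \<cdots> (x\<^sub>r - c\<^sub>s), x\<^sub>r)\<close> contracts these hyperplanes to distinct
  points.\<close>

section \<open>Polynomial functions\<close>

text \<open>It is not enough that projections from \<open>p\<close> differ; they must be separated
  by equations. Let a be a point off T_j, taken on T_i if i differs from j. If \<open>p\<close> is
  off a hypersurface that is a cone with vertex a containing T_j, the line joining \<open>p\<close>
  and a misses T_j. That some polynomial in x' vanishes on the projection of T_j but not at that of
  a is then shown by explicit elimination of the parameter along lines in direction
  \<open>p\<close>, which takes the place of completeness of projective space. The other obstacle is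
  that a rational map is a class of locally given maps: forms that define it on a dense set may all
  vanish at a point where it is defined. Claims about its values are therefore turned into
  polynomial identities, checked where some nonzero polynomial does not vanish, and extended to all
  vectors by cancellation. As only values matter, polynomials are handled as functions of coordinate
  vectors, which makes substitution plain composition.\<close>

inductive polyfun :: "nat \<Rightarrow> ((nat \<Rightarrow> complex) \<Rightarrow> complex) \<Rightarrow> bool" for n where
  polyfun_const: "polyfun n (\<lambda>x. c)"
| polyfun_var: "i \<le> n \<Longrightarrow> polyfun n (\<lambda>x. x i)"
| polyfun_add: "polyfun n f \<Longrightarrow> polyfun n g \<Longrightarrow> polyfun n (\<lambda>x. f x + g x)"
| polyfun_mult: "polyfun n f \<Longrightarrow> polyfun n g \<Longrightarrow> polyfun n (\<lambda>x. f x * g x)"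

text \<open>The zero function counts as a form of every degree, as in \<open>hom_poly\<close>; this
  lets a tuple of forms be padded by zeros.\<close>

inductive hpoly :: "nat \<Rightarrow> nat \<Rightarrow> ((nat \<Rightarrow> complex) \<Rightarrow> complex) \<Rightarrow> bool" for n where
  hpoly_const: "hpoly n 0 (\<lambda>x. c)"
| hpoly_zero: "hpoly n d (\<lambda>x. 0)"
| hpoly_var: "i \<le> n \<Longrightarrow> hpoly n (Suc 0) (\<lambda>x. x i)"
| hpoly_add: "hpoly n d f \<Longrightarrow> hpoly n d g \<Longrightarrow> hpoly n d (\<lambda>x. f x + g x)"
| hpoly_mult: "hpoly n d f \<Longrightarrow> hpoly n e g \<Longrightarrow> hpoly n (d + e) (\<lambda>x. f x * g x)"

lemma hpoly_imp_polyfun: "hpoly n d f \<Longrightarrow> polyfun n f"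
  by (induction rule: hpoly.induct) (auto intro: polyfun.intros)

lemma polyfun_uminus: "polyfun n f \<Longrightarrow> polyfun n (\<lambda>x. - f x)"
  using polyfun_mult[OF polyfun_const[of n "-1"]] by simp

lemma polyfun_diff: "polyfun n f \<Longrightarrow> polyfun n g \<Longrightarrow> polyfun n (\<lambda>x. f x - g x)"
  using polyfun_add[OF _ polyfun_uminus] by (simp add: algebra_simps)

lemma polyfun_sum: "(\<And>i. i \<in> I \<Longrightarrow> polyfun n (f i)) \<Longrightarrow> polyfun n (\<lambda>x. \<Sum>i\<in>I. f i x)"
  by (induction I rule: infinite_finite_induct) (auto intro: polyfun.intros)

lemma polyfun_prod: "(\<And>i. i \<in> I \<Longrightarrow> polyfun n (f i)) \<Longrightarrow> polyfun n (\<lambda>x. \<Prod>i\<in>I. f i x)"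
  by (induction I rule: infinite_finite_induct) (auto intro: polyfun.intros)

lemma polyfun_power: "polyfun n f \<Longrightarrow> polyfun n (\<lambda>x. f x ^ k)"
  by (induction k) (auto intro: polyfun.intros)

lemma polyfun_comp:
  assumes "polyfun m g" "\<And>i. i \<le> m \<Longrightarrow> polyfun n (\<lambda>x. F x i)"
  shows "polyfun n (\<lambda>x. g (F x))"
  using assms by (induction rule: polyfun.induct) (auto intro: polyfun.intros)

lemma polyfun_cong:
  assumes "polyfun n f" "\<And>i. i \<le> n \<Longrightarrow> x i = y i"
  shows "f x = f y"
  using assms by (induction rule: polyfun.induct) auto

lemma hpoly_mult': "hpoly n d f \<Longrightarrow> hpoly n e g \<Longrightarrow> k = d + e \<Longrightarrow> hpoly n k (\<lambda>x. f x * g x)"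
  using hpoly_mult by simp

lemma hpoly_cmult: "hpoly n d f \<Longrightarrow> hpoly n d (\<lambda>x. c * f x)"
  by (rule hpoly_mult'[OF hpoly_const]) auto

lemma hpoly_uminus: "hpoly n d f \<Longrightarrow> hpoly n d (\<lambda>x. - f x)"
  using hpoly_cmult[of n d f "-1"] by simp

lemma hpoly_diff: "hpoly n d f \<Longrightarrow> hpoly n d g \<Longrightarrow> hpoly n d (\<lambda>x. f x - g x)"
  using hpoly_add[OF _ hpoly_uminus] by (simp add: algebra_simps)

lemma hpoly_sum: "(\<And>i. i \<in> I \<Longrightarrow> hpoly n d (f i)) \<Longrightarrow> hpoly n d (\<lambda>x. \<Sum>i\<in>I. f i x)"
  by (induction I rule: infinite_finite_induct) (auto intro: hpoly.intros)

lemma hpoly_prod: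
  "(\<And>i. i \<in> I \<Longrightarrow> hpoly n (d i) (f i)) \<Longrightarrow> hpoly n (\<Sum>i\<in>I. d i) (\<lambda>x. \<Prod>i\<in>I. f i x)"
  by (induction I rule: infinite_finite_induct) (auto intro: hpoly.intros)

lemma hpoly_power: "hpoly n d f \<Longrightarrow> hpoly n (k * d) (\<lambda>x. f x ^ k)"
  by (induction k) (auto intro: hpoly.intros)

lemma hpoly_comp:
  assumes "hpoly m e g" "\<And>i. i \<le> m \<Longrightarrow> hpoly n d (\<lambda>x. F x i)"
  shows "hpoly n (e * d) (\<lambda>x. g (F x))"
  using assms
  by (induction rule: hpoly.induct) (auto intro: hpoly.intros simp: distrib_right)

lemma hpoly_cong:
  assumes "hpoly n d f" "\<And>i. i \<le> n \<Longrightarrow> x i = y i"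
  shows "f x = f y"
  using polyfun_cong[OF hpoly_imp_polyfun] assms by blast

lemma hpoly_scale: "hpoly n d f \<Longrightarrow> f (\<lambda>i. c * x i) = c ^ d * f x"
  by (induction rule: hpoly.induct) (auto simp: algebra_simps power_add)

section \<open>Comparison with formal polynomials\<close>

lemma mpoly_eval_single_var: "mpoly_eval (Poly_Mapping.single (Poly_Mapping.single i (Suc 0)) 1) x = x i"
  by (simp add: mpoly_eval_single monom_eval_def)

lemma hom_poly_add: "hom_poly n d f \<Longrightarrow> hom_poly n d g \<Longrightarrow> hom_poly n d (f + g)"
  using keys_add[of f g] unfolding hom_poly_def by blast

text \<open>The bridge to the definitions of closed sets and regular maps, whose forms are formal
  polynomials. From left to right it needs only that evaluation respects sums and products; from
  right to left an evaluation is expanded into monomials.\<close>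

lemma hpoly_iff: "hpoly n d \<phi> \<longleftrightarrow> (\<exists>f. hom_poly n d f \<and> \<phi> = mpoly_eval f)"
proof
  assume "hpoly n d \<phi>"
  then show "\<exists>f. hom_poly n d f \<and> \<phi> = mpoly_eval f"
  proof (induction rule: hpoly.induct)
    case (hpoly_const c)
    show ?case
      by (rule exI[of _ "Poly_Mapping.single 0 c"])
        (auto simp: hom_poly_def monom_degree_def mpoly_eval_single monom_eval_def fun_eq_iff)
  next
    case (hpoly_zero d)
    show ?case by (rule exI[of _ 0]) (auto simp: hom_poly_def fun_eq_iff)
  next
    case (hpoly_var i)
    then show ?case
      by (intro exI[of _ "Poly_Mapping.single (Poly_Mapping.single i (Suc 0)) 1"])
        (auto simp: hom_poly_def monom_degree_def mpoly_eval_single_var fun_eq_iff)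
  next
    case (hpoly_add d f g)
    then show ?case by (metis (mono_tags) hom_poly_add mpoly_eval_add ext)
  next
    case (hpoly_mult d f e g)
    then show ?case by (metis (mono_tags) hom_poly_mult mpoly_eval_mult ext)
  qed
next
  assume "\<exists>f. hom_poly n d f \<and> \<phi> = mpoly_eval f"
  then obtain f where f: "hom_poly n d f" "\<phi> = mpoly_eval f" by blast
  have "hpoly n d (\<lambda>x. \<Sum>m\<in>Poly_Mapping.keys f. Poly_Mapping.lookup f m * monom_eval m x)"
  proof (intro hpoly_sum hpoly_cmult)
    fix m assume m: "m \<in> Poly_Mapping.keys f"
    then have "hpoly n (\<Sum>i\<in>Poly_Mapping.keys m. Poly_Mapping.lookup m i * Suc 0) (monom_eval m)"
      unfolding monom_eval_def using f by (intro hpoly_prod hpoly_power hpoly_var) (auto simp: hom_poly_def)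
    then show "hpoly n d (monom_eval m)"
      using f m by (auto simp: hom_poly_def monom_degree_def)
  qed
  then show "hpoly n d \<phi>" by (simp add: f mpoly_eval_def[abs_def])
qed

lemma polyfun_decompose:
  assumes "polyfun n f"
  shows "\<exists>N \<psi>. (\<forall>d. hpoly n d (\<psi> d)) \<and> (\<forall>x. f x = (\<Sum>d<N. \<psi> d x))"
  using assms
proof (induction rule: polyfun.induct)
  case (polyfun_const c)
  show ?case
    by (rule exI[of _ 1], rule exI[of _ "\<lambda>d x. if d = 0 then c else 0"]) (auto intro: hpoly.intros)
next
  case (polyfun_var i)
  have "hpoly n d (\<lambda>x. if d = 1 then x i else 0)" for d
    using polyfun_var by (cases "d = 1") (auto intro: hpoly.intros)
  then show ?case
    by (intro exI[of _ 2] exI[of _ "\<lambda>d x. if d = 1 then x i else 0"]) (auto simp: eval_nat_numeral)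
next
  case (polyfun_add f g)
  then obtain N \<psi> M \<xi> where *: "\<forall>d. hpoly n d (\<psi> d)" "\<forall>x. f x = (\<Sum>d<N. \<psi> d x)"
    "\<forall>d. hpoly n d (\<xi> d)" "\<forall>x. g x = (\<Sum>d<M. \<xi> d x)" by blast
  \<comment> \<open>The components beyond \<open>N\<close> and \<open>M\<close> are left out of the
    two sums but may be nonzero, so each family is cut off at its own bound.\<close>
  let ?\<theta> = "\<lambda>d x. (if d < N then \<psi> d x else 0) + (if d < M then \<xi> d x else 0)"
  have "hpoly n d (?\<theta> d)" for d
    using * by (cases "d < N"; cases "d < M") (auto intro: hpoly.intros)
  moreover have "f x + g x = (\<Sum>d<max N M. ?\<theta> d x)" for x
  proof -
    have "(\<Sum>d<N. \<psi> d x) = (\<Sum>d<max N M. if d < N then \<psi> d x else 0)"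
      by (rule sum.mono_neutral_cong_left) auto
    moreover have "(\<Sum>d<M. \<xi> d x) = (\<Sum>d<max N M. if d < M then \<xi> d x else 0)"
      by (rule sum.mono_neutral_cong_left) auto
    ultimately show ?thesis using * by (simp add: sum.distrib)
  qed
  ultimately show ?case by (intro exI[of _ "max N M"] exI[of _ ?\<theta>]) blast
next
  case (polyfun_mult f g)
  then obtain N \<psi> M \<xi> where *: "\<forall>d. hpoly n d (\<psi> d)" "\<forall>x. f x = (\<Sum>d<N. \<psi> d x)"
    "\<forall>d. hpoly n d (\<xi> d)" "\<forall>x. g x = (\<Sum>d<M. \<xi> d x)" by blast
  let ?A = "{..<N} \<times> {..<M}"
  let ?\<theta> = "\<lambda>k x. \<Sum>p\<in>{p \<in> ?A. fst p + snd p = k}. \<psi> (fst p) x * \<xi> (snd p) x"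
  have "hpoly n k (?\<theta> k)" for k
    using * by (intro hpoly_sum) (auto intro: hpoly.intros)
  moreover have "f x * g x = (\<Sum>k<N+M. ?\<theta> k x)" for x
  proof -
    have "f x * g x = (\<Sum>p\<in>?A. \<psi> (fst p) x * \<xi> (snd p) x)"
      using * by (simp add: sum_product sum.cartesian_product split_def)
    also have "\<dots> = (\<Sum>k<N+M. ?\<theta> k x)"
      by (rule sum.group[symmetric]) auto
    finally show ?thesis .
  qed
  ultimately show ?case by (intro exI[of _ "N + M"] exI[of _ ?\<theta>]) blast
qed

lemma coeff_mult_top:
  fixes P Q :: "complex poly"
  assumes "degree P \<le> d" "degree Q \<le> e"
  shows "coeff (P * Q) (d + e) = coeff P d * coeff Q e"
proof -
  have "coeff (P * Q) (d + e) = (\<Sum>i\<le>d + e. coeff P i * coeff Q (d + e - i))"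
    by (rule coeff_mult)
  also have "\<dots> = (\<Sum>i\<in>{d}. coeff P i * coeff Q (d + e - i))"
  proof (rule sum.mono_neutral_right)
    show "\<forall>i\<in>{..d + e} - {d}. coeff P i * coeff Q (d + e - i) = 0"
    proof
      fix i assume i: "i \<in> {..d + e} - {d}"
      show "coeff P i * coeff Q (d + e - i) = 0"
      proof (cases "i < d")
        case True
        then show ?thesis using assms by (simp add: coeff_eq_0)
      next
        case False
        then have "i > d" using i by auto
        then show ?thesis using assms by (simp add: coeff_eq_0)
      qed
    qed
  qed auto
  finally show ?thesis by simp
qed

text \<open>Restriction to the line through x in direction p. The coefficient in degree d does not
  depend on x; if it is nonzero, an equation f = 0 becomes an integral equation for t over the
  functions of x.\<close>

lemma hpoly_expand:
  assumes "hpoly n d f"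
  shows "\<exists>Q. \<forall>x. (\<forall>t. poly (Q x) t = f (\<lambda>i. x i + t * p i)) \<and> degree (Q x) \<le> d \<and>
           coeff (Q x) d = f p \<and> (\<forall>l. polyfun n (\<lambda>x. coeff (Q x) l))"
  using assms
proof (induction rule: hpoly.induct)
  case (hpoly_const c)
  have "polyfun n (\<lambda>x. coeff [:c:] l)" for l by (intro polyfun.intros)
  then show ?case by (intro exI[of _ "\<lambda>x. [:c:]"]) auto
next
  case (hpoly_zero d)
  have "polyfun n (\<lambda>x. coeff 0 l)" for l by (intro polyfun.intros)
  then show ?case by (intro exI[of _ "\<lambda>x. 0"]) auto
next
  case (hpoly_var i)
  have "polyfun n (\<lambda>x. coeff [:x i, p i:] l)" for l
  proof (cases "l = 0 \<or> l = 1")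
    case True
    then show ?thesis using hpoly_var by (auto intro: polyfun.intros)
  next
    case False
    then have "coeff [:x i, p i:] l = 0" for x :: "nat \<Rightarrow> complex" by (simp add: coeff_eq_0)
    then show ?thesis by (simp add: polyfun_const)
  qed
  then show ?case by (intro exI[of _ "\<lambda>x. [:x i, p i:]"]) auto
next
  case (hpoly_add d f g)
  then obtain Q R where
    "\<forall>x. (\<forall>t. poly (Q x) t = f (\<lambda>i. x i + t * p i)) \<and> degree (Q x) \<le> d \<and>
           coeff (Q x) d = f p \<and> (\<forall>l. polyfun n (\<lambda>x. coeff (Q x) l))"
    "\<forall>x. (\<forall>t. poly (R x) t = g (\<lambda>i. x i + t * p i)) \<and> degree (R x) \<le> d \<and>
           coeff (R x) d = g p \<and> (\<forall>l. polyfun n (\<lambda>x. coeff (R x) l))" by blast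
  then show ?case
    by (intro exI[of _ "\<lambda>x. Q x + R x"]) (auto intro: polyfun.intros degree_add_le)
next
  case (hpoly_mult d f e g)
  then obtain Q R where *:
    "\<forall>x. (\<forall>t. poly (Q x) t = f (\<lambda>i. x i + t * p i)) \<and> degree (Q x) \<le> d \<and>
           coeff (Q x) d = f p \<and> (\<forall>l. polyfun n (\<lambda>x. coeff (Q x) l))"
    "\<forall>x. (\<forall>t. poly (R x) t = g (\<lambda>i. x i + t * p i)) \<and> degree (R x) \<le> e \<and>
           coeff (R x) e = g p \<and> (\<forall>l. polyfun n (\<lambda>x. coeff (R x) l))" by blast
  then have "polyfun n (\<lambda>x. coeff (Q x * R x) l)" for l
    unfolding coeff_mult by (intro polyfun_sum polyfun_mult) auto
  moreover have "degree (Q x * R x) \<le> d + e" for x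
    using degree_mult_le[of "Q x" "R x"] * by (meson add_mono le_trans)
  ultimately show ?case using *
    by (intro exI[of _ "\<lambda>x. Q x * R x"]) (auto simp: coeff_mult_top)
qed

section \<open>Density of nonvanishing sets\<close>

lemma polyfun_on_line:
  assumes "polyfun n f"
  shows "\<exists>Q. \<forall>t. f (\<lambda>i. x i + t * (y i - x i)) = poly Q t"
  using assms
proof (induction rule: polyfun.induct)
  case (polyfun_const c)
  show ?case by (intro exI[of _ "[:c:]"]) auto
next
  case (polyfun_var i)
  show ?case by (intro exI[of _ "[:x i, y i - x i:]"]) auto
next
  case (polyfun_add f g)
  then show ?case by (metis poly_add)
next
  case (polyfun_mult f g)
  then show ?case by (metis poly_mult)
qed

text \<open>On the line from x to y both restrictions are nonzero polynomials in t, one by its value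
  at 0 and the other by its value at 1, and their product has a non-root.\<close>

lemma polyfun_no_zero_divisors:
  assumes f: "polyfun n f" and g: "polyfun n g" and "f x \<noteq> 0" "g y \<noteq> 0"
  shows "\<exists>z. f z \<noteq> 0 \<and> g z \<noteq> 0"
proof -
  obtain P where P: "\<And>t. f (\<lambda>i. x i + t * (y i - x i)) = poly P t"
    using polyfun_on_line[OF f] by blast
  obtain Q where Q: "\<And>t. g (\<lambda>i. x i + t * (y i - x i)) = poly Q t"
    using polyfun_on_line[OF g] by blast
  have "poly P 0 \<noteq> 0" "poly Q 1 \<noteq> 0" using assms P[of 0] Q[of 1] by auto
  then have "P * Q \<noteq> 0" by auto
  then obtain t where "poly (P * Q) t \<noteq> 0" using poly_all_0_iff_0 by blast
  then show ?thesis using P Q by (metis mult_eq_0_iff poly_mult)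
qed

text \<open>This is the form in which density is used below: an identity g = 0 need only be checked
  where f is nonzero.\<close>

lemma polyfun_cancel:
  assumes "polyfun n f" "polyfun n g" "f x \<noteq> 0" "\<And>z. f z \<noteq> 0 \<Longrightarrow> g z = 0"
  shows "g y = 0"
  using polyfun_no_zero_divisors[OF assms(1,2,3)] assms(4) by blast

lemma polyfun_finite_nonzero:
  assumes "finite I" "\<And>i. i \<in> I \<Longrightarrow> polyfun n (f i) \<and> (\<exists>x. f i x \<noteq> 0)"
  shows "\<exists>x. \<forall>i\<in>I. f i x \<noteq> 0"
  using assms
proof (induction I rule: finite_induct)
  case (insert j I)
  then obtain x y where "\<forall>i\<in>I. f i x \<noteq> 0" "f j y \<noteq> 0" by blast
  moreover have "polyfun n (\<lambda>x. \<Prod>i\<in>I. f i x)" "polyfun n (f j)"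
    using insert by (auto intro: polyfun_prod)
  ultimately obtain z where "(\<Prod>i\<in>I. f i z) \<noteq> 0 \<and> f j z \<noteq> 0"
    using polyfun_no_zero_divisors[of n "\<lambda>x. \<Prod>i\<in>I. f i x" "f j" x y] insert(1) by auto
  then show ?case using insert(1) by auto
qed auto

text \<open>Along the multiples c x of a vector, h is a polynomial in c whose coefficients are the
  values of the homogeneous components at x. If it vanishes for all nonzero c, each component
  vanishes at x.\<close>

lemma polyfun_component:
  assumes h: "polyfun n h" and S: "\<And>x c. x \<in> S \<Longrightarrow> c \<noteq> 0 \<Longrightarrow> h (\<lambda>i. c * x i) = 0" and b: "h b \<noteq> 0"
  shows "\<exists>d g. hpoly n d g \<and> (\<forall>x\<in>S. g x = 0) \<and> g b \<noteq> 0"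
proof -
  obtain N \<psi> where \<psi>: "\<And>d. hpoly n d (\<psi> d)" "\<And>x. h x = (\<Sum>d<N. \<psi> d x)"
    using polyfun_decompose[OF h] by blast
  have "\<exists>d<N. \<psi> d b \<noteq> 0"
    using b \<psi>(2)[of b] by (metis lessThan_iff sum.neutral)
  then obtain d where d: "d < N" "\<psi> d b \<noteq> 0" by blast
  have "\<psi> d x = 0" if x: "x \<in> S" for x
  proof -
    define P where "P = (\<Sum>d<N. Polynomial.monom (\<psi> d x) d)"
    have "poly P c = h (\<lambda>i. c * x i)" for c
      by (simp add: P_def \<psi>(2) hpoly_scale[OF \<psi>(1)] poly_sum poly_monom mult.commute)
    \<comment> \<open>The extra factor c covers c = 0, about which the hypothesis says
      nothing.\<close>
    then have "poly ([:0, 1:] * P) c = 0" for c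
      using S[OF x, of c] by (cases "c = 0") auto
    then have "[:0, 1:] * P = 0" using poly_all_0_iff_0 by blast
    then have "P = 0" by auto
    moreover have "coeff P d = \<psi> d x"
      using d by (simp add: P_def coeff_sum)
    ultimately show ?thesis by simp
  qed
  then show ?thesis using \<psi>(1) d(2) by blast
qed

section \<open>Algebraic dependence\<close>

text \<open>An equation with a nonzero coefficient at \<open>j0\<close> is solved for that unknown,
  which leaves one equation and one unknown less.\<close>

lemma underdetermined_system:
  fixes M :: "'i \<Rightarrow> 'j \<Rightarrow> 'a :: field"
  assumes "finite I" "finite J" "card I < card J"
  shows "\<exists>x. (\<exists>j\<in>J. x j \<noteq> 0) \<and> (\<forall>i\<in>I. (\<Sum>j\<in>J. M i j * x j) = 0)"
  using assms
proof (induction I arbitrary: J M rule: finite_induct)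
  case empty
  then have "J \<noteq> {}" by auto
  then show ?case by (intro exI[of _ "\<lambda>_. 1"]) auto
next
  case (insert i I)
  show ?case
  proof (cases "\<forall>j\<in>J. M i j = 0")
    case True
    have "card I < card J" using insert by auto
    then obtain x where "\<exists>j\<in>J. x j \<noteq> 0" "\<forall>i\<in>I. (\<Sum>j\<in>J. M i j * x j) = 0"
      using insert.IH[OF insert.prems(1)] by blast
    then show ?thesis using True by (intro exI[of _ x]) (auto intro: sum.neutral)
  next
    case False
    then obtain j0 where j0: "j0 \<in> J" "M i j0 \<noteq> 0" by blast
    let ?J = "J - {j0}"
    have "card I < card ?J" using insert j0 by (simp add: card_Diff_singleton)
    then obtain x where x: "\<exists>j\<in>?J. x j \<noteq> 0"
      "\<And>k. k \<in> I \<Longrightarrow> (\<Sum>j\<in>?J. (M k j - M k j0 * M i j / M i j0) * x j) = 0"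
      using insert.IH[of ?J "\<lambda>k j. M k j - M k j0 * M i j / M i j0"] insert.prems(1) by blast
    define y where "y = x(j0 := - (\<Sum>j\<in>?J. M i j * x j) / M i j0)"
    have split: "(\<Sum>j\<in>J. M k j * y j) = M k j0 * y j0 + (\<Sum>j\<in>?J. M k j * x j)" for k
      using j0 insert.prems(1) by (simp add: sum.remove[of J j0] y_def)
    have "(\<Sum>j\<in>J. M i j * y j) = 0"
      unfolding split using j0 by (simp add: y_def)
    moreover have "(\<Sum>j\<in>J. M k j * y j) = 0" if "k \<in> I" for k
    proof -
      have "(\<Sum>j\<in>?J. M k j * x j) - M k j0 * (\<Sum>j\<in>?J. M i j * x j) / M i j0 = 0"
        using x(2)[OF that]
        by (simp add: left_diff_distrib sum_subtractf sum_distrib_left sum_divide_distrib mult.assoc)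
      then show ?thesis unfolding split by (simp add: y_def)
    qed
    moreover have "\<exists>j\<in>J. y j \<noteq> 0" using x(1) by (auto simp: y_def)
    ultimately show ?thesis by (intro exI[of _ y]) auto
  qed
qed

lemma sum_digits: "(\<Sum>i<r. (n div B ^ i mod B) * B ^ i) = n mod B ^ r" for n B r :: nat
proof (induction r)
  case (Suc r)
  have "n mod B ^ Suc r = B ^ r * (n div B ^ r mod B) + n mod B ^ r"
    by (metis mod_mult2_eq power_Suc2)
  then show ?case using Suc by (simp add: mult.commute)
qed auto

section \<open>Products of forms and a count of monomials\<close>

lemma hom_poly_power: "hom_poly n d f \<Longrightarrow> hom_poly n (k * d) (f ^ k)"
  by (induction k) (auto intro: hom_poly_1 hom_poly_mult)

lemma hom_poly_prod:
  "(\<And>i. i \<in> I \<Longrightarrow> hom_poly n (d i) (f i)) \<Longrightarrow> hom_poly n (\<Sum>i\<in>I. d i) (\<Prod>i\<in>I. f i)"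
  by (induction I rule: infinite_finite_induct) (auto intro: hom_poly_1 hom_poly_mult)

lemma mpoly_eval_power: "mpoly_eval (f ^ k) x = mpoly_eval f x ^ k"
  by (induction k) (auto simp: mpoly_eval_mult)

lemma mpoly_eval_prod: "mpoly_eval (\<Prod>i\<in>I. f i) x = (\<Prod>i\<in>I. mpoly_eval (f i) x)"
  by (induction I rule: infinite_finite_induct) (auto simp: mpoly_eval_mult)

lemma mpoly_eval_superset:
  assumes "finite A" "Poly_Mapping.keys f \<subseteq> A"
  shows "mpoly_eval f x = (\<Sum>m\<in>A. Poly_Mapping.lookup f m * monom_eval m x)"
  unfolding mpoly_eval_def
  by (rule sum.mono_neutral_left) (use assms in \<open>auto simp: in_keys_iff\<close>)

lemma lookup_le_monom_degree: "Poly_Mapping.lookup m i \<le> monom_degree m"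
proof (cases "i \<in> Poly_Mapping.keys m")
  case True
  then show ?thesis unfolding monom_degree_def by (intro member_le_sum) auto
qed (simp add: in_keys_iff)

text \<open>A crude count by boxes of exponents is enough: what matters is that it grows in D with
  the exponent d + 1, which is less than r in the application.\<close>

lemma bounded_monoms:
  fixes d D :: nat
  defines "A \<equiv> {m :: nat \<Rightarrow>\<^sub>0 nat. Poly_Mapping.keys m \<subseteq> {..d} \<and> (\<forall>i. Poly_Mapping.lookup m i \<le> D)}"
  shows "finite A" "card A \<le> (D + 1) ^ (d + 1)"
proof -
  let ?h = "\<lambda>m :: nat \<Rightarrow>\<^sub>0 nat. restrict (Poly_Mapping.lookup m) {..d}"
  have inj: "inj_on ?h A"
  proof (rule inj_onI, rule poly_mapping_eqI)
    fix m m' i assume m: "m \<in> A" "m' \<in> A" "?h m = ?h m'"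
    show "Poly_Mapping.lookup m i = Poly_Mapping.lookup m' i"
    proof (cases "i \<le> d")
      case True
      then show ?thesis using m(3) by (metis atMost_iff restrict_apply')
    next
      case False
      then have "i \<notin> Poly_Mapping.keys m" "i \<notin> Poly_Mapping.keys m'" using m(1,2) by (auto simp: A_def)
      then show ?thesis by (simp add: in_keys_iff)
    qed
  qed
  have sub: "?h ` A \<subseteq> {..d} \<rightarrow>\<^sub>E {..D}"
    unfolding A_def by (intro image_subsetI restrict_PiE_iff[THEN iffD2]) auto
  have fin: "finite ({..d} \<rightarrow>\<^sub>E {..D})" by (intro finite_PiE) auto
  show "finite A" using inj sub fin by (meson finite_imageD finite_subset)
  have "card A \<le> card ({..d} \<rightarrow>\<^sub>E {..D})" by (rule card_inj_on_le[OF inj sub fin])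
  then show "card A \<le> (D + 1) ^ (d + 1)" by (simp add: card_PiE)
qed

text \<open>There are more monomials of degree at most \<open>k\<close> in each of the \<open>r\<close> forms than there are
  monomials in \<open>d + 1\<close> variables to expand them in. The relation found is nonzero because the
  substitution \<open>y\<^sub>i = y\<^bsup>(k + 1)^i\<^esup>\<close> separates these monomials.\<close>

lemma forms_dependent:
  assumes \<phi>: "\<And>i. i < r \<Longrightarrow> hom_poly d e (\<phi> i)" and dr: "d + 1 < r"
  shows "\<exists>G. polyfun (r - 1) G \<and> (\<exists>Y. G Y \<noteq> 0) \<and> (\<forall>t. G (\<lambda>i. mpoly_eval (\<phi> i) t) = 0)"
proof -
  \<comment> \<open>At most (D + 1) ^ (d + 1) monomials occur, and D + 1 \<le> (r * e + 1) * B. With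
    this k the bound becomes k * B ^ (d + 1) < B ^ (d + 2) \<le> B ^ r, so there are fewer equations
    than unknowns.\<close>
  define k where "k = (r * e + 1) ^ (d + 1)"
  define B where "B = k + 1"
  define D where "D = r * k * e"
  \<comment> \<open>Exponent vectors of monomials in r letters are encoded as numbers n < B ^ r, the
    exponents being the digits in base B.\<close>
  define dig where "dig n i = n div B ^ i mod B" for n i
  define f where "f n = (\<Prod>i<r. \<phi> i ^ dig n i)" for n
  define A where "A = {m :: nat \<Rightarrow>\<^sub>0 nat. Poly_Mapping.keys m \<subseteq> {..d} \<and> (\<forall>i. Poly_Mapping.lookup m i \<le> D)}"
  have A: "finite A" "card A \<le> (D + 1) ^ (d + 1)"
    unfolding A_def by (rule bounded_monoms)+
  have dig: "dig n i \<le> k" for n i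
    unfolding dig_def B_def by (simp add: less_Suc_eq_le[symmetric])
  have keys: "Poly_Mapping.keys (f n) \<subseteq> A" for n
  proof
    fix m assume m: "m \<in> Poly_Mapping.keys (f n)"
    have "hom_poly d (\<Sum>i<r. dig n i * e) (f n)"
      unfolding f_def using \<phi> by (intro hom_poly_prod hom_poly_power) auto
    then have *: "Poly_Mapping.keys m \<subseteq> {..d}" "monom_degree m = (\<Sum>i<r. dig n i * e)"
      using m by (auto simp: hom_poly_def)
    have "(\<Sum>i<r. dig n i * e) \<le> (\<Sum>i<r. k * e)"
      by (intro sum_mono mult_right_mono dig) auto
    then have "monom_degree m \<le> D" using * by (simp add: D_def)
    then show "m \<in> A" using * lookup_le_monom_degree[of m] by (auto simp: A_def intro: order_trans)
  qed
  have "D + 1 \<le> (r * e + 1) * B" by (simp add: D_def B_def algebra_simps)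
  then have "(D + 1) ^ (d + 1) \<le> ((r * e + 1) * B) ^ (d + 1)" by (intro power_mono) auto
  also have "\<dots> = k * B ^ (d + 1)" by (simp only: k_def power_mult_distrib)
  also have "\<dots> < B * B ^ (d + 1)" by (intro mult_strict_right_mono) (auto simp: B_def)
  also have "\<dots> = B ^ (d + 2)" by simp
  also have "\<dots> \<le> B ^ r" using dr by (intro power_increasing) (auto simp: B_def)
  finally have "card A < card {..<B ^ r}" using A(2) by simp
  then obtain x where x: "\<exists>n\<in>{..<B ^ r}. x n \<noteq> 0"
    "\<And>m. m \<in> A \<Longrightarrow> (\<Sum>n<B ^ r. Poly_Mapping.lookup (f n) m * x n) = 0"
    using underdetermined_system[of A "{..<B ^ r}" "\<lambda>m n. Poly_Mapping.lookup (f n) m"] A(1) by blast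
  define G where "G Y = (\<Sum>n<B ^ r. x n * (\<Prod>i<r. Y i ^ dig n i))" for Y :: "nat \<Rightarrow> complex"
  have "polyfun (r - 1) G"
    unfolding G_def[abs_def]
    by (intro polyfun_sum polyfun_mult polyfun_prod polyfun_power polyfun_const polyfun_var) auto
  moreover have "G (\<lambda>i. mpoly_eval (\<phi> i) t) = 0" for t
  proof -
    have "G (\<lambda>i. mpoly_eval (\<phi> i) t) = (\<Sum>n<B ^ r. x n * mpoly_eval (f n) t)"
      by (simp add: G_def f_def mpoly_eval_prod mpoly_eval_power)
    also have "\<dots> = (\<Sum>n<B ^ r. \<Sum>m\<in>A. monom_eval m t * (Poly_Mapping.lookup (f n) m * x n))"
      by (simp add: mpoly_eval_superset[OF A(1) keys] sum_distrib_left mult_ac)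
    also have "\<dots> = (\<Sum>m\<in>A. monom_eval m t * (\<Sum>n<B ^ r. Poly_Mapping.lookup (f n) m * x n))"
      by (subst sum.swap) (simp add: sum_distrib_left)
    also have "\<dots> = 0" using x(2) by simp
    finally show ?thesis .
  qed
  moreover have "\<exists>Y. G Y \<noteq> 0"
  proof -
    obtain n0 where n0: "n0 < B ^ r" "x n0 \<noteq> 0" using x(1) by auto
    define P where "P = (\<Sum>n<B ^ r. Polynomial.monom (x n) n)"
    have "coeff P n0 = x n0" using n0 by (simp add: P_def coeff_sum)
    then have "P \<noteq> 0" using n0 by auto
    then obtain y where y: "poly P y \<noteq> 0" using poly_all_0_iff_0 by blast
    have "G (\<lambda>i. y ^ (B ^ i)) = poly P y"
    proof -
      have "(\<Prod>i<r. (y ^ (B ^ i)) ^ dig n i) = y ^ n" if "n < B ^ r" for n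
        using sum_digits[of n B r] that
        by (simp add: power_mult[symmetric] power_sum[symmetric] dig_def mult.commute)
      then show ?thesis by (simp add: G_def P_def poly_sum poly_monom)
    qed
    then show ?thesis using y by metis
  qed
  ultimately show ?thesis by blast
qed

section \<open>Points and forms\<close>

text \<open>Vanishing of all 2 x 2 minors. Unlike proportionality this is a polynomial condition, so
  it extends from a dense set; it also holds when one of the vectors is zero.\<close>

definition parallel :: "(nat \<Rightarrow> complex) \<Rightarrow> (nat \<Rightarrow> complex) \<Rightarrow> bool" where
  "parallel x y \<longleftrightarrow> (\<forall>i j. x i * y j = x j * y i)"

lemma parallelD:
  assumes "parallel x y"
  shows "x i * y j = x j * y i"
  using assms[unfolded parallel_def, THEN spec, THEN spec] .

definition pt :: "nat \<Rightarrow> (nat \<Rightarrow> complex) \<Rightarrow> point" where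
  "pt n x = proportional n `` {x}"

lemma pt_self: "x \<in> hom_coords n \<Longrightarrow> x \<in> pt n x"
  unfolding pt_def using equiv_proportional by (rule equiv_class_self)

lemma pt_in_proj_space: "x \<in> hom_coords n \<Longrightarrow> pt n x \<in> proj_space n"
  unfolding pt_def proj_space_def by (rule quotientI)

lemma proj_space_nonempty: "p \<in> proj_space n \<Longrightarrow> \<exists>x. x \<in> p"
  unfolding proj_space_def using in_quotient_imp_non_empty[OF equiv_proportional] by blast

lemma point_coords: "p \<in> proj_space n \<Longrightarrow> x \<in> p \<Longrightarrow> x \<in> hom_coords n"
  unfolding proj_space_def using in_quotient_imp_subset[OF equiv_proportional] by blast

lemma point_eq_pt:
  assumes "p \<in> proj_space n" "x \<in> p"
  shows "p = pt n x"
proof -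
  obtain z where z: "p = proportional n `` {z}" using assms(1) by (auto simp: proj_space_def quotient_def)
  then have "(z, x) \<in> proportional n" using assms(2) by simp
  then show ?thesis unfolding z pt_def by (rule equiv_class_eq[OF equiv_proportional])
qed

lemma mem_pt_iff:
  "x \<in> hom_coords n \<Longrightarrow> y \<in> pt n x \<longleftrightarrow> (\<exists>c. c \<noteq> 0 \<and> y = (\<lambda>i. c * x i))"
  by (auto simp: pt_def proportional_def hom_coords_def)

lemma point_scale: "p \<in> proj_space n \<Longrightarrow> x \<in> p \<Longrightarrow> c \<noteq> 0 \<Longrightarrow> (\<lambda>i. c * x i) \<in> p"
  using point_eq_pt[of p n x] mem_pt_iff[of x n] point_coords by blast

lemma point_same:
  assumes "p \<in> proj_space n" "x \<in> p" "y \<in> p"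
  shows "\<exists>c. c \<noteq> 0 \<and> y = (\<lambda>i. c * x i)"
  using assms point_eq_pt[of p n x] mem_pt_iff[of x n y] point_coords by blast

lemma point_parallel: "p \<in> proj_space n \<Longrightarrow> x \<in> p \<Longrightarrow> y \<in> p \<Longrightarrow> parallel x y"
  using point_same[of p n x y] by (auto simp: parallel_def)

lemma parallel_points_eq:
  assumes "p \<in> proj_space n" "q \<in> proj_space n" "x \<in> p" "y \<in> q" "parallel x y"
  shows "p = q"
proof -
  have x: "x \<in> hom_coords n" and y: "y \<in> hom_coords n" using assms point_coords by blast+
  then obtain j where j: "x j \<noteq> 0" by (auto simp: hom_coords_def)
  have *: "y i = (y j / x j) * x i" for i
  proof -
    have "x i * y j = x j * y i" by (rule parallelD[OF assms(5)])
    then show ?thesis using j by (simp add: field_simps)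
  qed
  have "y j \<noteq> 0"
  proof
    assume "y j = 0"
    then have "y i = 0" for i using *[of i] by simp
    then show False using y by (auto simp: hom_coords_def)
  qed
  then have "y j / x j \<noteq> 0" using j by simp
  moreover have "y = (\<lambda>i. y j / x j * x i)" by (rule ext) (rule *)
  ultimately have "y \<in> pt n x" unfolding mem_pt_iff[OF x] by blast
  then have "y \<in> p" using point_eq_pt[OF assms(1,3)] by simp
  then show ?thesis using point_eq_pt[OF assms(1)] point_eq_pt[OF assms(2,4)] by metis
qed

text \<open>Vanishing beyond m makes every nonzero value a coordinate vector of the target
  space.\<close>

definition forms :: "nat \<Rightarrow> nat \<Rightarrow> nat \<Rightarrow> ((nat \<Rightarrow> complex) \<Rightarrow> (nat \<Rightarrow> complex)) \<Rightarrow> bool" where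
  "forms n m d F \<longleftrightarrow> (\<forall>i\<le>m. hpoly n d (\<lambda>x. F x i)) \<and> (\<forall>x. \<forall>i>m. F x i = 0)"

lemma forms_hpoly: "forms n m d F \<Longrightarrow> hpoly n d (\<lambda>x. F x i)"
  by (cases "i \<le> m") (auto simp: forms_def hpoly_zero)

lemma forms_polyfun: "forms n m d F \<Longrightarrow> polyfun n (\<lambda>x. F x i)"
  by (rule hpoly_imp_polyfun[OF forms_hpoly])

lemma forms_scale: "forms n m d F \<Longrightarrow> F (\<lambda>i. c * x i) = (\<lambda>i. c ^ d * F x i)"
  by (rule ext) (rule hpoly_scale[OF forms_hpoly])

lemma forms_comp: "forms n m d F \<Longrightarrow> forms m l e G \<Longrightarrow> forms n l (e * d) (\<lambda>x. G (F x))"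
  unfolding forms_def by (auto intro: hpoly_comp)

lemma forms_hom_coords: "forms n m d F \<Longrightarrow> F x i \<noteq> 0 \<Longrightarrow> F x \<in> hom_coords m"
  by (auto simp: forms_def hom_coords_def)

lemma truncate_hom_coords: "x i \<noteq> 0 \<Longrightarrow> i \<le> n \<Longrightarrow> (\<lambda>i. if i \<le> n then x i else 0) \<in> hom_coords n"
  by (auto simp: hom_coords_def)

text \<open>Arbitrary sequences have to be replaced by elements of \<open>hom_coords n\<close>.
  Truncation after n does not change the values of polynomials, and the factor x 0 keeps the
  truncated vector from being zero.\<close>

lemma polyfun_zero_generic:
  assumes D: "polyfun n D" "D a \<noteq> 0" and f: "polyfun n f"
    and z: "\<And>x. x \<in> hom_coords n \<Longrightarrow> D x \<noteq> 0 \<Longrightarrow> f x = 0"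
  shows "f x = 0"
proof -
  have v: "polyfun n (\<lambda>x. x 0)" by (rule polyfun_var) simp
  obtain b where b: "D b \<noteq> 0" "b 0 \<noteq> 0"
    using polyfun_no_zero_divisors[OF D(1) v D(2), of "\<lambda>_. 1"] by auto
  show ?thesis
  proof (rule polyfun_cancel[OF polyfun_mult[OF D(1) v] f])
    show "D b * b 0 \<noteq> 0" using b by simp
  next
    fix y assume y: "D y * y 0 \<noteq> 0"
    let ?y = "\<lambda>i. if i \<le> n then y i else 0"
    have "D ?y = D y" "f ?y = f y"
      using polyfun_cong[OF D(1), of ?y y] polyfun_cong[OF f, of ?y y] by auto
    then show "f y = 0" using z[of ?y] truncate_hom_coords[of y 0 n] y by auto
  qed
qed

text \<open>If D vanished on all of \<open>hom_coords n\<close>, the preceding lemma would apply to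
  the constant 1.\<close>

lemma polyfun_nonzero_hom_coords:
  assumes D: "polyfun n D" "D a \<noteq> 0"
  shows "\<exists>x\<in>hom_coords n. D x \<noteq> 0"
  using polyfun_zero_generic[OF D polyfun_const[of n 1]] by auto

lemma parallel_generic:
  assumes "polyfun n D" "D a \<noteq> 0" "forms n m d F" "forms n l e G"
    and "\<And>x. x \<in> hom_coords n \<Longrightarrow> D x \<noteq> 0 \<Longrightarrow> parallel (F x) (G x)"
  shows "parallel (F x) (G x)"
  unfolding parallel_def
proof (intro allI)
  fix i j
  have "polyfun n (\<lambda>x. F x i * G x j - F x j * G x i)"
    by (intro polyfun_diff polyfun_mult forms_polyfun[OF assms(3)] forms_polyfun[OF assms(4)])
  from polyfun_zero_generic[OF assms(1,2) this, of x] show "F x i * G x j = F x j * G x i"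
    using parallelD[OF assms(5)] by (metis eq_iff_diff_eq_0)
qed

section \<open>Closed sets, open sets and forms\<close>

lemma closedin_zero_set:
  assumes "hpoly n d g"
  shows "closedin (zariski n) {p \<in> proj_space n. \<forall>x\<in>p. g x = 0}"
proof -
  obtain f where "hom_poly n d f" "g = mpoly_eval f" using assms hpoly_iff by blast
  then show ?thesis unfolding closedin_zariski
    by (intro exI[of _ "{f}"]) (auto simp: zero_locus_def)
qed

lemma closedin_separate:
  assumes "closedin (zariski n) A" "x \<in> hom_coords n" "pt n x \<notin> A"
  shows "\<exists>d f. hpoly n d f \<and> f x \<noteq> 0 \<and> (\<forall>p\<in>A. \<forall>y\<in>p. f y = 0)"
proof -
  obtain S where S: "\<forall>f\<in>S. \<exists>d. hom_poly n d f" "A = zero_locus n S"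
    using assms(1) closedin_zariski by blast
  obtain f y where f: "f \<in> S" "y \<in> pt n x" "mpoly_eval f y \<noteq> 0"
    using assms pt_in_proj_space S(2) by (auto simp: zero_locus_def)
  obtain d where d: "hom_poly n d f" using S(1) f by blast
  have "mpoly_eval f x \<noteq> 0"
    using eval_zero_point_iff[OF pt_in_proj_space[OF assms(2)] f(2) pt_self[OF assms(2)] d] f by blast
  then show ?thesis using d f S(2) hpoly_iff
    by (intro exI[of _ d] exI[of _ "mpoly_eval f"]) (auto simp: zero_locus_def)
qed

text \<open>An open neighbourhood is shrunk to the nonvanishing locus of one form, so that
  conditions on points become polynomial conditions on vectors.\<close>

lemma openin_basic:
  assumes "openin (zariski n) U" "p \<in> U"
  shows "\<exists>d D. hpoly n d D \<and> (\<forall>x\<in>p. D x \<noteq> 0) \<and> (\<forall>x\<in>hom_coords n. D x \<noteq> 0 \<longrightarrow> pt n x \<in> U)"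
proof -
  have p: "p \<in> proj_space n" using assms openin_zariski by blast
  obtain x where x: "x \<in> p" using proj_space_nonempty[OF p] by blast
  have "closedin (zariski n) (proj_space n - U)"
    using assms(1) openin_closedin_eq[of "zariski n" U] by simp
  moreover have px: "p = pt n x" "x \<in> hom_coords n" using point_eq_pt[OF p x] point_coords[OF p x] by auto
  ultimately obtain d D where D: "hpoly n d D" "D x \<noteq> 0" "\<forall>p\<in>proj_space n - U. \<forall>y\<in>p. D y = 0"
    using closedin_separate[of n "proj_space n - U" x] assms(2) by blast
  have "D y \<noteq> 0" if "y \<in> p" for y
    using point_same[OF p x that] D(1,2) by (auto simp: hpoly_scale)
  moreover have "pt n y \<in> U" if "y \<in> hom_coords n" "D y \<noteq> 0" for y
    using D(3) that pt_self pt_in_proj_space by blast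
  ultimately show ?thesis using D(1) by blast
qed

section \<open>Rational maps defined on a projective space\<close>

text \<open>One tuple of forms that gives the map on the nonempty open set where D is nonzero. The
  tuple may have common zeros elsewhere in the domain, and it is determined only up to
  \<open>parallel\<close>.\<close>

definition generic_forms ::
    "nat \<Rightarrow> nat \<Rightarrow> rational_map \<Rightarrow> ((nat \<Rightarrow> complex) \<Rightarrow> (nat \<Rightarrow> complex)) \<Rightarrow> bool" where
  "generic_forms n m \<eta> F \<longleftrightarrow> (\<exists>d. forms n m d F) \<and>
     (\<exists>D a. polyfun n D \<and> D a \<noteq> 0 \<and> (\<forall>x\<in>hom_coords n. D x \<noteq> 0 \<longrightarrow>
        pt n x \<in> rat_dom \<eta> \<and> F x \<in> rat_apply \<eta> (pt n x)))"

lemma rational_rep_subsets: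
  assumes "f \<in> rational_reps n (proj_space n) m Y"
  shows "openin (zariski n) (dom f)" "dom f \<subseteq> proj_space n" "ran f \<subseteq> proj_space m"
    "q \<in> dom f \<Longrightarrow> the (f q) \<in> proj_space m"
proof -
  have "openin (subtopology (zariski n) (topspace (zariski n))) (dom f)"
    using assms by (simp add: rational_reps_def)
  then show o: "openin (zariski n) (dom f)" by (simp only: subtopology_topspace)
  show "dom f \<subseteq> proj_space n" using openin_subset[OF o] by simp
  show r: "ran f \<subseteq> proj_space m" using assms by (simp add: rational_reps_def regular_map_def)
  show "q \<in> dom f \<Longrightarrow> the (f q) \<in> proj_space m" using r by (auto simp: ran_def)
qed

lemma rational_rep_local_forms:
  assumes f: "f \<in> rational_reps n (proj_space n) m Y" and p: "p \<in> dom f"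
  shows "\<exists>F d D e. forms n m d F \<and> hpoly n e D \<and> (\<forall>x\<in>p. D x \<noteq> 0 \<and> F x \<in> the (f p)) \<and>
    (\<forall>x\<in>hom_coords n. D x \<noteq> 0 \<longrightarrow> pt n x \<in> dom f \<and> F x \<in> the (f (pt n x)))"
proof -
  have "regular_map n m f" using f by (simp add: rational_reps_def)
  then obtain V G d where V: "openin (zariski n) V" "p \<in> V" "\<forall>i\<le>m. hom_poly n d (G i)"
      "\<forall>q\<in>V \<inter> dom f. \<forall>x\<in>q. (\<lambda>i. if i \<le> m then mpoly_eval (G i) x else 0) \<in> the (f q)"
    using p unfolding regular_map_def by blast
  define F where "F x = (\<lambda>i. if i \<le> m then mpoly_eval (G i) x else 0)" for x
  have F: "forms n m d F" using V(3) hpoly_iff by (auto simp: forms_def F_def)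
  have "openin (zariski n) (V \<inter> dom f)" using V(1) rational_rep_subsets(1)[OF f] by (rule openin_Int)
  from openin_basic[OF this, of p] p V(2) obtain e D where D: "hpoly n e D" "\<forall>x\<in>p. D x \<noteq> 0"
      "\<forall>x\<in>hom_coords n. D x \<noteq> 0 \<longrightarrow> pt n x \<in> V \<inter> dom f" by blast
  have "F x \<in> the (f q)" if "q \<in> V \<inter> dom f" "x \<in> q" for q x
    using V(4) that unfolding F_def by blast
  then show ?thesis using F D p V(2) pt_self
    by (intro exI[of _ F] exI[of _ d] exI[of _ D] exI[of _ e]) blast
qed

text \<open>Members of the class are related to its representative h and a priori not to each other.
  They agree where all three are defined; as this set is dense, the minors of local forms of f and g
  vanish identically, in particular at p.\<close>

lemma rational_map_reps_agree:
  assumes \<eta>: "\<eta> \<in> rational_maps n (proj_space n) m Y" and fg: "f \<in> \<eta>" "g \<in> \<eta>"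
    and p: "p \<in> dom f" "p \<in> dom g"
  shows "f p = g p"
proof -
  obtain h where h: "h \<in> rational_reps n (proj_space n) m Y"
      "\<eta> = rational_eq n (proj_space n) m Y `` {h}"
    using \<eta> by (auto simp: rational_maps_def quotient_def)
  have reps: "f \<in> rational_reps n (proj_space n) m Y" "g \<in> rational_reps n (proj_space n) m Y"
    and eq: "\<And>p. p \<in> dom h \<Longrightarrow> p \<in> dom f \<Longrightarrow> h p = f p" "\<And>p. p \<in> dom h \<Longrightarrow> p \<in> dom g \<Longrightarrow> h p = g p"
    using fg h by (auto simp: rational_eq_def)
  note sub = rational_rep_subsets(2)[OF reps(1)] rational_rep_subsets(2)[OF h(1)]
  note img = rational_rep_subsets(4)[OF reps(1)] and img' = rational_rep_subsets(4)[OF reps(2)]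
  obtain q where q: "q \<in> dom h" using h(1) unfolding rational_reps_def by blast
  obtain F d D e where F: "forms n m d F" "hpoly n e D" "\<forall>x\<in>p. D x \<noteq> 0 \<and> F x \<in> the (f p)"
    "\<forall>x\<in>hom_coords n. D x \<noteq> 0 \<longrightarrow> pt n x \<in> dom f \<and> F x \<in> the (f (pt n x))"
    using rational_rep_local_forms[OF reps(1) p(1)] by blast
  obtain G d' D' e' where G: "forms n m d' G" "hpoly n e' D'" "\<forall>x\<in>p. D' x \<noteq> 0 \<and> G x \<in> the (g p)"
    "\<forall>x\<in>hom_coords n. D' x \<noteq> 0 \<longrightarrow> pt n x \<in> dom g \<and> G x \<in> the (g (pt n x))"
    using rational_rep_local_forms[OF reps(2) p(2)] by blast
  obtain H d'' D'' e'' where H: "forms n m d'' H" "hpoly n e'' D''" "\<forall>x\<in>q. D'' x \<noteq> 0"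
    "\<forall>x\<in>hom_coords n. D'' x \<noteq> 0 \<longrightarrow> pt n x \<in> dom h \<and> H x \<in> the (h (pt n x))"
    using rational_rep_local_forms[OF h(1) q] by blast
  obtain x where x: "x \<in> p" using proj_space_nonempty p sub by blast
  obtain y where y: "y \<in> q" using proj_space_nonempty q sub by blast
  have poly: "polyfun n D" "polyfun n D'" "polyfun n D''" using F G H hpoly_imp_polyfun by blast+
  have "D x \<noteq> 0" "D' x \<noteq> 0" "D'' y \<noteq> 0" using F G H x y by auto
  then obtain a where a: "D a * D' a \<noteq> 0 \<and> D'' a \<noteq> 0"
    using polyfun_no_zero_divisors[OF polyfun_mult[OF poly(1,2)] poly(3), of x y] by auto
  have "parallel (F z) (G z)" for z
  proof (rule parallel_generic[OF polyfun_mult[OF polyfun_mult[OF poly(1,2)] poly(3)] _ F(1) G(1)])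
    show "D a * D' a * D'' a \<noteq> 0" using a by simp
  next
    fix z assume z: "z \<in> hom_coords n" "D z * D' z * D'' z \<noteq> 0"
    let ?q = "pt n z"
    have q: "?q \<in> dom f" "?q \<in> dom g" "?q \<in> dom h" and v: "F z \<in> the (f ?q)" "G z \<in> the (g ?q)"
      using F(4) G(4) H(4) z by simp_all
    have "f ?q = g ?q" using eq(1)[OF q(3,1)] eq(2)[OF q(3,2)] by simp
    then show "parallel (F z) (G z)" using point_parallel[OF img[OF q(1)] v(1)] v(2) by simp
  qed
  then have "the (f p) = the (g p)"
    using parallel_points_eq[OF img[OF p(1)] img'[OF p(2)]] F(3) G(3) x by blast
  then show ?thesis using p by force
qed

lemma rat_apply_rep:
  assumes \<eta>: "\<eta> \<in> rational_maps n (proj_space n) m Y" and f: "f \<in> \<eta>" "p \<in> dom f"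
  shows "rat_apply \<eta> p = the (f p)"
  unfolding rat_apply_def
proof (rule the_equality)
  show "\<exists>f'\<in>\<eta>. f' p = Some (the (f p))" using f by force
next
  fix q assume "\<exists>f'\<in>\<eta>. f' p = Some q"
  then obtain g where "g \<in> \<eta>" "g p = Some q" by blast
  moreover from this have "f p = g p" using rational_map_reps_agree[OF \<eta> f(1) _ f(2), of g] by blast
  ultimately show "q = the (f p)" by simp
qed

lemma rational_map_reps:
  assumes "\<eta> \<in> rational_maps n (proj_space n) m Y"
  shows "\<eta> \<subseteq> rational_reps n (proj_space n) m Y" "\<eta> \<noteq> {}"
proof -
  obtain h where h: "h \<in> rational_reps n (proj_space n) m Y"
      "\<eta> = rational_eq n (proj_space n) m Y `` {h}"
    using assms by (auto simp: rational_maps_def quotient_def)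
  then show "\<eta> \<subseteq> rational_reps n (proj_space n) m Y" by (auto simp: rational_eq_def)
  have "(h, h) \<in> rational_eq n (proj_space n) m Y" using h(1) by (auto simp: rational_eq_def)
  then show "\<eta> \<noteq> {}" using h(2) by blast
qed

lemma rat_dom_subset:
  assumes "\<eta> \<in> rational_maps n (proj_space n) m Y"
  shows "rat_dom \<eta> \<subseteq> proj_space n"
proof -
  have "dom f \<subseteq> proj_space n" if "f \<in> \<eta>" for f
    using rational_rep_subsets(2) rational_map_reps(1)[OF assms] that by blast
  then show ?thesis by (auto simp: rat_dom_def)
qed

lemma rat_apply_in:
  assumes \<eta>: "\<eta> \<in> rational_maps n (proj_space n) m Y" and p: "p \<in> rat_dom \<eta>"
  shows "rat_apply \<eta> p \<in> Y" "rat_apply \<eta> p \<in> proj_space m"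
proof -
  obtain f where f: "f \<in> \<eta>" "p \<in> dom f" using p by (auto simp: rat_dom_def)
  then have "f \<in> rational_reps n (proj_space n) m Y" using rational_map_reps(1)[OF \<eta>] by blast
  then have "ran f \<subseteq> Y" "ran f \<subseteq> proj_space m" by (simp_all add: rational_reps_def regular_map_def)
  moreover have "rat_apply \<eta> p \<in> ran f" using f rat_apply_rep[OF \<eta> f] by (auto simp: ran_def)
  ultimately show "rat_apply \<eta> p \<in> Y" "rat_apply \<eta> p \<in> proj_space m" by auto
qed

text \<open>The tuple has a nonzero value at the chosen p and represents the map generically as
  well, which makes the tuples belonging to different points comparable.\<close>

lemma generic_forms_at:
  assumes \<eta>: "\<eta> \<in> rational_maps n (proj_space n) m Y" and p: "p \<in> rat_dom \<eta>"
  shows "\<exists>F. generic_forms n m \<eta> F \<and> (\<forall>x\<in>p. F x \<in> rat_apply \<eta> p)"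
proof -
  obtain f where f: "f \<in> \<eta>" "p \<in> dom f" using p by (auto simp: rat_dom_def)
  then have "f \<in> rational_reps n (proj_space n) m Y" using rational_map_reps(1)[OF \<eta>] by blast
  from rational_rep_local_forms[OF this f(2)]
  obtain F d D e where F: "forms n m d F" "hpoly n e D" "\<forall>x\<in>p. D x \<noteq> 0 \<and> F x \<in> the (f p)"
    "\<forall>x\<in>hom_coords n. D x \<noteq> 0 \<longrightarrow> pt n x \<in> dom f \<and> F x \<in> the (f (pt n x))" by blast
  obtain x where "x \<in> p" using proj_space_nonempty rat_dom_subset[OF \<eta>] p by blast
  then have "D x \<noteq> 0" using F by blast
  moreover have "pt n x \<in> rat_dom \<eta> \<and> F x \<in> rat_apply \<eta> (pt n x)" if "x \<in> hom_coords n" "D x \<noteq> 0" for x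
  proof -
    have "pt n x \<in> dom f" "F x \<in> the (f (pt n x))" using F(4) that by auto
    then show ?thesis using rat_apply_rep[OF \<eta> f(1)] f(1) unfolding rat_dom_def by auto
  qed
  ultimately have "generic_forms n m \<eta> F"
    unfolding generic_forms_def using F(1) hpoly_imp_polyfun[OF F(2)] by blast
  then show ?thesis using F(3) rat_apply_rep[OF \<eta> f] by auto
qed

lemma generic_forms_exist:
  assumes \<eta>: "\<eta> \<in> rational_maps n (proj_space n) m Y"
  shows "\<exists>F. generic_forms n m \<eta> F"
proof -
  obtain f where f: "f \<in> \<eta>" using rational_map_reps(2)[OF \<eta>] by blast
  then have "dom f \<noteq> {}" using rational_map_reps(1)[OF \<eta>] unfolding rational_reps_def by blast
  then obtain p where "p \<in> rat_dom \<eta>" using f unfolding rat_dom_def by blast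
  then show ?thesis using generic_forms_at[OF \<eta>] by blast
qed

lemma generic_forms_nonzero:
  assumes \<eta>: "\<eta> \<in> rational_maps n (proj_space n) m Y" and F: "generic_forms n m \<eta> F"
  shows "\<exists>x i. F x i \<noteq> 0"
proof -
  obtain D a where D: "polyfun n D" "D a \<noteq> 0" "\<forall>x\<in>hom_coords n. D x \<noteq> 0 \<longrightarrow>
        pt n x \<in> rat_dom \<eta> \<and> F x \<in> rat_apply \<eta> (pt n x)"
    using F unfolding generic_forms_def by blast
  obtain x where x: "x \<in> hom_coords n" "D x \<noteq> 0" using polyfun_nonzero_hom_coords[OF D(1,2)] by blast
  then have "F x \<in> hom_coords m"
    using D(3) rat_apply_in[OF \<eta>] point_coords by blast
  then show ?thesis by (auto simp: hom_coords_def)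
qed

lemma generic_forms_parallel:
  assumes \<eta>: "\<eta> \<in> rational_maps n (proj_space n) m Y"
    and F: "generic_forms n m \<eta> F" and G: "generic_forms n m \<eta> G"
  shows "parallel (F x) (G x)"
proof -
  obtain d D a where D: "forms n m d F" "polyfun n D" "D a \<noteq> 0" "\<forall>x\<in>hom_coords n. D x \<noteq> 0 \<longrightarrow>
        pt n x \<in> rat_dom \<eta> \<and> F x \<in> rat_apply \<eta> (pt n x)"
    using F unfolding generic_forms_def by blast
  obtain e E b where E: "forms n m e G" "polyfun n E" "E b \<noteq> 0" "\<forall>x\<in>hom_coords n. E x \<noteq> 0 \<longrightarrow>
        pt n x \<in> rat_dom \<eta> \<and> G x \<in> rat_apply \<eta> (pt n x)"
    using G unfolding generic_forms_def by blast
  obtain c where c: "D c \<noteq> 0 \<and> E c \<noteq> 0" using polyfun_no_zero_divisors[OF D(2) E(2) D(3) E(3)] by blast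
  show ?thesis
  proof (rule parallel_generic[OF polyfun_mult[OF D(2) E(2)] _ D(1) E(1)])
    show "D c * E c \<noteq> 0" using c by simp
  next
    fix x assume "x \<in> hom_coords n" "D x * E x \<noteq> 0"
    then show "parallel (F x) (G x)"
      using D(4) E(4) point_parallel rat_apply_in(2)[OF \<eta>] by (metis mult_eq_0_iff)
  qed
qed

text \<open>F may vanish at a point q of the domain, so g is tested on a tuple G valid at q. From
  F_j G = G_j F and homogeneity, F_j^k g(G) = G_j^k g(F) = 0, and F_j cancels. Vanishing on the
  image passes to its closure Y.\<close>

lemma zero_on_image:
  assumes \<eta>: "\<eta> \<in> rational_maps n (proj_space n) m Y" and F: "generic_forms n m \<eta> F"
    and g: "hpoly m k g" and z: "\<And>x. g (F x) = 0" and dom: "dominant m Y \<eta>"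
    and p: "p \<in> Y" "x \<in> p"
  shows "g x = 0"
proof -
  let ?Z = "{p \<in> proj_space m. \<forall>x\<in>p. g x = 0}"
  have "rat_apply \<eta> ` rat_dom \<eta> \<subseteq> ?Z"
  proof (rule image_subsetI)
    fix q assume q: "q \<in> rat_dom \<eta>"
    obtain G where G: "generic_forms n m \<eta> G" "\<forall>x\<in>q. G x \<in> rat_apply \<eta> q"
      using generic_forms_at[OF \<eta> q] by blast
    obtain x where x: "x \<in> q" using proj_space_nonempty rat_dom_subset[OF \<eta>] q by blast
    obtain d where d: "forms n m d F" using F unfolding generic_forms_def by blast
    obtain e where e: "forms n m e G" using G unfolding generic_forms_def by blast
    obtain a j where a: "F a j \<noteq> 0" using generic_forms_nonzero[OF \<eta> F] by blast
    have "g (G x) = 0"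
    proof (rule polyfun_cancel[of n "\<lambda>x. F x j ^ k" "\<lambda>x. g (G x)"])
      show "polyfun n (\<lambda>x. F x j ^ k)"
        by (intro polyfun_power forms_polyfun[OF d])
      show "polyfun n (\<lambda>x. g (G x))"
        by (rule polyfun_comp[OF hpoly_imp_polyfun[OF g] forms_polyfun[OF e]])
      show "F a j ^ k \<noteq> 0" using a by simp
    next
      fix z assume nz: "F z j ^ k \<noteq> 0"
      have "(\<lambda>i. F z j * G z i) = (\<lambda>i. G z j * F z i)"
        using parallelD[OF generic_forms_parallel[OF \<eta> F G(1), of z], of j] by (simp add: mult.commute)
      then have "F z j ^ k * g (G z) = G z j ^ k * g (F z)"
        using hpoly_scale[OF g] by metis
      then show "g (G z) = 0" using nz z by (metis mult_eq_0_iff)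
    qed
    moreover have R: "rat_apply \<eta> q \<in> proj_space m" by (rule rat_apply_in(2)[OF \<eta> q])
    moreover have "G x \<in> rat_apply \<eta> q" using G x by blast
    ultimately have "g y = 0" if "y \<in> rat_apply \<eta> q" for y
      using point_same[OF R _ that] hpoly_scale[OF g] by (metis mult_zero_right)
    then show "rat_apply \<eta> q \<in> ?Z" using R by blast
  qed
  then have "Y \<subseteq> ?Z"
    using dom closure_of_minimal[OF _ closedin_zero_set[OF g]] unfolding dominant_def by blast
  then show ?thesis using p by blast
qed

section \<open>Cones and projections from a point\<close>

text \<open>With positive degree e, scaling the argument by an e-th root of c scales the value by c.
  Degree 0 can occur, for instance on the projective space of dimension 0.\<close>

lemma generic_forms_pos:
  assumes \<eta>: "\<eta> \<in> rational_maps n (proj_space n) m Y"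
  shows "\<exists>F e. e > 0 \<and> forms n m e F \<and> generic_forms n m \<eta> F"
proof -
  obtain F where F: "generic_forms n m \<eta> F" using generic_forms_exist[OF \<eta>] by blast
  then obtain d D a where D: "forms n m d F" "polyfun n D" "D a \<noteq> 0" "\<forall>x\<in>hom_coords n. D x \<noteq> 0 \<longrightarrow>
        pt n x \<in> rat_dom \<eta> \<and> F x \<in> rat_apply \<eta> (pt n x)"
    unfolding generic_forms_def by blast
  have v: "polyfun n (\<lambda>x. x 0)" by (rule polyfun_var) simp
  obtain b where b: "D b \<noteq> 0" "b 0 \<noteq> 0"
    using polyfun_no_zero_divisors[OF D(2) v D(3), of "\<lambda>_. 1"] by auto
  let ?G = "\<lambda>x i. x 0 * F x i"
  have "hpoly n (Suc 0 + d) (\<lambda>x. x 0 * F x i)" for i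
    by (intro hpoly_mult hpoly_var forms_hpoly[OF D(1)]) simp
  then have G: "forms n m (Suc d) ?G" using D(1) by (auto simp: forms_def)
  have "pt n x \<in> rat_dom \<eta> \<and> ?G x \<in> rat_apply \<eta> (pt n x)"
    if x: "x \<in> hom_coords n" "D x * x 0 \<noteq> 0" for x
  proof -
    have "D x \<noteq> 0" "x 0 \<noteq> 0" using x by auto
    moreover then have *: "pt n x \<in> rat_dom \<eta>" "F x \<in> rat_apply \<eta> (pt n x)" using D(4) x by auto
    ultimately show ?thesis using point_scale[OF rat_apply_in(2)[OF \<eta> *(1)] *(2)] by blast
  qed
  then have "generic_forms n m \<eta> ?G"
    unfolding generic_forms_def using G polyfun_mult[OF D(2) v] b
    by (intro conjI exI[of _ "Suc d"] exI[of _ "\<lambda>x. D x * x 0"] exI[of _ b]) auto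
  then show ?thesis using G by blast
qed

lemma complex_root_exists:
  fixes c :: complex
  assumes "e > 0" "c \<noteq> 0"
  shows "\<exists>b. b ^ e = c"
proof -
  have "of_nat e * (Ln c / of_nat e) = Ln c" using assms by simp
  then show ?thesis using assms(2) by (metis exp_Ln exp_of_nat_mult)
qed

text \<open>The form is a relation between \<open>r\<close> forms in \<open>d + 1 < r\<close> variables, namely the
  parametrisation of \<open>T\<close> projected from \<open>a\<close>.\<close>

lemma cone_form:
  assumes \<eta>: "\<eta> \<in> rational_maps d (proj_space d) r T" and dom: "dominant r T \<eta>"
    and dr: "d + 2 \<le> r" and a: "a \<in> hom_coords r"
  shows "\<exists>k g p. hpoly r k g \<and> (\<forall>q\<in>T. \<forall>x\<in>q. g x = 0) \<and>
           (\<forall>x t. g (\<lambda>i. x i + t * a i) = g x) \<and> g p \<noteq> 0"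
proof -
  obtain F e where F: "e > 0" "forms d r e F" "generic_forms d r \<eta> F"
    using generic_forms_pos[OF \<eta>] by blast
  obtain q where q: "a q \<noteq> 0" using a by (auto simp: hom_coords_def)
  have qr: "q \<le> r" using a q by (auto simp: hom_coords_def intro: leI)
  \<comment> \<open>\<open>s\<close> skips the index q, and \<open>\<rho>\<close> subtracts the
    multiple of a that kills coordinate q. Together they are the projection from a, with r
    coordinates left.\<close>
  define s where "s n = (if n < q then n else Suc n)" for n
  define \<rho> where "\<rho> x n = x (s n) - a (s n) / a q * x q" for x n
  have "hpoly d e (\<lambda>x. \<rho> (F x) n)" for n
    unfolding \<rho>_def by (intro hpoly_diff hpoly_cmult forms_hpoly[OF F(2)])
  then obtain \<phi> where \<phi>: "\<And>n. hom_poly d e (\<phi> n)" "\<And>n. (\<lambda>x. \<rho> (F x) n) = mpoly_eval (\<phi> n)"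
    unfolding hpoly_iff by metis
  have "d + 1 < r" using dr by simp
  then obtain G Y where G: "polyfun (r - 1) G" "G Y \<noteq> 0" "\<And>t. G (\<lambda>i. mpoly_eval (\<phi> i) t) = 0"
    using forms_dependent[of r d e \<phi>] \<phi>(1) by blast
  have G0: "G (\<rho> (F t)) = 0" for t
    using G(3)[of t] by (simp flip: \<phi>(2))
  \<comment> \<open>The relation G is not known to be homogeneous. One of its components serves,
    since the range of the projected parametrisation is stable under scaling.\<close>
  have "\<exists>k g. hpoly (r - 1) k g \<and> (\<forall>y\<in>range (\<lambda>t. \<rho> (F t)). g y = 0) \<and> g Y \<noteq> 0"
  proof (rule polyfun_component[OF G(1) _ G(2)])
    fix y and c :: complex assume "y \<in> range (\<lambda>t. \<rho> (F t))" "c \<noteq> 0"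
    then obtain t where t: "y = \<rho> (F t)" by blast
    obtain b where b: "b ^ e = c" using complex_root_exists[OF F(1) \<open>c \<noteq> 0\<close>] by blast
    have "(\<lambda>i. c * y i) = \<rho> (F (\<lambda>i. b * t i))"
      unfolding forms_scale[OF F(2)] b t by (auto simp: \<rho>_def algebra_simps)
    then show "G (\<lambda>i. c * y i) = 0" by (simp add: G0)
  qed
  then obtain k g where g: "hpoly (r - 1) k g" "\<And>t. g (\<rho> (F t)) = 0" "g Y \<noteq> 0" by blast
  have lin: "hpoly r (Suc 0) (\<lambda>x. \<rho> x n)" if "n \<le> r - 1" for n
    unfolding \<rho>_def using that qr dr
    by (intro hpoly_diff hpoly_cmult hpoly_var) (auto simp: s_def)
  have h: "hpoly r k (\<lambda>x. g (\<rho> x))"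
    using hpoly_comp[OF g(1), of r "Suc 0" \<rho>] lin by simp
  moreover have "\<forall>p\<in>T. \<forall>x\<in>p. g (\<rho> x) = 0"
    using zero_on_image[OF \<eta> F(3) h _ dom] g(2) by blast
  moreover have "g (\<rho> (\<lambda>i. x i + t * a i)) = g (\<rho> x)" for x t
  proof -
    have "\<rho> (\<lambda>i. x i + t * a i) = \<rho> x"
      using q by (auto simp: \<rho>_def field_simps)
    then show ?thesis by simp
  qed
  \<comment> \<open>Inserting a zero at place q gives a preimage of Y under
    \<open>\<rho>\<close>.\<close>
  moreover have "g (\<rho> (\<lambda>i. if i < q then Y i else if i = q then 0 else Y (i - 1))) \<noteq> 0"
  proof -
    have "\<rho> (\<lambda>i. if i < q then Y i else if i = q then 0 else Y (i - 1)) = Y"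
      by (auto simp: \<rho>_def s_def)
    then show ?thesis using g(3) by simp
  qed
  ultimately show ?thesis by blast
qed

text \<open>Gaussian elimination; the matrix \<open>u - m\<close> is invertible at \<open>a\<close>.\<close>

lemma eliminate:
  fixes w :: "nat \<Rightarrow> 'b \<Rightarrow> complex"
  assumes "polyfun n u" "u a \<noteq> 0"
    and "\<And>i j. i < k \<Longrightarrow> j < k \<Longrightarrow> polyfun n (m i j) \<and> m i j a = 0"
    and "\<And>x i. x \<in> S \<Longrightarrow> i < k \<Longrightarrow> u (y x) * w i x = (\<Sum>j<k. m i j (y x) * w j x)"
  shows "\<exists>H. polyfun n H \<and> H a \<noteq> 0 \<and> (\<forall>x\<in>S. \<forall>i<k. H (y x) * w i x = 0)"
  using assms
proof (induction k arbitrary: u m)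
  case 0
  show ?case by (intro exI[of _ "\<lambda>_. 1"]) (auto intro: polyfun_const)
next
  case (Suc k)
  note m = Suc.prems(3) and eq = Suc.prems(4)
  define v where "v z = u z - m k k z" for z
  have v: "polyfun n v" "v a \<noteq> 0"
    unfolding v_def[abs_def] using Suc.prems(1,2) m[of k k] by (auto intro: polyfun_diff)
  have last: "v (y x) * w k x = (\<Sum>j<k. m k j (y x) * w j x)" if "x \<in> S" for x
    using eq[OF that, of k] by (simp add: v_def algebra_simps)
  \<comment> \<open>Row i is multiplied by the pivot v, and v times the last unknown is replaced by
    means of row k. The new entries still vanish at a, and u is replaced by u * v, which does
    not.\<close>
  have "\<exists>H. polyfun n H \<and> H a \<noteq> 0 \<and> (\<forall>x\<in>S. \<forall>i<k. H (y x) * w i x = 0)"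
  proof (rule Suc.IH[where u = "\<lambda>z. u z * v z" and m = "\<lambda>i j z. v z * m i j z + m i k z * m k j z"])
    show "polyfun n (\<lambda>z. u z * v z)" using Suc.prems(1) v by (intro polyfun_mult)
    show "u a * v a \<noteq> 0" using Suc.prems(2) v by simp
    show "polyfun n (\<lambda>z. v z * m i j z + m i k z * m k j z) \<and> v a * m i j a + m i k a * m k j a = 0"
      if "i < k" "j < k" for i j
      using that m[of i j] m[of i k] m[of k j] v by (auto intro!: polyfun_add polyfun_mult)
  next
    fix x i assume x: "x \<in> S" and i: "i < k"
    have "u (y x) * w i x = (\<Sum>j<k. m i j (y x) * w j x) + m i k (y x) * w k x"
      using eq[OF x, of i] i by simp
    then have "v (y x) * (u (y x) * w i x) =
        v (y x) * (\<Sum>j<k. m i j (y x) * w j x) + m i k (y x) * (v (y x) * w k x)"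
      by (simp only: distrib_left mult_ac)
    then have "u (y x) * v (y x) * w i x =
        v (y x) * (\<Sum>j<k. m i j (y x) * w j x) + m i k (y x) * (v (y x) * w k x)"
      by (simp only: mult_ac)
    also have "\<dots> = (\<Sum>j<k. (v (y x) * m i j (y x) + m i k (y x) * m k j (y x)) * w j x)"
      unfolding last[OF x] by (simp add: sum_distrib_left sum.distrib algebra_simps)
    finally show "u (y x) * v (y x) * w i x =
        (\<Sum>j<k. (v (y x) * m i j (y x) + m i k (y x) * m k j (y x)) * w j x)" .
  qed
  then obtain H where H: "polyfun n H" "H a \<noteq> 0" "\<forall>x\<in>S. \<forall>i<k. H (y x) * w i x = 0" by blast
  have "H (y x) * v (y x) * w i x = 0" if x: "x \<in> S" and i: "i < Suc k" for x i
  proof (cases "i = k")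
    case True
    have "H (y x) * v (y x) * w k x = (\<Sum>j<k. m k j (y x) * (H (y x) * w j x))"
      using last[OF x] by (simp add: sum_distrib_left mult_ac)
    also have "\<dots> = 0" using H(3) x by (intro sum.neutral) auto
    finally show ?thesis using True by simp
  next
    case False
    then have "H (y x) * w i x = 0" using H(3) x i by auto
    then show ?thesis by auto
  qed
  then show ?case using H(1,2) v by (intro exI[of _ "\<lambda>z. H z * v z"]) (auto intro: polyfun_mult)
qed

lemma poly_eq_sum_atMost:
  fixes P :: "complex poly"
  assumes "degree P \<le> n"
  shows "poly P t = (\<Sum>i\<le>n. coeff P i * t ^ i)"
  by (subst poly_as_sum_of_monoms'[OF assms, symmetric]) (simp add: poly_sum poly_monom)

text \<open>In the application below a point of \<open>S\<close> is \<open>y + t p\<close>, where \<open>y\<close> is its projection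
  from \<open>p\<close> and \<open>t\<close> vanishes at \<open>a\<close>. As \<open>g\<close> is constant along \<open>a\<close>, on \<open>S\<close> the power \<open>t\<^sup>k\<close> is a
  combination of lower powers with coefficients in \<open>y\<close> that vanish at \<open>a\<close>. The functions on \<open>S\<close>
  that are such combinations are closed under multiplication by functions of \<open>y\<close> and by \<open>t\<close>.\<close>

locale reduction =
  fixes r k :: nat and a :: "nat \<Rightarrow> complex" and S :: "'b set" and y :: "'b \<Rightarrow> nat \<Rightarrow> complex"
    and t :: "'b \<Rightarrow> complex" and c :: "nat \<Rightarrow> (nat \<Rightarrow> complex) \<Rightarrow> complex"
  assumes c: "\<And>j. j < k \<Longrightarrow> polyfun r (c j) \<and> c j a = 0"
    and tk: "\<And>x. x \<in> S \<Longrightarrow> t x ^ k = (\<Sum>j<k. c j (y x) * t x ^ j)"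
    and k: "k > 0"
begin

definition reducible :: "('b \<Rightarrow> complex) \<Rightarrow> bool" where
  "reducible e \<longleftrightarrow> (\<exists>m. (\<forall>j<k. polyfun r (m j) \<and> m j a = 0) \<and>
      (\<forall>x\<in>S. e x = (\<Sum>j<k. m j (y x) * t x ^ j)))"

lemma reducible_power: "reducible (\<lambda>x. t x ^ k)"
  unfolding reducible_def using c tk by blast

lemma reducible_zero: "reducible (\<lambda>x. 0)"
  unfolding reducible_def by (intro exI[of _ "\<lambda>_ _. 0"]) (auto intro: polyfun_const)

lemma reducible_add:
  assumes "reducible e" "reducible e'"
  shows "reducible (\<lambda>x. e x + e' x)"
proof -
  obtain m m' where "\<forall>j<k. polyfun r (m j) \<and> m j a = 0" "\<forall>x\<in>S. e x = (\<Sum>j<k. m j (y x) * t x ^ j)"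
    "\<forall>j<k. polyfun r (m' j) \<and> m' j a = 0" "\<forall>x\<in>S. e' x = (\<Sum>j<k. m' j (y x) * t x ^ j)"
    using assms unfolding reducible_def by blast
  then show ?thesis unfolding reducible_def
    by (intro exI[of _ "\<lambda>j z. m j z + m' j z"]) (auto intro: polyfun_add simp: sum.distrib algebra_simps)
qed

lemma reducible_mult:
  assumes "polyfun r \<phi>" "reducible e"
  shows "reducible (\<lambda>x. \<phi> (y x) * e x)"
proof -
  obtain m where "\<forall>j<k. polyfun r (m j) \<and> m j a = 0" "\<forall>x\<in>S. e x = (\<Sum>j<k. m j (y x) * t x ^ j)"
    using assms unfolding reducible_def by blast
  then show ?thesis unfolding reducible_def using assms(1)
    by (intro exI[of _ "\<lambda>j z. \<phi> z * m j z"]) (auto intro: polyfun_mult simp: sum_distrib_left mult_ac)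
qed

lemma reducible_t:
  assumes "reducible e"
  shows "reducible (\<lambda>x. t x * e x)"
proof -
  obtain m where m: "\<forall>j<k. polyfun r (m j) \<and> m j a = 0" "\<forall>x\<in>S. e x = (\<Sum>j<k. m j (y x) * t x ^ j)"
    using assms unfolding reducible_def by blast
  obtain l where l: "k = Suc l" using k by (cases k) auto
  \<comment> \<open>Multiplication by t shifts the coefficients up; the term with t ^ k that leaves
    the range is rewritten by \<open>tk\<close>.\<close>
  let ?m = "\<lambda>j z. (if j = 0 then 0 else m (j - 1) z) + m l z * c j z"
  have "polyfun r (\<lambda>z. if j = 0 then 0 else m (j - 1) z)" if "j < k" for j
    using that m(1) by (cases "j = 0") (auto intro: polyfun_const)
  then have "\<forall>j<k. polyfun r (?m j) \<and> ?m j a = 0"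
    using m(1) c l by (auto intro!: polyfun_add polyfun_mult)
  moreover have "t x * e x = (\<Sum>j<k. ?m j (y x) * t x ^ j)" if x: "x \<in> S" for x
  proof -
    have "t x * e x = (\<Sum>j<l. m j (y x) * t x ^ Suc j) + m l (y x) * t x ^ k"
      using m(2) x by (simp add: l sum_distrib_left algebra_simps)
    also have "(\<Sum>j<l. m j (y x) * t x ^ Suc j) = (\<Sum>j<k. (if j = 0 then 0 else m (j - 1) (y x)) * t x ^ j)"
      unfolding l sum.lessThan_Suc_shift by simp
    also have "m l (y x) * t x ^ k = (\<Sum>j<k. m l (y x) * c j (y x) * t x ^ j)"
      unfolding tk[OF x] by (simp add: sum_distrib_left mult_ac)
    finally show ?thesis by (simp add: sum.distrib distrib_right)
  qed
  ultimately show ?thesis unfolding reducible_def by (intro exI[of _ ?m]) blast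
qed

lemma reducible_t_power: "reducible e \<Longrightarrow> reducible (\<lambda>x. t x ^ i * e x)"
  by (induction i) (auto simp: mult.assoc dest: reducible_t)

lemma reducible_poly:
  assumes "\<And>l. polyfun r (s l)" "reducible e"
  shows "reducible (\<lambda>x. (\<Sum>l<N. s l (y x) * t x ^ l) * e x)"
proof (induction N)
  case (Suc N)
  have "reducible (\<lambda>x. (\<Sum>l<N. s l (y x) * t x ^ l) * e x + s N (y x) * (t x ^ N * e x))"
    using Suc assms by (intro reducible_add reducible_mult reducible_t_power)
  then show ?case by (simp add: algebra_simps)
qed (simp add: reducible_zero)

lemma reducible_poly_power:
  assumes "\<And>l. polyfun r (s l)" "reducible e"
  shows "reducible (\<lambda>x. (\<Sum>l<N. s l (y x) * t x ^ l) ^ i * e x)"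
proof (induction i)
  case (Suc i)
  show ?case using reducible_poly[where N = N, OF assms(1) Suc] by (simp add: mult.assoc)
qed (simp add: assms)

end

text \<open>The hypotheses on \<open>g\<close> say that \<open>p\<close> is off a cone with vertex \<open>a\<close> that contains \<open>S\<close>. The form
  \<open>f\<close> gives \<open>f\<^sub>0(y) = t s\<close> on \<open>S\<close> with \<open>f\<^sub>0(a) \<noteq> 0\<close>, so \<open>f\<^sub>0(y)\<^sup>k t\<^sup>i = t\<^sup>k s\<^sup>k t\<^sup>i\<close> is reducible, and
  elimination applies to the powers \<open>t\<^sup>i\<close> with \<open>i < k\<close>.\<close>

lemma separate_projection:
  assumes g: "hpoly r k g" "g p \<noteq> 0" and inv: "\<And>x t. g (\<lambda>i. x i + t * a i) = g x"
    and f: "hpoly r e f" "f a \<noteq> 0" and S: "\<And>x. x \<in> S \<Longrightarrow> g x = 0 \<and> f x = 0"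
  shows "\<exists>h. polyfun r h \<and> (\<forall>x\<in>S. h (\<lambda>i. x i - x r * p i) = 0) \<and> h (\<lambda>i. a i - a r * p i) \<noteq> 0"
proof (cases "k = 0")
  case True
  have "g x = g (\<lambda>i. 0)" for x using hpoly_scale[OF g(1), of 0 x] True by simp
  then have "S = {}" using S g(2) by (metis equals0I)
  then show ?thesis by (intro exI[of _ "\<lambda>_. 1"]) (auto intro: polyfun_const)
next
  case False
  obtain Q where Q: "\<And>z t. poly (Q z) t = g (\<lambda>i. z i + t * p i)" "\<And>z. degree (Q z) \<le> k"
      "\<And>z. coeff (Q z) k = g p" "\<And>l. polyfun r (\<lambda>z. coeff (Q z) l)"
    using hpoly_expand[OF g(1), of p] by auto
  obtain R where R: "\<And>z t. poly (R z) t = f (\<lambda>i. z i + t * p i)" "\<And>z. degree (R z) \<le> e"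
      "\<And>l. polyfun r (\<lambda>z. coeff (R z) l)"
    using hpoly_expand[OF f(1), of p] by auto
  \<comment> \<open>Normalised so that t vanishes at a and y fixes a. The vector y x differs from x
    - x_r p by the constant a_r p, which \<open>?h\<close> compensates at the end.\<close>
  define t where "t x = x r - a r" for x :: "nat \<Rightarrow> complex"
  define y where "y x i = x i - t x * p i" for x :: "nat \<Rightarrow> complex" and i
  define c where "c j z = - coeff (Q z) j * inverse (g p)" for j z
  define s where "s l z = - coeff (R z) (Suc l)" for l z
  define u where "u z = coeff (R z) 0 ^ k" for z
  have yt: "(\<lambda>i. y x i + t x * p i) = x" for x by (simp add: y_def)
  \<comment> \<open>As g is constant along a, g (a + \<tau> p) = g (\<tau> p) = \<tau>^k g p. Hence
    all coefficients of Q below the top one vanish at a.\<close>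
  have "Q a = Polynomial.monom (g p) k"
  proof (rule poly_eq_poly_eq_iff[THEN iffD1], rule ext)
    fix \<tau>
    have "poly (Q a) \<tau> = g (\<lambda>i. \<tau> * p i + 1 * a i)" unfolding Q(1) by (simp add: add.commute)
    also have "\<dots> = \<tau> ^ k * g p" unfolding inv by (rule hpoly_scale[OF g(1)])
    finally show "poly (Q a) \<tau> = poly (Polynomial.monom (g p) k) \<tau>" by (simp add: poly_monom)
  qed
  then have ca: "c j a = 0" if "j < k" for j using that by (simp add: c_def)
  have cp: "polyfun r (c j)" for j
    unfolding c_def[abs_def] by (intro polyfun_mult polyfun_uminus Q polyfun_const)
  have sp: "polyfun r (s j)" for j
    unfolding s_def[abs_def] by (intro polyfun_uminus R)
  interpret reduction r k a S y t c
  proof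
    fix x assume "x \<in> S"
    then have "0 = poly (Q (y x)) (t x)" unfolding Q(1) yt using S by simp
    also have "\<dots> = (\<Sum>j<k. coeff (Q (y x)) j * t x ^ j) + g p * t x ^ k"
      unfolding poly_eq_sum_atMost[OF Q(2)] using Q(3) by (simp add: lessThan_Suc_atMost[symmetric])
    finally have "t x ^ k = - (\<Sum>j<k. coeff (Q (y x)) j * t x ^ j) * inverse (g p)"
      using g(2) by (simp add: field_simps eq_neg_iff_add_eq_0)
    also have "\<dots> = (\<Sum>j<k. c j (y x) * t x ^ j)"
      by (simp add: c_def sum_distrib_left sum_distrib_right sum_negf[symmetric] mult_ac)
    finally show "t x ^ k = (\<Sum>j<k. c j (y x) * t x ^ j)" .
  qed (use ca cp False in auto)
  \<comment> \<open>f vanishes at x = y + t p, so the constant coefficient of its expansion, which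
    is f at y, is divisible by t on S.\<close>
  have ts: "coeff (R (y x)) 0 = t x * (\<Sum>l<e. s l (y x) * t x ^ l)" if "x \<in> S" for x
  proof -
    have "0 = poly (R (y x)) (t x)" unfolding R(1) yt using S that by simp
    also have "\<dots> = coeff (R (y x)) 0 - t x * (\<Sum>l<e. s l (y x) * t x ^ l)"
      unfolding poly_eq_sum_atMost[OF R(2)] lessThan_Suc_atMost[symmetric] sum.lessThan_Suc_shift
      by (simp add: s_def sum_distrib_left sum_negf mult_ac)
    finally show ?thesis by simp
  qed
  have "\<exists>m. (\<forall>j<k. polyfun r (m j) \<and> m j a = 0) \<and>
      (\<forall>x\<in>S. u (y x) * t x ^ i = (\<Sum>j<k. m j (y x) * t x ^ j))" for i
  proof -
    have "reducible (\<lambda>x. t x ^ i * ((\<Sum>l<e. s l (y x) * t x ^ l) ^ k * t x ^ k))"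
      by (intro reducible_t_power reducible_poly_power sp reducible_power)
    moreover have "t x ^ i * ((\<Sum>l<e. s l (y x) * t x ^ l) ^ k * t x ^ k) = u (y x) * t x ^ i" if "x \<in> S" for x
      by (simp add: u_def ts[OF that] power_mult_distrib mult_ac)
    ultimately show ?thesis unfolding reducible_def by simp
  qed
  then obtain m where m: "\<And>i j. j < k \<Longrightarrow> polyfun r (m i j) \<and> m i j a = 0"
      "\<And>i x. x \<in> S \<Longrightarrow> u (y x) * t x ^ i = (\<Sum>j<k. m i j (y x) * t x ^ j)"
    by metis
  have "coeff (R a) 0 = f a" using R(1)[of a 0] by (simp add: poly_0_coeff_0)
  then have "u a \<noteq> 0" using f(2) by (simp add: u_def)
  moreover have "polyfun r u" unfolding u_def[abs_def] by (intro polyfun_power R)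
  ultimately obtain H where H: "polyfun r H" "H a \<noteq> 0" "\<forall>x\<in>S. \<forall>i<k. H (y x) * t x ^ i = 0"
    using eliminate[of r u a k m S y "\<lambda>i x. t x ^ i"] m by blast
  let ?h = "\<lambda>z. H (\<lambda>i. z i + a r * p i)"
  have "polyfun r ?h" by (intro polyfun_comp[OF H(1)] polyfun_add polyfun_var polyfun_const)
  moreover have "?h (\<lambda>i. x i - x r * p i) = H (y x)" for x
    by (simp add: y_def[abs_def] t_def algebra_simps)
  \<comment> \<open>Row i = 0 of the eliminated system, where t ^ 0 = 1; it exists because k >
    0.\<close>
  moreover have "H (y x) = 0" if "x \<in> S" for x using H(3) that False by force
  moreover have "y a = a" by (simp add: y_def[abs_def] t_def)
  ultimately show ?thesis using H(2) by (intro exI[of _ ?h]) simp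
qed

section \<open>Cremona transformations given by forms\<close>

definition inverse_forms ::
    "nat \<Rightarrow> ((nat \<Rightarrow> complex) \<Rightarrow> nat \<Rightarrow> complex) \<Rightarrow> ((nat \<Rightarrow> complex) \<Rightarrow> nat \<Rightarrow> complex) \<Rightarrow> bool" where
  "inverse_forms r F A \<longleftrightarrow>
     (\<exists>h H. hpoly r h H \<and> (\<exists>x. H x \<noteq> 0) \<and> (\<forall>x. \<forall>i\<le>r. A (F x) i = H x * x i))"

definition cremona ::
    "nat \<Rightarrow> ((nat \<Rightarrow> complex) \<Rightarrow> nat \<Rightarrow> complex) \<Rightarrow> ((nat \<Rightarrow> complex) \<Rightarrow> nat \<Rightarrow> complex) \<Rightarrow> bool" where
  "cremona r F A \<longleftrightarrow> (\<exists>d. forms r r d F) \<and> (\<exists>e. forms r r e A) \<and>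
     inverse_forms r F A \<and> inverse_forms r A F"

text \<open>Pulling the factor L (F x) out of A produces the factor L (F x) ^ e * H x. It is nonzero
  because L does not vanish on the values of F: on the relevant coordinates F (A z) is K z times z,
  so these values include nonzero multiples of all z with K z \<noteq> 0.\<close>

lemma inverse_forms_comp:
  assumes F: "forms r r d F" "forms r r e A" "inverse_forms r F A" "inverse_forms r A F"
    and G: "forms r r d' G" "forms r r e' B" "inverse_forms r G B"
  shows "inverse_forms r (\<lambda>x. G (F x)) (\<lambda>x. A (B x))"
proof -
  obtain h H where H: "hpoly r h H" "\<exists>x. H x \<noteq> 0" "\<And>x i. i \<le> r \<Longrightarrow> A (F x) i = H x * x i"
    using F(3) unfolding inverse_forms_def by blast
  obtain k K where K: "hpoly r k K" "\<exists>x. K x \<noteq> 0" "\<And>x i. i \<le> r \<Longrightarrow> F (A x) i = K x * x i"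
    using F(4) unfolding inverse_forms_def by blast
  obtain l L where L: "hpoly r l L" "\<exists>x. L x \<noteq> 0" "\<And>x i. i \<le> r \<Longrightarrow> B (G x) i = L x * x i"
    using G(3) unfolding inverse_forms_def by blast
  let ?M = "\<lambda>x. L (F x) ^ e * H x"
  have LF: "hpoly r (l * d) (\<lambda>x. L (F x))" using L(1) forms_hpoly[OF F(1)] by (rule hpoly_comp)
  have "hpoly r (e * (l * d) + h) ?M"
    by (intro hpoly_mult hpoly_power LF H)
  moreover have "A (B (G (F x))) i = ?M x * x i" if "i \<le> r" for x i
  proof -
    have "B (G (F x)) = (\<lambda>i. L (F x) * F x i)"
    proof
      fix j
      show "B (G (F x)) j = L (F x) * F x j"
      proof (cases "j \<le> r")
        case True
        then show ?thesis by (rule L(3))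
      next
        case False
        then show ?thesis using F(1) G(2) unfolding forms_def by simp
      qed
    qed
    then show ?thesis using forms_scale[OF F(2), of "L (F x)" "F x"] H(3)[OF that, of x] by simp
  qed
  moreover have "\<exists>x. ?M x \<noteq> 0"
  proof -
    obtain b c where "K b \<noteq> 0" "L c \<noteq> 0" using K(2) L(2) by blast
    then obtain z where z: "K z \<noteq> 0" "L z \<noteq> 0"
      using polyfun_no_zero_divisors[OF K(1)[THEN hpoly_imp_polyfun] L(1)[THEN hpoly_imp_polyfun]] by blast
    have "L (F (A z)) = L (\<lambda>i. K z * z i)" by (rule hpoly_cong[OF L(1)]) (rule K(3))
    then have "L (F (A z)) \<noteq> 0" using z hpoly_scale[OF L(1), of "K z" z] by simp
    then obtain y where "L (F y) \<noteq> 0 \<and> H y \<noteq> 0"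
      using polyfun_no_zero_divisors[OF LF[THEN hpoly_imp_polyfun] H(1)[THEN hpoly_imp_polyfun]] H(2) by blast
    then show ?thesis by (intro exI[of _ y]) simp
  qed
  ultimately show ?thesis unfolding inverse_forms_def by blast
qed

lemma cremona_comp:
  assumes "cremona r F A" "cremona r G B"
  shows "cremona r (\<lambda>x. G (F x)) (\<lambda>x. A (B x))"
proof -
  obtain d e d' e' where forms: "forms r r d F" "forms r r e A" "forms r r d' G" "forms r r e' B"
    using assms unfolding cremona_def by blast
  have inv: "inverse_forms r F A" "inverse_forms r A F" "inverse_forms r G B" "inverse_forms r B G"
    using assms unfolding cremona_def by blast+
  show ?thesis
    unfolding cremona_def
    using forms_comp[OF forms(1,3)] forms_comp[OF forms(4,2)]
      inverse_forms_comp[OF forms(1,2) inv(1,2) forms(3,4) inv(3)]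
      inverse_forms_comp[OF forms(4,3) inv(4,3) forms(2,1) inv(2)] by blast
qed

section \<open>The rational map given by a tuple of forms\<close>

definition forms_map :: "nat \<Rightarrow> ((nat \<Rightarrow> complex) \<Rightarrow> nat \<Rightarrow> complex) \<Rightarrow> (point \<rightharpoonup> point)" where
  "forms_map r F p =
     (if p \<in> proj_space r \<and> (\<exists>x\<in>p. \<exists>i. F x i \<noteq> 0) then Some (pt r (F (SOME x. x \<in> p))) else None)"

text \<open>Homogeneity makes the vector chosen by \<open>SOME\<close> immaterial.\<close>

lemma forms_map_apply:
  assumes F: "forms r r d F" and p: "p \<in> dom (forms_map r F)"
  shows "p \<in> proj_space r" "the (forms_map r F p) \<in> proj_space r" "x \<in> p \<Longrightarrow> F x \<in> the (forms_map r F p)"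
proof -
  obtain y i where *: "p \<in> proj_space r" "y \<in> p" "F y i \<noteq> 0"
    using p by (auto simp: forms_map_def split: if_splits)
  have hc: "F x \<in> hom_coords r" if xp: "x \<in> p" for x
  proof -
    obtain c where "c \<noteq> 0" "x = (\<lambda>i. c * y i)" using point_same[OF *(1,2) xp] by blast
    then have "F x i \<noteq> 0" using forms_scale[OF F, of c y] *(3) by simp
    then show ?thesis using forms_hom_coords[OF F] by blast
  qed
  let ?z = "SOME x. x \<in> p"
  have z: "?z \<in> p" using *(2) by (metis someI)
  have val: "the (forms_map r F p) = pt r (F ?z)" using * by (auto simp: forms_map_def)
  show "p \<in> proj_space r" by (rule *(1))
  show "the (forms_map r F p) \<in> proj_space r" unfolding val using pt_in_proj_space hc z by blast
  show "F x \<in> the (forms_map r F p)" if x: "x \<in> p"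
  proof -
    obtain c where "c \<noteq> 0" "x = (\<lambda>i. c * ?z i)" using point_same[OF *(1) z x] by blast
    then show ?thesis unfolding val mem_pt_iff[OF hc[OF z]]
      using forms_scale[OF F, of c ?z] by (intro exI[of _ "c ^ d"]) auto
  qed
qed

lemma forms_map_dom:
  "dom (forms_map r F) = {p \<in> proj_space r. \<exists>x\<in>p. \<exists>i. F x i \<noteq> 0}"
  by (auto simp: forms_map_def dom_def split: if_splits)

lemma forms_map_rep:
  assumes F: "forms r r d F" and nz: "F a j \<noteq> 0"
  shows "forms_map r F \<in> rational_reps r (proj_space r) r (proj_space r)"
proof -
  let ?f = "forms_map r F"
  have eq: "dom ?f = (\<Union>i. proj_space r - {p \<in> proj_space r. \<forall>x\<in>p. F x i = 0})"
    unfolding forms_map_dom by blast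
  have "openin (zariski r) (proj_space r - {p \<in> proj_space r. \<forall>x\<in>p. F x i = 0})" for i
    using openin_diff[OF openin_topspace closedin_zero_set[OF forms_hpoly[OF F]]] by simp
  then have op: "openin (zariski r) (dom ?f)" unfolding eq by (intro openin_Union) auto
  then have op': "openin (subtopology (zariski r) (proj_space r)) (dom ?f)"
    by (metis subtopology_topspace topspace_zariski)
  obtain x where x: "x \<in> hom_coords r" "F x j \<noteq> 0"
    using polyfun_nonzero_hom_coords[OF forms_polyfun[OF F] nz] by blast
  then have "pt r x \<in> dom ?f" unfolding forms_map_dom using pt_self pt_in_proj_space by blast
  then have ne: "dom ?f \<noteq> {}" by blast
  have ran: "ran ?f \<subseteq> proj_space r"
  proof
    fix q assume "q \<in> ran ?f"
    then obtain p where p: "?f p = Some q" by (auto simp: ran_def)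
    then have "p \<in> dom ?f" by blast
    then show "q \<in> proj_space r" using forms_map_apply(2)[OF F, of p] p by simp
  qed
  have "\<exists>f. \<forall>i. hom_poly r d (f i) \<and> (\<lambda>x. F x i) = mpoly_eval (f i)"
    using forms_hpoly[OF F] unfolding hpoly_iff by (intro choice) blast
  then obtain f where f: "\<And>i. hom_poly r d (f i)" "\<And>i. (\<lambda>x. F x i) = mpoly_eval (f i)" by blast
  have Ff: "(\<lambda>i. if i \<le> r then mpoly_eval (f i) x else 0) = F x" for x
    using F fun_cong[OF f(2)] by (auto simp: forms_def fun_eq_iff)
  have "regular_map r r ?f"
    unfolding regular_map_def
  proof (intro conjI ballI exI[of _ "proj_space r"] exI[of _ f] exI[of _ d] ran)
    show "openin (zariski r) (proj_space r)" using openin_topspace[of "zariski r"] by simp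
  qed (use f(1) Ff forms_map_apply[OF F] in auto)
  then show ?thesis unfolding rational_reps_def using op' ne ran by blast
qed

lemma forms_map_rational:
  assumes F: "forms r r d F" and nz: "F a j \<noteq> 0"
  defines "\<omega> \<equiv> rational_eq r (proj_space r) r (proj_space r) `` {forms_map r F}"
  shows "\<omega> \<in> rational_maps r (proj_space r) r (proj_space r)" "generic_forms r r \<omega> F"
    "x \<in> hom_coords r \<Longrightarrow> F x i \<noteq> 0 \<Longrightarrow> pt r x \<in> rat_dom \<omega>"
proof -
  let ?f = "forms_map r F"
  have rep: "?f \<in> rational_reps r (proj_space r) r (proj_space r)" by (rule forms_map_rep[OF F nz])
  then show \<omega>: "\<omega> \<in> rational_maps r (proj_space r) r (proj_space r)"
    unfolding rational_maps_def \<omega>_def by (rule quotientI)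
  have f: "?f \<in> \<omega>" using rep by (auto simp: \<omega>_def rational_eq_def)
  have dom: "pt r x \<in> dom ?f" if "x \<in> hom_coords r" "F x i \<noteq> 0" for x i
    unfolding forms_map_dom using that pt_self pt_in_proj_space by blast
  then show "x \<in> hom_coords r \<Longrightarrow> F x i \<noteq> 0 \<Longrightarrow> pt r x \<in> rat_dom \<omega>"
    using f unfolding rat_dom_def by blast
  have "pt r x \<in> rat_dom \<omega> \<and> F x \<in> rat_apply \<omega> (pt r x)" if x: "x \<in> hom_coords r" "F x j \<noteq> 0" for x
  proof -
    have d: "pt r x \<in> dom ?f" by (rule dom[OF x])
    have "F x \<in> rat_apply \<omega> (pt r x)"
      unfolding rat_apply_rep[OF \<omega> f d] using forms_map_apply(3)[OF F d] pt_self[OF x(1)] by blast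
    then show ?thesis using f d unfolding rat_dom_def by blast
  qed
  then show "generic_forms r r \<omega> F"
    unfolding generic_forms_def using F nz forms_polyfun[OF F, of j] by blast
qed

text \<open>A form g that vanishes on the closure of the image satisfies g (F y) = 0 for all y.
  Substituting y = A z gives K^l g = 0, hence g = 0, so no point can be separated from the
  closure.\<close>

lemma dominant_inverse_forms:
  assumes \<omega>: "\<omega> \<in> rational_maps r (proj_space r) r (proj_space r)" and F: "generic_forms r r \<omega> F"
    and A: "forms r r e A" "inverse_forms r A F"
  shows "dominant r (proj_space r) \<omega>"
  unfolding dominant_def
proof
  let ?I = "rat_apply \<omega> ` rat_dom \<omega>"
  let ?C = "zariski r closure_of ?I"
  show "?C \<subseteq> proj_space r" using closure_of_subset_topspace[of "zariski r" ?I] by simp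
  have I: "?I \<subseteq> ?C" using rat_apply_in(2)[OF \<omega>] by (intro closure_of_subset) auto
  obtain k K where K: "hpoly r k K" "\<exists>x. K x \<noteq> 0" "\<And>x i. i \<le> r \<Longrightarrow> F (A x) i = K x * x i"
    using A(2) unfolding inverse_forms_def by blast
  obtain d D a where D: "forms r r d F" "polyfun r D" "D a \<noteq> 0" "\<forall>x\<in>hom_coords r. D x \<noteq> 0 \<longrightarrow>
        pt r x \<in> rat_dom \<omega> \<and> F x \<in> rat_apply \<omega> (pt r x)"
    using F unfolding generic_forms_def by blast
  show "proj_space r \<subseteq> ?C"
  proof
    fix p assume p: "p \<in> proj_space r"
    obtain x where x: "x \<in> p" using proj_space_nonempty[OF p] by blast
    show "p \<in> ?C"
    proof (rule ccontr)
      assume "p \<notin> ?C"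
      then obtain l g where g: "hpoly r l g" "g x \<noteq> 0" "\<forall>q\<in>?C. \<forall>y\<in>q. g y = 0"
        using closedin_separate[OF closedin_closure_of point_coords[OF p x]] point_eq_pt[OF p x] by metis
      have gF: "g (F y) = 0" for y
      proof (rule polyfun_zero_generic[where f = "\<lambda>y. g (F y)", OF D(2,3)])
        show "polyfun r (\<lambda>y. g (F y))"
          by (rule polyfun_comp[OF hpoly_imp_polyfun[OF g(1)] forms_polyfun[OF D(1)]])
      next
        fix y assume y: "y \<in> hom_coords r" "D y \<noteq> 0"
        then have "pt r y \<in> rat_dom \<omega>" "F y \<in> rat_apply \<omega> (pt r y)" using D(4) by auto
        moreover then have "rat_apply \<omega> (pt r y) \<in> ?C" using I by blast
        ultimately show "g (F y) = 0" using g(3) by blast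
      qed
      obtain b where b: "K b \<noteq> 0" using K(2) by blast
      have "g x = 0"
      proof (rule polyfun_cancel[OF hpoly_imp_polyfun[OF K(1)] hpoly_imp_polyfun[OF g(1)] b])
        fix z assume "K z \<noteq> 0"
        moreover have "g (F (A z)) = g (\<lambda>i. K z * z i)" by (rule hpoly_cong[OF g(1)]) (rule K(3))
        ultimately show "g z = 0" using gF[of "A z"] hpoly_scale[OF g(1), of "K z" z] by simp
      qed
      then show False using g(2) by simp
    qed
  qed
qed

text \<open>F may vanish at p, and A at its image, although both maps are defined there. Tuples G
  and B valid at these points take their place. That A (F x) is parallel to x carries over to B (G
  x) in two cancellations.\<close>

lemma inverse_forms_left_inverse:
  assumes \<omega>: "\<omega> \<in> rational_maps r (proj_space r) r (proj_space r)" "generic_forms r r \<omega> F"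
    and \<eta>: "\<eta> \<in> rational_maps r (proj_space r) r (proj_space r)" "generic_forms r r \<eta> A"
    and inv: "inverse_forms r F A"
    and p: "p \<in> rat_dom \<omega>" "rat_apply \<omega> p \<in> rat_dom \<eta>"
  shows "rat_apply \<eta> (rat_apply \<omega> p) = p"
proof -
  let ?q = "rat_apply \<omega> p"
  obtain h H where H: "hpoly r h H" "\<exists>x. H x \<noteq> 0" "\<And>x i. i \<le> r \<Longrightarrow> A (F x) i = H x * x i"
    using inv unfolding inverse_forms_def by blast
  obtain G where G: "generic_forms r r \<omega> G" "\<forall>x\<in>p. G x \<in> ?q"
    using generic_forms_at[OF \<omega>(1) p(1)] by blast
  obtain B where B: "generic_forms r r \<eta> B" "\<forall>y\<in>?q. B y \<in> rat_apply \<eta> ?q"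
    using generic_forms_at[OF \<eta>(1) p(2)] by blast
  obtain d d' e where d: "forms r r d F" "forms r r d' G" "forms r r e B"
    using \<omega>(2) G(1) B(1) unfolding generic_forms_def by blast
  have comp: "polyfun r (\<lambda>x. B (F x) i)" "polyfun r (\<lambda>x. B (G x) i)" for i
    by (rule polyfun_comp[OF forms_polyfun[OF d(3)] forms_polyfun[OF d(1)]],
        rule polyfun_comp[OF forms_polyfun[OF d(3)] forms_polyfun[OF d(2)]])
  \<comment> \<open>A is exchanged for B, by cancelling H.\<close>
  have BF: "B (F x) i * x l = B (F x) l * x i" if il: "i \<le> r" "l \<le> r" for x i l
  proof -
    obtain b where b: "H b \<noteq> 0" using H(2) by blast
    have "B (F x) i * x l - B (F x) l * x i = 0"
    proof (rule polyfun_cancel[where g = "\<lambda>x. B (F x) i * x l - B (F x) l * x i",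
          OF hpoly_imp_polyfun[OF H(1)] _ b])
      show "polyfun r (\<lambda>x. B (F x) i * x l - B (F x) l * x i)"
        using il by (intro polyfun_diff polyfun_mult comp polyfun_var)
    next
      fix z assume z: "H z \<noteq> 0"
      have "B (F z) i * A (F z) l = B (F z) l * A (F z) i"
        by (rule parallelD[OF generic_forms_parallel[OF \<eta>(1) B(1) \<eta>(2)]])
      then have "H z * (B (F z) i * z l - B (F z) l * z i) = 0"
        unfolding H(3)[OF il(1)] H(3)[OF il(2)] by (simp add: algebra_simps)
      then show "B (F z) i * z l - B (F z) l * z i = 0" using z by simp
    qed
    then show ?thesis by simp
  qed
  obtain a j where a: "F a j \<noteq> 0" using generic_forms_nonzero[OF \<omega>] by blast
  \<comment> \<open>F is exchanged for G, by cancelling a nonzero coordinate of F.\<close>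
  have BG: "B (G x) i * x l = B (G x) l * x i" if il: "i \<le> r" "l \<le> r" for x i l
  proof -
    have "B (G x) i * x l - B (G x) l * x i = 0"
    proof (rule polyfun_cancel[where g = "\<lambda>x. B (G x) i * x l - B (G x) l * x i",
          OF forms_polyfun[OF d(1)] _ a])
      show "polyfun r (\<lambda>x. B (G x) i * x l - B (G x) l * x i)"
        using il by (intro polyfun_diff polyfun_mult comp polyfun_var)
    next
      fix z assume z: "F z j \<noteq> 0"
      have "(\<lambda>i. F z j * G z i) = (\<lambda>i. G z j * F z i)"
        using parallelD[OF generic_forms_parallel[OF \<omega> G(1), of z], of j] by (simp add: mult.commute)
      then have *: "F z j ^ e * B (G z) i = G z j ^ e * B (F z) i" for i
        using forms_scale[OF d(3)] by metis
      have "F z j ^ e * (B (G z) i * z l - B (G z) l * z i) =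
          (F z j ^ e * B (G z) i) * z l - (F z j ^ e * B (G z) l) * z i"
        by (simp add: right_diff_distrib)
      also have "\<dots> = G z j ^ e * (B (F z) i * z l - B (F z) l * z i)"
        unfolding * by (simp add: right_diff_distrib)
      also have "\<dots> = 0" using BF[OF il] by simp
      finally show "B (G z) i * z l - B (G z) l * z i = 0" using z by simp
    qed
    then show ?thesis by simp
  qed
  have pP: "p \<in> proj_space r" using rat_dom_subset[OF \<omega>(1)] p(1) by blast
  obtain x where x: "x \<in> p" using proj_space_nonempty[OF pP] by blast
  have "parallel (B (G x)) x"
    unfolding parallel_def
  proof (intro allI)
    fix i l
    have "B (G x) k = 0" "x k = 0" if "\<not> k \<le> r" for k
      using d(3) point_coords[OF pP x] that by (auto simp: forms_def hom_coords_def)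
    then show "B (G x) i * x l = B (G x) l * x i"
      using BG[of i l x] by (cases "i \<le> r"; cases "l \<le> r") auto
  qed
  moreover have "B (G x) \<in> rat_apply \<eta> ?q" using B(2) G(2) x by blast
  ultimately show ?thesis
    using parallel_points_eq[OF rat_apply_in(2)[OF \<eta>(1) p(2)] pP _ x] by blast
qed

lemma cremona_birational:
  assumes "cremona r F A"
  shows "\<exists>\<omega>\<in>birational_maps r (proj_space r) r (proj_space r).
     generic_forms r r \<omega> F \<and> (\<forall>x\<in>hom_coords r. \<forall>i. F x i \<noteq> 0 \<longrightarrow> pt r x \<in> rat_dom \<omega>)"
proof -
  obtain d e where F: "forms r r d F" "forms r r e A"
    and inv: "inverse_forms r F A" "inverse_forms r A F"
    using assms unfolding cremona_def by blast
  have nz: "\<exists>a j. G a j \<noteq> 0" if BG: "inverse_forms r B G" for G B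
  proof -
    obtain h H where H: "hpoly r h H" "\<exists>x. H x \<noteq> 0" "\<And>x i. i \<le> r \<Longrightarrow> G (B x) i = H x * x i"
      using BG unfolding inverse_forms_def by blast
    obtain x where x: "x \<in> hom_coords r" "H x \<noteq> 0"
      using polyfun_nonzero_hom_coords[OF hpoly_imp_polyfun[OF H(1)]] H(2) by blast
    then obtain i where "x i \<noteq> 0" "i \<le> r" by (auto simp: hom_coords_def intro: leI)
    then have "G (B x) i \<noteq> 0" using H(3) x by simp
    then show ?thesis by blast
  qed
  obtain a j where a: "F a j \<noteq> 0" using nz[OF inv(2)] by blast
  obtain b l where b: "A b l \<noteq> 0" using nz[OF inv(1)] by blast
  let ?\<omega> = "rational_eq r (proj_space r) r (proj_space r) `` {forms_map r F}"
  let ?\<eta> = "rational_eq r (proj_space r) r (proj_space r) `` {forms_map r A}"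
  note \<omega> = forms_map_rational[OF F(1) a] and \<eta> = forms_map_rational[OF F(2) b]
  have "?\<omega> \<in> birational_maps r (proj_space r) r (proj_space r)"
    unfolding birational_maps_def
  proof (intro CollectI conjI bexI[of _ ?\<eta>] ballI impI)
    show "dominant r (proj_space r) ?\<omega>" by (rule dominant_inverse_forms[OF \<omega>(1,2) F(2) inv(2)])
    show "dominant r (proj_space r) ?\<eta>" by (rule dominant_inverse_forms[OF \<eta>(1,2) F(1) inv(1)])
    show "rat_apply ?\<eta> (rat_apply ?\<omega> p) = p" if "p \<in> rat_dom ?\<omega>" "rat_apply ?\<omega> p \<in> rat_dom ?\<eta>" for p
      using inverse_forms_left_inverse[OF \<omega>(1,2) \<eta>(1,2) inv(1)] that by blast
    show "rat_apply ?\<omega> (rat_apply ?\<eta> p) = p" if "p \<in> rat_dom ?\<eta>" "rat_apply ?\<eta> p \<in> rat_dom ?\<omega>" for p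
      using inverse_forms_left_inverse[OF \<eta>(1,2) \<omega>(1,2) inv(2)] that by blast
  qed (use \<omega>(1) \<eta>(1) in auto)
  then show ?thesis using \<omega>(2,3) by (intro bexI[of _ ?\<omega>]) auto
qed

section \<open>Contractions\<close>

lemma irreducible_zero_product:
  assumes T: "irreducible_in (zariski n) T" and f: "hpoly n d f" and g: "hpoly n e g"
    and fg: "\<And>p x. p \<in> T \<Longrightarrow> x \<in> p \<Longrightarrow> f x * g x = 0"
  shows "(\<forall>p\<in>T. \<forall>x\<in>p. f x = 0) \<or> (\<forall>p\<in>T. \<forall>x\<in>p. g x = 0)"
proof -
  have TP: "T \<subseteq> proj_space n" using T by (simp add: irreducible_in_def)
  define A where "A = T \<inter> {p \<in> proj_space n. \<forall>x\<in>p. f x = 0}"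
  define B where "B = T \<inter> {p \<in> proj_space n. \<forall>x\<in>p. g x = 0}"
  have cl: "closedin (subtopology (zariski n) T) A" "closedin (subtopology (zariski n) T) B"
    unfolding A_def B_def
    by (rule closedin_subtopology_Int_closed, rule closedin_zero_set, rule f,
        rule closedin_subtopology_Int_closed, rule closedin_zero_set, rule g)
  have "p \<in> A \<union> B" if p: "p \<in> T" for p
  proof -
    have pP: "p \<in> proj_space n" using p TP by blast
    obtain x where x: "x \<in> p" using proj_space_nonempty[OF pP] by blast
    have all: "\<forall>y\<in>p. h y = 0" if h: "h x = 0" "hpoly n k h" for h k
    proof
      fix y assume "y \<in> p"
      then obtain c where "y = (\<lambda>i. c * x i)" using point_same[OF pP x] by blast
      then show "h y = 0" using hpoly_scale[OF h(2), of c x] h(1) by simp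
    qed
    have "f x = 0 \<or> g x = 0" using fg[OF p x] by simp
    then show ?thesis
    proof
      assume "f x = 0"
      from all[OF this f] show ?thesis using p pP by (simp add: A_def)
    next
      assume "g x = 0"
      from all[OF this g] show ?thesis using p pP by (simp add: B_def)
    qed
  qed
  moreover have "A \<subseteq> T" "B \<subseteq> T" by (simp_all add: A_def B_def)
  ultimately have "A \<union> B = T" by blast
  moreover have top: "topspace (subtopology (zariski n) T) = T" using TP by (simp add: Int_absorb1)
  moreover have "irreducible_space (subtopology (zariski n) T)" using T by (simp add: irreducible_in_def)
  ultimately have "A = T \<or> B = T" using cl unfolding irreducible_space_def by simp
  then show ?thesis
  proof
    assume "A = T"
    then have "p \<in> A" if "p \<in> T" for p using that by simp
    then show ?thesis by (simp add: A_def)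
  next
    assume "B = T"
    then have "p \<in> B" if "p \<in> T" for p using that by simp
    then show ?thesis by (simp add: B_def)
  qed
qed

lemma closedin_point:
  assumes v: "v \<in> hom_coords n"
  shows "closedin (zariski n) {pt n v}"
proof -
  let ?Z = "\<lambda>i j. {p \<in> proj_space n. \<forall>x\<in>p. v i * x j - v j * x i = 0}"
  have "{pt n v} = (\<Inter>ij\<in>{..n} \<times> {..n}. ?Z (fst ij) (snd ij))"
  proof (intro equalityI subsetI)
    fix p assume "p \<in> {pt n v}"
    then show "p \<in> (\<Inter>ij\<in>{..n} \<times> {..n}. ?Z (fst ij) (snd ij))"
      using pt_in_proj_space[OF v] mem_pt_iff[OF v] by auto
  next
    fix p assume p: "p \<in> (\<Inter>ij\<in>{..n} \<times> {..n}. ?Z (fst ij) (snd ij))"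
    then have pP: "p \<in> proj_space n" by force
    obtain x where x: "x \<in> p" using proj_space_nonempty[OF pP] by blast
    have "parallel v x"
      unfolding parallel_def
    proof (intro allI)
      fix i j
      have z: "v k = 0" "x k = 0" if "\<not> k \<le> n" for k
        using that v point_coords[OF pP x] by (auto simp: hom_coords_def)
      show "v i * x j = v j * x i"
      proof (cases "i \<le> n \<and> j \<le> n")
        case True
        then have "p \<in> ?Z i j" using p by force
        then show ?thesis using x by auto
      qed (use z in auto)
    qed
    then show "p \<in> {pt n v}"
      using parallel_points_eq[OF pt_in_proj_space[OF v] pP pt_self[OF v] x] by simp
  qed
  moreover have "closedin (zariski n) (\<Inter>ij\<in>{..n} \<times> {..n}. ?Z (fst ij) (snd ij))"
  proof (rule closedin_INT)
    fix ij assume "ij \<in> {..n} \<times> {..n}"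
    then show "closedin (zariski n) (?Z (fst ij) (snd ij))"
      by (intro closedin_zero_set[of n "Suc 0"] hpoly_diff hpoly_cmult hpoly_var) auto
  qed auto
  ultimately show ?thesis by simp
qed

text \<open>F vanishes on T wherever \<open>\<phi>\<close> does, so a point of T in the domain needs
  its own tuple G. Multiplied by \<open>\<phi>\<close>, the minors of G against v vanish on T, and
  irreducibility cancels \<open>\<phi>\<close>: the density argument takes place on T instead of the
  whole space.\<close>

lemma contracts_to_pointI:
  assumes \<omega>: "\<omega> \<in> rational_maps r (proj_space r) r (proj_space r)" and F: "generic_forms r r \<omega> F"
    and dom: "\<And>x i. x \<in> hom_coords r \<Longrightarrow> F x i \<noteq> 0 \<Longrightarrow> pt r x \<in> rat_dom \<omega>"
    and T: "irreducible_in (zariski r) T" and v: "v \<in> hom_coords r" and \<phi>: "hpoly r k \<phi>"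
    and Fv: "\<And>p x i. p \<in> T \<Longrightarrow> x \<in> p \<Longrightarrow> F x i = \<phi> x * v i"
    and nz: "p0 \<in> T" "x0 \<in> p0" "\<phi> x0 \<noteq> 0"
  shows "contracts_to_point r \<omega> T (pt r v)"
proof -
  have TP: "T \<subseteq> proj_space r" using T by (simp add: irreducible_in_def)
  have x0: "x0 \<in> hom_coords r" "p0 = pt r x0" using nz TP point_coords point_eq_pt by blast+
  obtain i where "v i \<noteq> 0" using v by (auto simp: hom_coords_def)
  then have "F x0 i \<noteq> 0" using Fv nz by simp
  then have p0: "p0 \<in> T \<inter> rat_dom \<omega>" using dom x0 nz(1) by blast
  have val: "rat_apply \<omega> p = pt r v" if p: "p \<in> T \<inter> rat_dom \<omega>" for p
  proof -
    obtain G where G: "generic_forms r r \<omega> G" "\<forall>x\<in>p. G x \<in> rat_apply \<omega> p"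
      using generic_forms_at[OF \<omega>] p by blast
    obtain e where e: "forms r r e G" using G(1) unfolding generic_forms_def by blast
    have Gv: "G x i * v j - G x j * v i = 0" if "q \<in> T" "x \<in> q" for q x i j
    proof -
      have h: "hpoly r e (\<lambda>x. v j * G x i - v i * G x j)"
        by (intro hpoly_diff hpoly_cmult forms_hpoly[OF e])
      have "\<phi> x * (v j * G x i - v i * G x j) = 0" if "q \<in> T" "x \<in> q" for q x
        using parallelD[OF generic_forms_parallel[OF \<omega> G(1) F, of x], of i j]
        unfolding Fv[OF that] by (simp add: algebra_simps)
      then show ?thesis
        using irreducible_zero_product[OF T \<phi> h] nz that by (metis mult.commute)
    qed
    have pP: "p \<in> proj_space r" using p TP by blast
    obtain x where x: "x \<in> p" using proj_space_nonempty[OF pP] by blast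
    have "parallel (G x) v" unfolding parallel_def using Gv[of p x] p x by simp
    then show ?thesis
      using parallel_points_eq[OF rat_apply_in(2)[OF \<omega>] pt_in_proj_space[OF v] _ pt_self[OF v]] G(2) x p
      by blast
  qed
  then have "rat_apply \<omega> ` (T \<inter> rat_dom \<omega>) = {pt r v}" using p0 by blast
  moreover have "zariski r closure_of {pt r v} = {pt r v}"
    using closedin_point[OF v] by (simp add: closure_of_eq)
  ultimately show ?thesis using p0 unfolding contracts_to_point_def by auto
qed

section \<open>Explicit Cremona transformations\<close>

lemma cremonaI:
  assumes "forms r r d F" "forms r r e A" "hpoly r h H" "H a \<noteq> 0" "hpoly r k K" "K b \<noteq> 0"
    "\<And>x i. i \<le> r \<Longrightarrow> A (F x) i = H x * x i" "\<And>y i. i \<le> r \<Longrightarrow> F (A y) i = K y * y i"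
  shows "cremona r F A"
  using assms unfolding cremona_def inverse_forms_def by blast

lemma cremona_id: "cremona r (\<lambda>x i. if i \<le> r then x i else 0) (\<lambda>x i. if i \<le> r then x i else 0)"
proof (rule cremonaI)
  show "forms r r (Suc 0) (\<lambda>x i. if i \<le> r then x i else 0)"
    unfolding forms_def by (auto intro: hpoly_var)
  then show "forms r r (Suc 0) (\<lambda>x i. if i \<le> r then x i else 0)" .
  show "hpoly r 0 (\<lambda>x. 1)" "hpoly r 0 (\<lambda>x. 1)" by (rule hpoly_const)+
qed auto

text \<open>For p with last coordinate 1 this picks the point where the line through x and p meets
  the hyperplane x_r = 0.\<close>

definition proj_from :: "nat \<Rightarrow> (nat \<Rightarrow> complex) \<Rightarrow> (nat \<Rightarrow> complex) \<Rightarrow> nat \<Rightarrow> complex" where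
  "proj_from r p x i = x i - x r * p i"

text \<open>The affine chart used later is z_0 = 1. Coordinate 0 is therefore a combination l of the
  projected coordinates, which can be chosen not to vanish identically on any T_i.\<close>

definition proj_coords ::
    "nat \<Rightarrow> (nat \<Rightarrow> complex) \<Rightarrow> (nat \<Rightarrow> complex) \<Rightarrow> (nat \<Rightarrow> complex) \<Rightarrow> nat \<Rightarrow> complex" where
  "proj_coords r p l x i = (if i = 0 then \<Sum>j<r. l j * proj_from r p x j
     else if i < r then proj_from r p x i else if i = r then x r else 0)"

text \<open>Solves the combination l for its first summand and so recovers the projection from z_0,
  ..., z_{r-1}; this is the purpose of requiring \<open>l 0 \<noteq> 0\<close>.\<close>

definition lift_coords :: "nat \<Rightarrow> (nat \<Rightarrow> complex) \<Rightarrow> (nat \<Rightarrow> complex) \<Rightarrow> nat \<Rightarrow> complex" where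
  "lift_coords r l z i = (if i = 0 then (z 0 - (\<Sum>j\<in>{1..<r}. l j * z j)) * inverse (l 0)
     else if i < r then z i else 0)"

lemma hpoly_proj_from: "i \<le> r \<Longrightarrow> hpoly r (Suc 0) (\<lambda>x. proj_from r p x i)"
  unfolding proj_from_def
  using hpoly_diff[OF hpoly_var hpoly_cmult[OF hpoly_var], of i r r "p i"] by (simp add: mult.commute)

lemma forms_proj_coords: "r > 0 \<Longrightarrow> forms r r (Suc 0) (proj_coords r p l)"
  unfolding forms_def
proof (intro conjI allI impI)
  fix i assume i: "i \<le> r" and r: "r > 0"
  consider "i = 0" | "0 < i" "i < r" | "0 < i" "i = r" using i by linarith
  then show "hpoly r (Suc 0) (\<lambda>x. proj_coords r p l x i)"
  proof cases
    case 1
    then show ?thesis unfolding proj_coords_def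
      by (simp, intro hpoly_sum hpoly_cmult hpoly_proj_from) auto
  next
    case 2
    then show ?thesis unfolding proj_coords_def using hpoly_proj_from by simp
  next
    case 3
    then show ?thesis unfolding proj_coords_def using hpoly_var by simp
  qed
qed (auto simp: proj_coords_def)

lemma hpoly_lift_coords: "r > 0 \<Longrightarrow> hpoly r (Suc 0) (\<lambda>x. lift_coords r l x i)"
proof -
  assume r: "r > 0"
  have "hpoly r (Suc 0) (\<lambda>z. inverse (l 0) * (z 0 - (\<Sum>j\<in>{1..<r}. l j * z j)))"
    by (intro hpoly_diff hpoly_sum hpoly_cmult hpoly_var) auto
  then show ?thesis
    using hpoly_var[of i r] hpoly_zero[of r "Suc 0"] unfolding lift_coords_def
    by (cases "i = 0"; cases "i < r") (simp_all add: mult.commute)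
qed

lemma lift_proj_coords:
  assumes "r > 0" "l 0 \<noteq> 0" "p r = 1" "i \<le> r"
  shows "lift_coords r l (proj_coords r p l x) i = proj_from r p x i"
proof -
  have "(\<Sum>j<r. l j * proj_from r p x j) = l 0 * proj_from r p x 0 + (\<Sum>j\<in>{1..<r}. l j * proj_from r p x j)"
    using assms(1) by (simp add: lessThan_atLeast0 sum.atLeast_Suc_lessThan)
  moreover have "(\<Sum>j\<in>{1..<r}. l j * proj_coords r p l x j) = (\<Sum>j\<in>{1..<r}. l j * proj_from r p x j)"
    by (rule sum.cong) (auto simp: proj_coords_def)
  moreover have "proj_from r p x r = 0" using assms(3) by (simp add: proj_from_def)
  ultimately show ?thesis using assms
    by (auto simp: lift_coords_def proj_coords_def)
qed

lemma cremona_proj_coords: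
  assumes r: "r > 0" and l: "l 0 \<noteq> 0" and p: "p r = 1" "\<And>i. i > r \<Longrightarrow> p i = 0"
  shows "cremona r (proj_coords r p l) (\<lambda>z i. lift_coords r l z i + p i * z r)"
proof (rule cremonaI)
  show "forms r r (Suc 0) (proj_coords r p l)" by (rule forms_proj_coords[OF r])
  have "hpoly r (Suc 0) (\<lambda>z. lift_coords r l z i + p i * z r)" for i
    by (intro hpoly_add hpoly_lift_coords r hpoly_cmult hpoly_var) simp
  then show "forms r r (Suc 0) (\<lambda>z i. lift_coords r l z i + p i * z r)"
    unfolding forms_def using p(2) r by (auto simp: lift_coords_def)
  show "hpoly r 0 (\<lambda>x. 1)" "hpoly r 0 (\<lambda>x. 1)" by (rule hpoly_const)+
  show "lift_coords r l (proj_coords r p l x) i + p i * proj_coords r p l x r = 1 * x i" if "i \<le> r" for x i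
    using lift_proj_coords[where r = r and l = l and p = p and i = i and x = x, OF r l p(1) that] r by (simp add: proj_from_def proj_coords_def)
  show "proj_coords r p l (\<lambda>i. lift_coords r l z i + p i * z r) i = 1 * z i" if i: "i \<le> r" for z i
  proof -
    let ?x = "\<lambda>i. lift_coords r l z i + p i * z r"
    have xr: "?x r = z r" using r p(1) by (simp add: lift_coords_def)
    then have \<pi>: "proj_from r p ?x j = lift_coords r l z j" for j
      by (simp add: proj_from_def)
    have "(\<Sum>j<r. l j * lift_coords r l z j) = l 0 * lift_coords r l z 0 + (\<Sum>j\<in>{1..<r}. l j * lift_coords r l z j)"
      using r by (simp add: lessThan_atLeast0 sum.atLeast_Suc_lessThan)
    also have "(\<Sum>j\<in>{1..<r}. l j * lift_coords r l z j) = (\<Sum>j\<in>{1..<r}. l j * z j)"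
      by (rule sum.cong) (auto simp: lift_coords_def)
    also have "l 0 * lift_coords r l z 0 + \<dots> = z 0" using l by (simp add: lift_coords_def field_simps)
    finally show ?thesis using i r xr
      unfolding proj_coords_def \<pi> by (auto simp: lift_coords_def)
  qed
qed auto

text \<open>In the chart x_0 = 1 this is the substitution x_r \<mapsto> \<alpha> x_r + \<beta> with
  \<alpha> = a / c and \<beta> = b / (x_0 c), written with the common denominator c. The inverse
  solves for x_r.\<close>

lemma cremona_affine_last:
  fixes a b c :: "(nat \<Rightarrow> complex) \<Rightarrow> complex"
  assumes a: "hpoly r k a" "a u \<noteq> 0" and c: "hpoly r k c" "c v \<noteq> 0" and b: "hpoly r (Suc k) b"
    and indep: "\<And>x y. (\<And>i. i < r \<Longrightarrow> x i = y i) \<Longrightarrow> a x = a y \<and> b x = b y \<and> c x = c y"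
  shows "cremona r (\<lambda>x i. if i < r then c x * x i else if i = r then a x * x r + b x else 0)
           (\<lambda>y i. if i < r then a y * y i else if i = r then c y * y r - b y else 0)"
    (is "cremona r ?F ?A")
proof -
  have nz: "\<exists>z. f z ^ Suc k * g z \<noteq> 0" if "hpoly r k f" "hpoly r k g" "f u \<noteq> 0" "g v \<noteq> 0" for f g u v
    using polyfun_no_zero_divisors[OF hpoly_imp_polyfun hpoly_imp_polyfun, OF that] by auto
  obtain s where s: "c s ^ Suc k * a s \<noteq> 0" using nz[OF c(1) a(1) c(2) a(2)] by blast
  obtain t where t: "a t ^ Suc k * c t \<noteq> 0" using nz[OF a(1) c(1) a(2) c(2)] by blast
  \<comment> \<open>a, b and c see only the first r coordinates, on which \<open>?F\<close> is
    scaling by c x.\<close>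
  have F: "a (?F x) = c x ^ k * a x" "b (?F x) = c x ^ Suc k * b x" "c (?F x) = c x ^ k * c x" for x
    using indep[of "?F x" "\<lambda>i. c x * x i"] hpoly_scale[OF a(1), of "c x" x]
      hpoly_scale[OF b(1), of "c x" x] hpoly_scale[OF c(1), of "c x" x] by auto
  have A: "a (?A x) = a x ^ k * a x" "b (?A x) = a x ^ Suc k * b x" "c (?A x) = a x ^ k * c x" for x
    using indep[of "?A x" "\<lambda>i. a x * x i"] hpoly_scale[OF a(1), of "a x" x]
      hpoly_scale[OF b(1), of "a x" x] hpoly_scale[OF c(1), of "a x" x] by auto
  show ?thesis
  proof (rule cremonaI)
    have "hpoly r (Suc k) (\<lambda>x. f x * x i)" if "hpoly r k f" "i \<le> r" for f i
      using that by (intro hpoly_mult'[OF _ hpoly_var]) auto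
    with a c b show "forms r r (Suc k) ?F" "forms r r (Suc k) ?A"
      unfolding forms_def by (auto simp: le_less intro!: hpoly_add hpoly_diff)
    show "hpoly r (Suc k * k + k) (\<lambda>x. c x ^ Suc k * a x)" "hpoly r (Suc k * k + k) (\<lambda>x. a x ^ Suc k * c x)"
      by (intro hpoly_mult hpoly_power a c)+
    show "c s ^ Suc k * a s \<noteq> 0" "a t ^ Suc k * c t \<noteq> 0" by (rule s, rule t)
    show "?A (?F x) i = c x ^ Suc k * a x * x i" if "i \<le> r" for x i
      unfolding F using that by (simp add: algebra_simps)
    show "?F (?A x) i = a x ^ Suc k * c x * x i" if "i \<le> r" for x i
      unfolding A using that by (simp add: algebra_simps)
  qed
qed

text \<open>In the chart x_0 = 1 the last coordinate is kept and the others are scaled by P, a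
  function of the last one, so the map is undone by dividing by P. The powers of x_0
  homogenise.\<close>

lemma cremona_contract_hyperplanes:
  fixes c :: "'i \<Rightarrow> complex"
  assumes r: "r > 0" and J: "finite J"
  defines "s \<equiv> card J"
  defines "P \<equiv> \<lambda>x :: nat \<Rightarrow> complex. \<Prod>j\<in>J. (x r - c j * x 0)"
  shows "cremona r
     (\<lambda>x i. if i = 0 then x 0 * x 0 ^ s else if i < r then x i * P x else if i = r then x r * x 0 ^ s else 0)
     (\<lambda>y i. if i = 0 then y 0 * P y else if i < r then y i * y 0 ^ s else if i = r then y r * P y else 0)"
    (is "cremona r ?F ?A")
proof -
  have P_eq: "P x = (\<Prod>j\<in>J. (x r - c j * x 0))" for x by (simp add: P_def)
  have P: "hpoly r s P"
  proof -
    have "hpoly r (\<Sum>j\<in>J. Suc 0) P"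
      unfolding P_def by (intro hpoly_prod hpoly_diff hpoly_cmult hpoly_var) auto
    then show ?thesis by (simp add: s_def)
  qed
  have X: "hpoly r s (\<lambda>x. x 0 ^ s)" using hpoly_power[OF hpoly_var, of 0 r s] by simp
  \<comment> \<open>The last coordinate exceeds the norm of every c j, so no factor of P vanishes at
    u.\<close>
  define u where "u i = (if i = 0 then 1 else if i = r then 1 + (\<Sum>j\<in>J. norm (c j)) else 0 :: complex)" for i
  have "u r - c j * u 0 \<noteq> 0" if "j \<in> J" for j
  proof
    assume "u r - c j * u 0 = 0"
    then have "c j = of_real (1 + (\<Sum>j\<in>J. norm (c j)))" using r by (simp add: u_def)
    then have "norm (c j) = norm (of_real (1 + (\<Sum>j\<in>J. norm (c j))) :: complex)" by simp
    also have "\<dots> = 1 + (\<Sum>j\<in>J. norm (c j))" unfolding norm_of_real by (simp add: sum_nonneg add_nonneg_nonneg)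
    finally show False using member_le_sum[of j J "\<lambda>j. norm (c j)"] that J by simp
  qed
  then have u: "P u \<noteq> 0" "u 0 \<noteq> 0" using J by (auto simp: P_def u_def)
  have PF: "P (?F x) = (x 0 ^ s) ^ s * P x" for x
  proof -
    have "P (?F x) = (\<Prod>j\<in>J. x 0 ^ s * (x r - c j * x 0))"
      using r by (simp add: P_def algebra_simps)
    then show ?thesis by (simp add: P_def prod.distrib s_def)
  qed
  have PA: "P (?A y) = P y ^ s * P y" for y
  proof -
    have "P (?A y) = (\<Prod>j\<in>J. P y * (y r - c j * y 0))"
      using r by (simp add: P_eq[of "?A y"] algebra_simps)
    then show ?thesis by (simp add: P_eq[of y] prod.distrib s_def)
  qed
  show ?thesis
  proof (rule cremonaI)
    have E: "hpoly r (Suc s) (\<lambda>x. x i * f x)" if "hpoly r s f" "i \<le> r" for f i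
      using that by (intro hpoly_mult'[OF hpoly_var]) auto
    have "forms r r (Suc s) (\<lambda>x i. if i = 0 then x 0 * f x else if i < r then x i * g x
        else if i = r then x r * f x else 0)" if "hpoly r s f" "hpoly r s g" for f g
      unfolding forms_def
    proof (intro conjI allI impI)
      fix i assume "i \<le> r"
      then consider "i = 0" | "i \<noteq> 0" "i < r" | "i \<noteq> 0" "i = r" by linarith
      then show "hpoly r (Suc s) (\<lambda>x. if i = 0 then x 0 * f x else if i < r then x i * g x
        else if i = r then x r * f x else 0)"
        using E[OF that(1), of 0] E[OF that(1), of r] E[OF that(2), of i] by cases simp_all
    qed auto
    from this[OF X P] this[OF P X] show "forms r r (Suc s) ?F" "forms r r (Suc s) ?A" .
    show "hpoly r (s + s * s + s) (\<lambda>x. x 0 ^ s * (x 0 ^ s) ^ s * P x)"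
      by (intro hpoly_mult X P hpoly_power)
    show "hpoly r (s + (s * s + s)) (\<lambda>x. x 0 ^ s * (P x ^ s * P x))"
      by (intro hpoly_mult X P hpoly_power)
    show "u 0 ^ s * (u 0 ^ s) ^ s * P u \<noteq> 0" "u 0 ^ s * (P u ^ s * P u) \<noteq> 0" using u by auto
    show "?A (?F x) i = x 0 ^ s * (x 0 ^ s) ^ s * P x * x i" if "i \<le> r" for x i
      unfolding PF using that r by (simp add: power_mult_distrib algebra_simps)
    show "?F (?A y) i = y 0 ^ s * (P y ^ s * P y) * y i" if "i \<le> r" for y i
      unfolding PA using that r by (simp add: power_mult_distrib algebra_simps)
  qed
qed

section \<open>Nonvanishing of products on an irreducible set, and the contraction\<close>

lemma irreducible_nonzero_mult:
  assumes T: "irreducible_in (zariski n) T" and f: "hpoly n d f" and g: "hpoly n e g"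
    and "\<exists>p\<in>T. \<exists>x\<in>p. f x \<noteq> 0" "\<exists>p\<in>T. \<exists>x\<in>p. g x \<noteq> 0"
  shows "\<exists>p\<in>T. \<exists>x\<in>p. f x * g x \<noteq> 0"
proof (rule ccontr)
  assume *: "\<not> ?thesis"
  have "(\<forall>p\<in>T. \<forall>x\<in>p. f x = 0) \<or> (\<forall>p\<in>T. \<forall>x\<in>p. g x = 0)"
    by (rule irreducible_zero_product[OF T f g]) (use * in blast)
  then show False using assms(4,5) by blast
qed

lemma irreducible_nonzero_prod:
  assumes T: "irreducible_in (zariski n) T" and J: "finite J"
    and f: "\<And>j. j \<in> J \<Longrightarrow> hpoly n (d j) (f j) \<and> (\<exists>p\<in>T. \<exists>x\<in>p. f j x \<noteq> 0)"
  shows "\<exists>p\<in>T. \<exists>x\<in>p. (\<Prod>j\<in>J. f j x) \<noteq> 0"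
  using J f
proof (induction J rule: finite_induct)
  case empty
  have "T \<subseteq> proj_space n" "topspace (subtopology (zariski n) T) \<noteq> {}"
    using T by (simp_all add: irreducible_in_def irreducible_space_def)
  then obtain p where p: "p \<in> T" "p \<in> proj_space n" by auto
  then obtain x where "x \<in> p" using proj_space_nonempty by blast
  then show ?case using p(1) by (intro bexI[of _ p] bexI[of _ x]) simp_all
next
  case (insert j J)
  have h: "hpoly n (d j) (f j)" "hpoly n (\<Sum>j\<in>J. d j) (\<lambda>x. \<Prod>j\<in>J. f j x)"
    using insert.prems by (auto intro: hpoly_prod)
  have nz: "\<exists>p\<in>T. \<exists>x\<in>p. (\<Prod>j\<in>J. f j x) \<noteq> 0" "\<exists>p\<in>T. \<exists>x\<in>p. f j x \<noteq> 0"
    by (rule insert.IH, rule insert.prems, simp) (use insert.prems[of j] in simp)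
  have "\<exists>p\<in>T. \<exists>x\<in>p. f j x * (\<Prod>j\<in>J. f j x) \<noteq> 0"
    by (rule irreducible_nonzero_mult[OF T h nz(2,1)])
  then show ?case using insert.hyps by simp
qed

text \<open>In coordinates \<open>z\<close> for which \<open>z\<^sub>0, \<dots>, z\<^sub>r\<^sub>-\<^sub>1\<close> are functions of the projection from \<open>p\<close>, an
  affine substitution in \<open>z\<^sub>r\<close> moves \<open>T\<^sub>i\<close> into the hyperplane \<open>z\<^sub>r = c\<^sub>i z\<^sub>0\<close>, and these hyperplanes
  are contracted afterwards.\<close>

lemma contracting_cremona:
  fixes T :: "'i \<Rightarrow> point set" and c :: "'i \<Rightarrow> complex"
  assumes r: "r > 0" and I: "finite I" "I \<noteq> {}"
    and irr: "\<And>i. i \<in> I \<Longrightarrow> irreducible_in (zariski r) (T i)"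
    and p: "p r = 1" "\<And>i. i > r \<Longrightarrow> p i = 0"
    and h: "\<And>i j. i \<in> I \<Longrightarrow> j \<in> I \<Longrightarrow> hpoly r (k i j) (h i j)"
    and h_zero: "\<And>i j q x. i \<in> I \<Longrightarrow> j \<in> I \<Longrightarrow> q \<in> T j \<Longrightarrow> x \<in> q \<Longrightarrow> h i j (proj_from r p x) = 0"
    and h_nz: "\<And>i j. i \<in> I \<Longrightarrow> j \<in> I \<Longrightarrow> i \<noteq> j \<Longrightarrow> \<exists>q\<in>T i. \<exists>x\<in>q. h i j (proj_from r p x) \<noteq> 0"
    and h_nz': "\<And>i. i \<in> I \<Longrightarrow> \<exists>x. h i i (proj_from r p x) \<noteq> 0"
    and l: "l 0 \<noteq> 0" "\<And>i. i \<in> I \<Longrightarrow> \<exists>q\<in>T i. \<exists>x\<in>q. (\<Sum>j<r. l j * proj_from r p x j) \<noteq> 0"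
    and c: "inj_on c I"
  shows "\<exists>\<omega>\<in>birational_maps r (proj_space r) r (proj_space r). contracts_to_distinct_points r \<omega> I T"
proof -
  define L where "L = proj_coords r p l"
  define V where "V = lift_coords r l"
  \<comment> \<open>N bounds the degrees of all products below, so that powers of z 0 can pad them
    to the same degree.\<close>
  define N where "N = (\<Sum>i\<in>I. \<Sum>j\<in>I. k i j)"
  \<comment> \<open>The \<open>e i\<close> act as a Lagrange basis: composed with L, e i vanishes on
    T j for every j other than i, and it does not vanish identically on T i.\<close>
  define e where "e i z = z 0 ^ (N - (\<Sum>j\<in>I - {i}. k i j)) * (\<Prod>j\<in>I - {i}. h i j (V z))" for i z
  \<comment> \<open>The numerator of \<alpha>: the factor \<open>h j j\<close> makes it vanish on T
    j.\<close>
  define a where "a z = z 0 ^ (N - (\<Sum>j\<in>I. k j j)) * (\<Prod>j\<in>I. h j j (V z))" for z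
  \<comment> \<open>The common denominator. On T i both C and the sum in b reduce to their i-th
    terms, so \<beta> = b / (z 0 * C) takes the value c i there.\<close>
  define C where "C z = (\<Sum>i\<in>I. e i z)" for z
  define b where "b z = z 0 * (\<Sum>i\<in>I. c i * e i z)" for z
  have hV: "hpoly r (k i j) (\<lambda>z. h i j (V z))" if "i \<in> I" "j \<in> I" for i j
    using hpoly_comp[OF h[OF that], of r "Suc 0" V] hpoly_lift_coords[OF r] by (simp add: V_def)
  have pow: "hpoly r m (\<lambda>z. z 0 ^ m)" for m using hpoly_power[OF hpoly_var, of 0 r m] by simp
  have e: "hpoly r N (e i)" if i: "i \<in> I" for i
  proof -
    have "(\<Sum>j\<in>I - {i}. k i j) \<le> (\<Sum>j\<in>I. k i j)" using I by (intro sum_mono2) auto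
    also have "\<dots> \<le> N" unfolding N_def using I i by (intro member_le_sum) auto
    finally show ?thesis
      unfolding e_def[abs_def] using i by (intro hpoly_mult'[OF pow hpoly_prod[OF hV]]) auto
  qed
  have a: "hpoly r N a"
  proof -
    have "(\<Sum>j\<in>I. k j j) \<le> N"
      unfolding N_def using I by (intro sum_mono member_le_sum) auto
    then show ?thesis
      unfolding a_def[abs_def] by (intro hpoly_mult'[OF pow hpoly_prod[OF hV]]) auto
  qed
  have C: "hpoly r N C" unfolding C_def[abs_def] by (intro hpoly_sum e)
  have b: "hpoly r (Suc N) b"
    unfolding b_def[abs_def]
    by (intro hpoly_mult'[OF hpoly_var hpoly_sum[OF hpoly_cmult[OF e]]]) auto
  have VL: "h i j (V (L x)) = h i j (proj_from r p x)" if "i \<in> I" "j \<in> I" for i j x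
    by (rule hpoly_cong[OF h[OF that]]) (simp add: V_def L_def lift_proj_coords r l p)
  have L0: "L x 0 = (\<Sum>j<r. l j * proj_from r p x j)" for x by (simp add: L_def proj_coords_def)
  have formsL: "forms r r (Suc 0) L" unfolding L_def by (rule forms_proj_coords[OF r])
  have hL: "hpoly r d (\<lambda>x. f (L x))" if "hpoly r d f" for d f
    using hpoly_comp[OF that forms_hpoly[OF formsL]] by simp
  have zero: "a (L x) = 0" "C (L x) = e i (L x)" "b (L x) = L x 0 * (c i * e i (L x))"
    if i: "i \<in> I" and x: "q \<in> T i" "x \<in> q" for i q x
  proof -
    have z: "h j i (V (L x)) = 0" if "j \<in> I" for j
      using VL[OF that i] h_zero[OF that i x] by simp
    then show "a (L x) = 0" using I(1) i by (auto simp: a_def)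
    have "(\<Prod>j'\<in>I - {j}. h j j' (V (L x))) = 0" if "j \<in> I" "j \<noteq> i" for j
      using z[OF that(1)] i that(2) I(1) by (intro prod_zero) auto
    then have ej: "e j (L x) = 0" if "j \<in> I - {i}" for j using that by (simp add: e_def)
    show "C (L x) = e i (L x)" unfolding C_def using ej i I(1) by (simp add: sum.remove[of I i])
    show "b (L x) = L x 0 * (c i * e i (L x))"
      unfolding b_def using ej i I(1) by (simp add: sum.remove[of I i])
  qed
  define s where "s = card I"
  \<comment> \<open>On T i the first two maps give a vector y with y_0 = e i (L x) * L x 0, y_r = c
    i * y_0 and P y = 0. The last map sends it to y_0 ^ (s + 1) times (1, 0, ..., 0, c i); the
    scalar is \<open>\<phi> i\<close>.\<close>
  define \<phi> where "\<phi> i x = (e i (L x) * L x 0) ^ Suc s" for i x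
  have \<phi>: "hpoly r (Suc s * (N + Suc 0)) (\<phi> i)" if "i \<in> I" for i
    unfolding \<phi>_def[abs_def] by (intro hpoly_power hpoly_mult hL e that hpoly_var) simp
  have \<phi>_nz: "\<exists>q\<in>T i. \<exists>x\<in>q. \<phi> i x \<noteq> 0" if i: "i \<in> I" for i
  proof -
    let ?g = "\<lambda>x. \<Prod>j\<in>I - {i}. h i j (V (L x))"
    have g: "hpoly r (\<Sum>j\<in>I - {i}. k i j) ?g" using i by (intro hpoly_prod hL hV) auto
    have L: "hpoly r (Suc 0) (\<lambda>x. L x 0)" by (intro hL hpoly_var) simp
    have "\<exists>q\<in>T i. \<exists>x\<in>q. ?g x \<noteq> 0"
    proof (rule irreducible_nonzero_prod[OF irr[OF i]])
      fix j assume j: "j \<in> I - {i}"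
      then show "hpoly r (k i j) (\<lambda>x. h i j (V (L x))) \<and> (\<exists>q\<in>T i. \<exists>x\<in>q. h i j (V (L x)) \<noteq> 0)"
        using hL[OF hV[OF i, of j]] h_nz[OF i, of j] VL[OF i, of j] by auto
    qed (use I in auto)
    moreover have "\<exists>q\<in>T i. \<exists>x\<in>q. L x 0 \<noteq> 0" using l(2)[OF i] L0 by simp
    ultimately have "\<exists>q\<in>T i. \<exists>x\<in>q. L x 0 * ?g x \<noteq> 0"
      by (intro irreducible_nonzero_mult[OF irr[OF i] L g])
    then show ?thesis by (auto simp: \<phi>_def e_def)
  qed
  have C_nz: "\<exists>z. C z \<noteq> 0"
  proof -
    obtain i where i: "i \<in> I" using I by blast
    then obtain q x where x: "q \<in> T i" "x \<in> q" "\<phi> i x \<noteq> 0" using \<phi>_nz by blast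
    then have "C (L x) \<noteq> 0" using zero(2)[OF i x(1,2)] by (simp add: \<phi>_def)
    then show ?thesis by blast
  qed
  have a_nz: "\<exists>z. a z \<noteq> 0"
  proof -
    have "\<exists>z. \<forall>j\<in>I. h j j (V z) \<noteq> 0"
    proof (rule polyfun_finite_nonzero[OF I(1)])
      fix j assume j: "j \<in> I"
      obtain x where "h j j (proj_from r p x) \<noteq> 0" using h_nz'[OF j] by blast
      then have "h j j (V (L x)) \<noteq> 0" using VL[OF j j] by simp
      then show "polyfun r (\<lambda>z. h j j (V z)) \<and> (\<exists>z. h j j (V z) \<noteq> 0)"
        using hpoly_imp_polyfun[OF hV[OF j j]] by blast
    qed
    then obtain z where "(\<Prod>j\<in>I. h j j (V z)) \<noteq> 0" using I(1) by auto
    moreover have "polyfun r (\<lambda>z. \<Prod>j\<in>I. h j j (V z))"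
      by (intro polyfun_prod hpoly_imp_polyfun[OF hV])
    moreover have "polyfun r (\<lambda>z. z 0)" by (rule polyfun_var) simp
    ultimately obtain z where "(\<Prod>j\<in>I. h j j (V z)) \<noteq> 0 \<and> z 0 \<noteq> 0"
      using polyfun_no_zero_divisors[of r "\<lambda>z. \<Prod>j\<in>I. h j j (V z)" "\<lambda>z. z 0" z "\<lambda>_. 1"] by auto
    then show ?thesis by (intro exI[of _ z]) (simp add: a_def)
  qed
  have indep: "a x = a y \<and> b x = b y \<and> C x = C y" if xy: "\<And>i. i < r \<Longrightarrow> x i = y i" for x y
  proof -
    have "(\<Sum>j\<in>{1..<r}. l j * x j) = (\<Sum>j\<in>{1..<r}. l j * y j)" using xy by (intro sum.cong) auto
    then have "V x = V y" using xy r by (auto simp: V_def lift_coords_def)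
    moreover have "x 0 = y 0" using xy r by simp
    ultimately show ?thesis by (simp add: a_def b_def C_def e_def)
  qed
  define M where "M x i = (if i < r then C x * x i else if i = r then a x * x r + b x else 0)" for x i
  define P where "P x = (\<Prod>j\<in>I. (x r - c j * x 0))" for x :: "nat \<Rightarrow> complex"
  define Q where "Q x i = (if i = 0 then x 0 * x 0 ^ s else if i < r then x i * P x
      else if i = r then x r * x 0 ^ s else 0)" for x i
  obtain A where A: "cremona r L A" using cremona_proj_coords[of r l p] r l p unfolding L_def by blast
  obtain B where B: "cremona r M B"
    using cremona_affine_last[OF a _ C _ b indep] a_nz C_nz unfolding M_def[abs_def] by blast
  obtain D where D: "cremona r Q D"
    using cremona_contract_hyperplanes[OF r I(1), of c] unfolding Q_def[abs_def] P_def s_def by blast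
  let ?F = "\<lambda>x. Q (M (L x))"
  have "cremona r ?F (\<lambda>x. A (B (D x)))"
    using cremona_comp[OF cremona_comp[OF A B] D] by simp
  then obtain \<omega> where \<omega>: "\<omega> \<in> birational_maps r (proj_space r) r (proj_space r)"
      "generic_forms r r \<omega> ?F" "\<forall>x\<in>hom_coords r. \<forall>i. ?F x i \<noteq> 0 \<longrightarrow> pt r x \<in> rat_dom \<omega>"
    using cremona_birational by blast
  have \<omega>': "\<omega> \<in> rational_maps r (proj_space r) r (proj_space r)"
    using \<omega>(1) by (simp add: birational_maps_def)
  define v where "v i j = (if j = 0 then 1 else if j = r then c i else 0)" for i j
  have v: "v i \<in> hom_coords r" for i
    using r by (auto simp: hom_coords_def v_def intro!: exI[of _ 0])
  have Fv: "?F x j = \<phi> i x * v i j" if i: "i \<in> I" and x: "q \<in> T i" "x \<in> q" for i q x j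
  proof -
    let ?y = "M (L x)"
    have y: "?y 0 = e i (L x) * L x 0" "?y r = c i * (e i (L x) * L x 0)"
      using r zero[OF i x] by (simp_all add: M_def)
    then have "P ?y = 0" using i I(1) unfolding P_def by (intro prod_zero) auto
    then show ?thesis using y r by (simp add: Q_def \<phi>_def v_def)
  qed
  have "contracts_to_point r \<omega> (T i) (pt r (v i))" if i: "i \<in> I" for i
  proof -
    obtain q x where "q \<in> T i" "x \<in> q" "\<phi> i x \<noteq> 0" using \<phi>_nz[OF i] by blast
    then show ?thesis
      by (intro contracts_to_pointI[OF \<omega>' \<omega>(2) _ irr[OF i] v \<phi>[OF i] Fv[OF i]] \<omega>(3)[rule_format])
  qed
  moreover have "inj_on (\<lambda>i. pt r (v i)) I"
  proof (rule inj_onI)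
    fix i j assume ij: "i \<in> I" "j \<in> I" "pt r (v i) = pt r (v j)"
    then have "v j \<in> pt r (v i)" using pt_self[OF v] by simp
    then obtain d where d: "v j = (\<lambda>n. d * v i n)" unfolding mem_pt_iff[OF v] by blast
    have "d = 1" using fun_cong[OF d, of 0] by (simp add: v_def)
    then have "c i = c j" using fun_cong[OF d, of r] r by (simp add: v_def)
    then show "i = j" using c ij by (simp add: inj_on_def)
  qed
  ultimately have "contracts_to_distinct_points r \<omega> I T"
    unfolding contracts_to_distinct_points_def by (intro exI[of _ "\<lambda>i. pt r (v i)"]) simp
  then show ?thesis using \<omega>(1) by blast
qed

section \<open>General position\<close>

lemma rational_variety_cone_form:
  assumes T: "rational_variety r T" and dim: "variety_dim r T + 2 \<le> enat r" and a: "a \<in> hom_coords r"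
  shows "\<exists>k g p. hpoly r k g \<and> (\<forall>q\<in>T. \<forall>x\<in>q. g x = 0) \<and>
           (\<forall>x t. g (\<lambda>i. x i + t * a i) = g x) \<and> g p \<noteq> 0"
proof -
  obtain d where d: "variety_dim r T = enat d" "birational_maps r T d (proj_space d) \<noteq> {}"
    using T unfolding rational_variety_def by blast
  then obtain \<eta> where \<eta>: "\<eta> \<in> rational_maps d (proj_space d) r T" "dominant r T \<eta>"
    unfolding birational_maps_def by blast
  have "enat (d + 2) \<le> enat r" using dim d(1) by (simp add: numeral_eq_enat)
  then show ?thesis using cone_form[OF \<eta> _ a] by simp
qed

text \<open>The vectors representing points of T are stable under scaling and
  \<open>proj_from\<close> is linear, so a separating polynomial can be replaced by one of its
  components.\<close>

lemma proj_from_component: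
  assumes T: "T \<subseteq> proj_space r" and h: "polyfun r h" "h (proj_from r p a) \<noteq> 0"
    "\<And>q x. q \<in> T \<Longrightarrow> x \<in> q \<Longrightarrow> h (proj_from r p x) = 0"
  shows "\<exists>d g. hpoly r d g \<and> (\<forall>q\<in>T. \<forall>x\<in>q. g (proj_from r p x) = 0) \<and> g (proj_from r p a) \<noteq> 0"
proof -
  have "\<exists>d g. hpoly r d g \<and> (\<forall>y\<in>proj_from r p ` \<Union>T. g y = 0) \<and> g (proj_from r p a) \<noteq> 0"
  proof (rule polyfun_component[OF h(1) _ h(2)])
    fix y and c :: complex assume "y \<in> proj_from r p ` \<Union>T" "c \<noteq> 0"
    then obtain q x where q: "q \<in> T" "x \<in> q" "y = proj_from r p x" by blast
    have "(\<lambda>i. c * x i) \<in> q" using point_scale[of q r x c] q T \<open>c \<noteq> 0\<close> by blast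
    moreover have "(\<lambda>i. c * y i) = proj_from r p (\<lambda>i. c * x i)"
      by (simp add: q(3) proj_from_def fun_eq_iff algebra_simps)
    ultimately show "h (\<lambda>i. c * y i) = 0" using h(3)[OF q(1)] by simp
  qed
  then show ?thesis by blast
qed

text \<open>Serves to pick p off all cones. The last coordinate is scaled to 1, so that
  \<open>proj_from r p\<close> sends p to zero.\<close>

lemma common_nonzero_point:
  assumes I: "finite I" and g: "\<And>i. i \<in> I \<Longrightarrow> hpoly r (k i) (g i) \<and> (\<exists>x. g i x \<noteq> 0)"
  shows "\<exists>p. p r = 1 \<and> (\<forall>i>r. p i = 0) \<and> (\<forall>i\<in>I. g i p \<noteq> 0)"
proof -
  obtain x where x: "\<forall>i\<in>I. g i x \<noteq> 0"
    using polyfun_finite_nonzero[OF I, of r g] g hpoly_imp_polyfun by blast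
  have "polyfun r (\<lambda>x. \<Prod>i\<in>I. g i x)" using g hpoly_imp_polyfun by (intro polyfun_prod) blast
  moreover have "polyfun r (\<lambda>x. x r)" by (rule polyfun_var) simp
  moreover have "(\<Prod>i\<in>I. g i x) \<noteq> 0" using x I by simp
  ultimately obtain z where z: "(\<Prod>i\<in>I. g i z) \<noteq> 0 \<and> z r \<noteq> 0"
    using polyfun_no_zero_divisors[of r "\<lambda>x. \<Prod>i\<in>I. g i x" "\<lambda>x. x r" x "\<lambda>_. 1"] by auto
  define p where "p i = (if i \<le> r then inverse (z r) * z i else 0)" for i
  have "g i p \<noteq> 0" if i: "i \<in> I" for i
  proof -
    have gi: "hpoly r (k i) (g i)" using g[OF i] by blast
    have "g i p = g i (\<lambda>j. inverse (z r) * z j)" by (rule hpoly_cong[OF gi]) (simp add: p_def)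
    also have "\<dots> = inverse (z r) ^ k i * g i z" by (rule hpoly_scale[OF gi])
    finally show ?thesis using z i I by simp
  qed
  then show ?thesis using z by (intro exI[of _ p]) (simp add: p_def)
qed

text \<open>The sums are read as polynomials in l, finitely many and nonzero; l 0 is one more such
  polynomial.\<close>

lemma common_nonvanishing_functional:
  fixes v :: "'i \<Rightarrow> nat \<Rightarrow> complex"
  assumes I: "finite I" and r: "r > 0" and v: "\<And>i. i \<in> I \<Longrightarrow> \<exists>j<r. v i j \<noteq> 0"
  shows "\<exists>l. l 0 \<noteq> 0 \<and> (\<forall>i\<in>I. (\<Sum>j<r. l j * v i j) \<noteq> 0)"
proof -
  have pf: "polyfun r (\<lambda>l. \<Sum>j<r. l j * v i j)" for i
    by (intro polyfun_sum polyfun_mult polyfun_var polyfun_const) auto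
  obtain l where "\<forall>i\<in>I. (\<Sum>j<r. l j * v i j) \<noteq> 0"
  proof -
    have "\<exists>l. (\<Sum>j<r. l j * v i j) \<noteq> 0" if i: "i \<in> I" for i
    proof -
      obtain n where n: "n < r" "v i n \<noteq> 0" using v[OF i] by blast
      have "(\<Sum>j<r. (if j = n then 1 else 0) * v i j) = (\<Sum>j<r. if j = n then v i j else 0)"
        by (rule sum.cong) auto
      then show ?thesis using n by (intro exI[of _ "\<lambda>j. if j = n then 1 else 0"]) simp
    qed
    then show ?thesis using polyfun_finite_nonzero[OF I, of r "\<lambda>i l. \<Sum>j<r. l j * v i j"] pf that by blast
  qed
  then have "(\<Prod>i\<in>I. \<Sum>j<r. l j * v i j) \<noteq> 0" using I by simp
  moreover have "polyfun r (\<lambda>l. \<Prod>i\<in>I. \<Sum>j<r. l j * v i j)" by (intro polyfun_prod pf)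
  moreover have "polyfun r (\<lambda>l. l 0)" by (rule polyfun_var) simp
  ultimately obtain l where "(\<Prod>i\<in>I. \<Sum>j<r. l j * v i j) \<noteq> 0 \<and> l 0 \<noteq> 0"
    using polyfun_no_zero_divisors[of r "\<lambda>l. \<Prod>i\<in>I. \<Sum>j<r. l j * v i j" "\<lambda>l. l 0" l "\<lambda>_. 1"] by auto
  then show ?thesis using I by auto
qed

lemma irreducible_components_incomparable:
  assumes "A \<in> irreducible_components X" "B \<in> irreducible_components X" "A \<subseteq> B"
  shows "A = B"
  using assms unfolding irreducible_components_def by blast

theorem corollary4p8:
  fixes r s :: nat and Z :: "point set" and T :: "nat \<Rightarrow> point set"
  assumes "closedin (zariski r) Z"
    and "Z = (\<Union>i\<in>{1..s}. T i)"
    and "bij_betw T {1..s} (irreducible_components (subtopology (zariski r) Z))"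
    and "\<And>i. i \<in> {1..s} \<Longrightarrow> rational_variety r (T i)"
    and "\<And>i. i \<in> {1..s} \<Longrightarrow> variety_dim r (T i) + 2 \<le> enat r"
  shows "\<exists>\<omega>\<in>birational_maps r (proj_space r) r (proj_space r).
           contracts_to_distinct_points r \<omega> {1..s} T"
proof (cases "s = 0")
  case True
  \<comment> \<open>Without components there is nothing to contract, and the identity
    serves.\<close>
  obtain \<omega> where "\<omega> \<in> birational_maps r (proj_space r) r (proj_space r)"
    using cremona_birational[OF cremona_id] by blast
  then show ?thesis
    using True by (intro bexI[of _ \<omega>]) (simp_all add: contracts_to_distinct_points_def)
next
  case False
  let ?I = "{1..s}"
  have irr: "irreducible_in (zariski r) (T i)" and cl: "closedin (zariski r) (T i)" if "i \<in> ?I" for i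
    using assms(4)[OF that] unfolding rational_variety_def proj_variety_def by blast+
  have TP: "T i \<subseteq> proj_space r" if "i \<in> ?I" for i
    using irr[OF that] by (simp add: irreducible_in_def)
  have cone: "\<exists>k g p. hpoly r k g \<and> (\<forall>q\<in>T j. \<forall>x\<in>q. g x = 0) \<and>
           (\<forall>x t. g (\<lambda>i. x i + t * a i) = g x) \<and> g p \<noteq> 0" if "j \<in> ?I" "a \<in> hom_coords r" for j a
    using rational_variety_cone_form[OF assms(4,5)[OF that(1)] that(2)] .
  have r: "r > 0"
  proof -
    have "variety_dim r (T s) + 2 \<le> enat r" using assms(5) False by simp
    then show ?thesis by (cases "r = 0") (simp_all add: zero_enat_def[symmetric])
  qed
  \<comment> \<open>These are the vertices of the cones over T j. For i \<noteq> j the vertex lies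
    on T i, so separating its projection from that of T j yields a form nonzero on T i; for i = j
    any point off T j shows that the projection of T j is not dense.\<close>
  have "\<exists>a\<in>hom_coords r. (i \<noteq> j \<longrightarrow> pt r a \<in> T i) \<and> pt r a \<notin> T j" if ij: "i \<in> ?I" "j \<in> ?I" for i j
  proof (cases "i = j")
    case False
    have "T n \<in> irreducible_components (subtopology (zariski r) Z)" if "n \<in> ?I" for n
      using bij_betwE[OF assms(3)] that by blast
    moreover have "T i \<noteq> T j" using inj_on_contraD[OF bij_betw_imp_inj_on[OF assms(3)] False ij] .
    ultimately have "\<not> T i \<subseteq> T j"
      using irreducible_components_incomparable ij by metis
    then obtain q where q: "q \<in> T i" "q \<notin> T j" by blast
    have qP: "q \<in> proj_space r" using q(1) TP[OF ij(1)] by blast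
    obtain x where x: "x \<in> q" using proj_space_nonempty[OF qP] by blast
    show ?thesis
      using point_eq_pt[OF qP x] q by (intro bexI[OF _ point_coords[OF qP x]]) simp
  next
    case True
    \<comment> \<open>A cone form with vertex (1, ..., 1) shows that T j is not the whole
      space.\<close>
    obtain k g p where g: "hpoly r k g" "\<forall>q\<in>T j. \<forall>x\<in>q. g x = 0" "g p \<noteq> 0"
      using cone[OF ij(2) truncate_hom_coords[of "\<lambda>_. 1" 0 r, OF one_neq_zero le0]] by blast
    obtain x where x: "x \<in> hom_coords r" "g x \<noteq> 0"
      using polyfun_nonzero_hom_coords[OF hpoly_imp_polyfun[OF g(1)] g(3)] by blast
    then have "pt r x \<notin> T j" using g(2) pt_self[OF x(1)] by blast
    then show ?thesis using x(1) True by blast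
  qed
  then obtain a where a: "\<And>i j. i \<in> ?I \<Longrightarrow> j \<in> ?I \<Longrightarrow> a i j \<in> hom_coords r"
      "\<And>i j. i \<in> ?I \<Longrightarrow> j \<in> ?I \<Longrightarrow> i \<noteq> j \<Longrightarrow> pt r (a i j) \<in> T i"
      "\<And>i j. i \<in> ?I \<Longrightarrow> j \<in> ?I \<Longrightarrow> pt r (a i j) \<notin> T j"
    by metis
  define cf where "cf i j k g \<longleftrightarrow> hpoly r k g \<and> (\<forall>q\<in>T j. \<forall>x\<in>q. g x = 0) \<and>
      (\<forall>x t. g (\<lambda>n. x n + t * a i j n) = g x) \<and> (\<exists>p. g p \<noteq> 0)" for i j k g
  have "\<exists>k g. cf i j k g" if "i \<in> ?I" "j \<in> ?I" for i j
    unfolding cf_def using cone[OF that(2) a(1)[OF that]] by blast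
  then obtain k g where cf: "\<And>i j. i \<in> ?I \<Longrightarrow> j \<in> ?I \<Longrightarrow> cf i j (k i j) (g i j)"
    by metis
  have g: "hpoly r (k i j) (g i j)" "\<And>q x. q \<in> T j \<Longrightarrow> x \<in> q \<Longrightarrow> g i j x = 0"
    "\<And>x t. g i j (\<lambda>n. x n + t * a i j n) = g i j x" "\<exists>p. g i j p \<noteq> 0"
    if "i \<in> ?I" "j \<in> ?I" for i j
    using cf[OF that] unfolding cf_def by blast+
  \<comment> \<open>Off every cone: the line joining p to the vertex \<open>a i j\<close> then
    misses T j.\<close>
  have "\<exists>p. p r = 1 \<and> (\<forall>i>r. p i = 0) \<and> (\<forall>ij\<in>?I \<times> ?I. g (fst ij) (snd ij) p \<noteq> 0)"
  proof (rule common_nonzero_point[where k = "\<lambda>ij. k (fst ij) (snd ij)" and g = "\<lambda>ij. g (fst ij) (snd ij)"])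
    fix ij assume "ij \<in> ?I \<times> ?I"
    then have "fst ij \<in> ?I" "snd ij \<in> ?I" by auto
    from g(1,4)[OF this] show "hpoly r (k (fst ij) (snd ij)) (g (fst ij) (snd ij)) \<and>
        (\<exists>x. g (fst ij) (snd ij) x \<noteq> 0)" by blast
  qed simp
  then obtain p where p: "p r = 1" "\<forall>i>r. p i = 0" "\<forall>ij\<in>?I \<times> ?I. g (fst ij) (snd ij) p \<noteq> 0"
    by blast
  have gp: "g i j p \<noteq> 0" if "i \<in> ?I" "j \<in> ?I" for i j
    using bspec[OF p(3), of "(i, j)"] that by simp
  define sf where "sf i j d h \<longleftrightarrow> hpoly r d h \<and> (\<forall>q\<in>T j. \<forall>x\<in>q. h (proj_from r p x) = 0) \<and>
      h (proj_from r p (a i j)) \<noteq> 0" for i j d h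
  have "\<exists>d h. sf i j d h" if ij: "i \<in> ?I" "j \<in> ?I" for i j
  proof -
    obtain e f where f: "hpoly r e f" "f (a i j) \<noteq> 0" "\<forall>q\<in>T j. \<forall>x\<in>q. f x = 0"
      using closedin_separate[OF cl[OF ij(2)] a(1,3)[OF ij]] by blast
    have "\<exists>h. polyfun r h \<and> (\<forall>x\<in>\<Union>(T j). h (\<lambda>i. x i - x r * p i) = 0) \<and>
        h (\<lambda>n. a i j n - a i j r * p n) \<noteq> 0"
      by (rule separate_projection[OF g(1)[OF ij] gp[OF ij] g(3)[OF ij] f(1,2)])
        (use g(2)[OF ij] f(3) in blast)
    then obtain h where h: "polyfun r h" "\<forall>x\<in>\<Union>(T j). h (proj_from r p x) = 0" "h (proj_from r p (a i j)) \<noteq> 0"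
      unfolding proj_from_def[abs_def] by (elim exE conjE)
    show ?thesis
      unfolding sf_def by (rule proj_from_component[OF TP[OF ij(2)] h(1,3)]) (use h(2) in blast)
  qed
  then obtain d h where sf: "\<And>i j. i \<in> ?I \<Longrightarrow> j \<in> ?I \<Longrightarrow> sf i j (d i j) (h i j)"
    by metis
  have h: "hpoly r (d i j) (h i j)" "\<And>q x. q \<in> T j \<Longrightarrow> x \<in> q \<Longrightarrow> h i j (proj_from r p x) = 0"
    "h i j (proj_from r p (a i j)) \<noteq> 0" if "i \<in> ?I" "j \<in> ?I" for i j
    using sf[OF that] unfolding sf_def by blast+
  \<comment> \<open>A vector with zero projection is a multiple of p, and p is not on T i because
    \<open>g i i\<close> vanishes on T i but not at p.\<close>
  have "\<exists>x. x \<in> \<Union>(T i) \<and> (\<exists>j<r. proj_from r p x j \<noteq> 0)" if i: "i \<in> ?I" for i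
  proof -
    have "T i \<noteq> {}" using irr[OF i] TP[OF i] by (auto simp: irreducible_in_def irreducible_space_def)
    then obtain q where q: "q \<in> T i" by blast
    then have qP: "q \<in> proj_space r" using TP[OF i] by blast
    obtain x where x: "x \<in> q" using proj_space_nonempty[OF qP] by blast
    have "\<exists>j<r. proj_from r p x j \<noteq> 0"
    proof (rule ccontr)
      assume "\<not> ?thesis"
      then have "x j = x r * p j" if "j < r" for j using that by (simp add: proj_from_def)
      moreover have xh: "x \<in> hom_coords r" by (rule point_coords[OF qP x])
      then have "x j = x r * p j" if "\<not> j < r" for j
        using that p(1) p(2) by (cases "j = r") (auto simp: hom_coords_def)
      ultimately have eq: "x = (\<lambda>j. x r * p j)" by blast
      have "g i i x = 0" by (rule g(2)[OF i i q x])
      moreover have "g i i x = x r ^ k i i * g i i p"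
        by (subst eq) (rule hpoly_scale[OF g(1)[OF i i]])
      ultimately have "x r = 0" using gp[OF i i] by simp
      then have "x j = 0" for j using fun_cong[OF eq, of j] by simp
      then show False using xh by (simp add: hom_coords_def)
    qed
    then show ?thesis using q x by blast
  qed
  then obtain b where b: "\<And>i. i \<in> ?I \<Longrightarrow> b i \<in> \<Union>(T i)"
      "\<And>i. i \<in> ?I \<Longrightarrow> \<exists>j<r. proj_from r p (b i) j \<noteq> 0"
    by metis
  have "\<exists>l. l 0 \<noteq> 0 \<and> (\<forall>i\<in>?I. (\<Sum>j<r. l j * proj_from r p (b i) j) \<noteq> 0)"
    by (rule common_nonvanishing_functional[OF _ r]) (simp, rule b(2))
  then obtain l where l: "l 0 \<noteq> 0" "\<And>i. i \<in> ?I \<Longrightarrow> (\<Sum>j<r. l j * proj_from r p (b i) j) \<noteq> 0"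
    by (elim exE conjE) simp
  show ?thesis
  proof (rule contracting_cremona[where h = h and k = d and p = p and l = l and c = of_nat])
    show "hpoly r (d i j) (h i j)" if "i \<in> ?I" "j \<in> ?I" for i j by (rule h(1)[OF that])
    show "h i j (proj_from r p x) = 0" if "i \<in> ?I" "j \<in> ?I" "q \<in> T j" "x \<in> q" for i j q x
      by (rule h(2)[OF that])
    show "\<exists>q\<in>T i. \<exists>x\<in>q. h i j (proj_from r p x) \<noteq> 0" if "i \<in> ?I" "j \<in> ?I" "i \<noteq> j" for i j
      by (rule bexI[OF _ a(2)[OF that]], rule bexI[OF _ pt_self[OF a(1)[OF that(1,2)]]])
        (rule h(3)[OF that(1,2)])
    show "\<exists>x. h i i (proj_from r p x) \<noteq> 0" if "i \<in> ?I" for i using h(3)[OF that that] by blast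
    show "\<exists>q\<in>T i. \<exists>x\<in>q. (\<Sum>j<r. l j * proj_from r p x j) \<noteq> 0" if i: "i \<in> ?I" for i
    proof -
      obtain q where "q \<in> T i" "b i \<in> q" using b(1)[OF i] by blast
      then show ?thesis using l(2)[OF i] by (intro bexI[of _ q] bexI[of _ "b i"])
    qed
    show "p i = 0" if "i > r" for i using p(2) that by blast
  qed (use r False irr p(1) l(1) in \<open>simp_all add: inj_on_def\<close>)
qed

end
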